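(* Let $1<p<\infty$, $\frac1p+\frac1{p'}=1$, $\gamma>0$, and let $\mu$ be a finite positive Borel measure on $[0,1)$. Put $$s=\gamma+\frac1p,\qquad a_j=1-2^{-j},\qquad b_j=2^{js}\mu([a_j,1)),\quad j\ge0.$$ Then the following assertions are equivalent: (i) $\mathcal C_{\mu,\gamma}:H^p\to H^\infty$ is bounded; (ii) $\mathcal C_{\mu,\gamma}:H^p\to H^\infty$ is compact; (iii) $b=\{b_j\}_{j\ge0}\in\ell^{p'}$; (iv) $\displaystyle\int_0^1\left(\frac{\mu([t,1))}{(1-t)^{\gamma+1}}\right)^{p'}dt<\infty$; (v) $F_{\mu,\gamma+1}\in H^{p'}$; (vi) $\displaystyle\sum_{n=0}^\infty(n+1)^{p'(\gamma+1)-2}\mu_n^{p'}<\infty$. Moreover, $$\|\mathcal C_{\mu,\gamma}\|_{H^p\to H^\infty}\asymp\|F_{\mu,\gamma+1}\|_{H^{p'}}\asymp\|P_{\mu,\gamma+1}\|_{L^{p'}(\mathbb T)}\asymp\|b\|_{\ell^{p'}}\asymp\left(\sum_{n=0}^\infty(n+1)^{p'(\gamma+1)-2}\mu_n^{p'}\right)^{1/p'}$$ $$\asymp\left[\mu([0,1))^{p'}+\int_0^1\left(\frac{\mu([t,1))}{(1-t)^{\gamma+1}}\right)^{p'}dt\right]^{1/p'},$$ where the comparison constants depend only on $p$ and $\gamma$.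
   Context: $\mathbb D$ is the open unit disc in $\mathbb C$ and $\mathbb T=\partial\mathbb D$ carries normalized arc measure $d\theta/(2\pi)$. For $0<p<\infty$, $H^p$ is the Hardy space of analytic functions $f$ on $\mathbb D$ with $\|f\|_{H^p}=\sup_{0\le\rho<1}\left(\frac1{2\pi}\int_0^{2\pi}|f(\rho e^{i\theta})|^p\,d\theta\right)^{1/p}<\infty$; $H^\infty$ is the space of bounded analytic functions with the supremum norm. For a finite positive Borel measure $\mu$ on $[0,1)$ put $\mu_n=\int_{[0,1)}t^n\,d\mu(t)$, $n\ge0$. For $\gamma>0$ and $f(z)=\sum_{k\ge0}a_kz^k$ analytic in $\mathbb D$, the generalized Cesàro operator is $$\mathcal C_{\mu,\gamma}f(z)=\sum_{n=0}^\infty\mu_n\left(\sum_{k=0}^n\frac{\Gamma(n-k+\gamma)}{\Gamma(\gamma)(n-k)!}a_k\right)z^n=\int_{[0,1)}\frac{f(tz)}{(1-tz)^\gamma}\,d\mu(t),\qquad z\in\mathbb D.$$ For $\alpha>0$, $$F_{\mu,\alpha}(z)=\mathcal C_{\mu,\alpha}(1)(z)=\int_{[0,1)}\frac{d\mu(t)}{(1-tz)^\alpha}\quad(z\in\mathbb D),\qquad P_{\mu,\alpha}(e^{i\theta})=\int_{[0,1)}\frac{d\mu(t)}{|1-te^{i\theta}|^\alpha}.$$ $\|\mathcal C_{\mu,\gamma}\|_{H^p\to H^\infty}$ is the least constant $C$ with $\|\mathcal C_{\mu,\gamma}f\|_{H^\infty}\le C\|f\|_{H^p}$ for all $f\in H^p$.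 $X\asymp Y$ means $C^{-1}Y\le X\le CY$ with a constant $C>0$ independent of the functions, measures and indices under consideration. *)

theory Defs
  imports "HOL-Complex_Analysis.Complex_Analysis"
begin

text \<open>All (quasi-)norms take values in \<^typ>\<open>ennreal\<close>, so that \<open>\<infinity>\<close> stands for ``not in the space'';
  \<open>enn_powr\<close> extends \<open>powr\<close> to that range and is only used with positive exponents.\<close>

definition enn_powr :: "ennreal \<Rightarrow> real \<Rightarrow> ennreal" where
  "enn_powr x r = (if x = \<infinity> then \<infinity> else ennreal (enn2real x powr r))"

definition circle_Lq_norm :: "real \<Rightarrow> (complex \<Rightarrow> ennreal) \<Rightarrow> ennreal" where
  "circle_Lq_norm q u =
     enn_powr (ennreal (1 / (2 * pi)) *
       (\<integral>\<^sup>+\<theta>\<in>{0..2*pi}. enn_powr (u (cis \<theta>)) q \<partial>lborel)) (1 / q)"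

definition Hardy_norm :: "real \<Rightarrow> (complex \<Rightarrow> complex) \<Rightarrow> ennreal" where
  "Hardy_norm p f =
     (SUP \<rho>\<in>{0..<1}. circle_Lq_norm p (\<lambda>\<zeta>. ennreal (norm (f (complex_of_real \<rho> * \<zeta>)))))"

text \<open>Elements of the Hardy spaces are functions on \<open>\<complex>\<close> of which only the restriction to the unit
  disc matters.\<close>

definition Hardy :: "real \<Rightarrow> (complex \<Rightarrow> complex) set" where
  "Hardy p = {f. f holomorphic_on ball 0 1 \<and> Hardy_norm p f < \<infinity>}"

definition Hinf_norm :: "(complex \<Rightarrow> complex) \<Rightarrow> ennreal" where
  "Hinf_norm f = (SUP z\<in>ball 0 1. ennreal (norm (f z)))"

definition Hinf :: "(complex \<Rightarrow> complex) set" where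
  "Hinf = {f. f holomorphic_on ball 0 1 \<and> Hinf_norm f < \<infinity>}"

definition bounded_Hardy_Hinf :: "real \<Rightarrow> ((complex \<Rightarrow> complex) \<Rightarrow> complex \<Rightarrow> complex) \<Rightarrow> bool" where
  "bounded_Hardy_Hinf p T \<longleftrightarrow> (\<forall>f\<in>Hardy p. T f \<in> Hinf) \<and>
     (\<exists>C::real. C \<ge> 0 \<and> (\<forall>f\<in>Hardy p. Hinf_norm (T f) \<le> ennreal C * Hardy_norm p f))"

definition compact_Hardy_Hinf :: "real \<Rightarrow> ((complex \<Rightarrow> complex) \<Rightarrow> complex \<Rightarrow> complex) \<Rightarrow> bool" where
  "compact_Hardy_Hinf p T \<longleftrightarrow> (\<forall>f\<in>Hardy p. T f \<in> Hinf) \<and>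
     (\<forall>F :: nat \<Rightarrow> complex \<Rightarrow> complex.
        (\<forall>n. F n \<in> Hardy p) \<and> (\<exists>M::real. \<forall>n. Hardy_norm p (F n) \<le> ennreal M) \<longrightarrow>
        (\<exists>r g. strict_mono (r :: nat \<Rightarrow> nat) \<and> g \<in> Hinf \<and>
           (\<lambda>n. Hinf_norm (\<lambda>z. T (F (r n)) z - g z)) \<longlonglongrightarrow> 0))"

text \<open>The least admissible constant, equal to \<open>\<infinity>\<close> if no finite constant is admissible.\<close>

definition Hardy_Hinf_opnorm :: "real \<Rightarrow> ((complex \<Rightarrow> complex) \<Rightarrow> complex \<Rightarrow> complex) \<Rightarrow> ennreal" where
  "Hardy_Hinf_opnorm p T = Inf {C. \<forall>f\<in>Hardy p. Hinf_norm (T f) \<le> C * Hardy_norm p f}"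

definition finite_borel_measure_01 :: "real measure \<Rightarrow> bool" where
  "finite_borel_measure_01 \<mu> \<longleftrightarrow>
     finite_measure \<mu> \<and> sets \<mu> = sets (restrict_space borel {0..<1})"

definition moment :: "real measure \<Rightarrow> nat \<Rightarrow> real" where
  "moment \<mu> n = (\<integral>t. t ^ n \<partial>\<mu>)"

definition taylor_coeff :: "(complex \<Rightarrow> complex) \<Rightarrow> nat \<Rightarrow> complex" where
  "taylor_coeff f k = (deriv ^^ k) f 0 / fact k"

definition Cesaro_op :: "real measure \<Rightarrow> real \<Rightarrow> (complex \<Rightarrow> complex) \<Rightarrow> complex \<Rightarrow> complex" where
  "Cesaro_op \<mu> \<gamma> f z =
     (\<Sum>n. complex_of_real (moment \<mu> n) *
       (\<Sum>k\<le>n. complex_of_real (Gamma (real (n - k) + \<gamma>) / (Gamma \<gamma> * fact (n - k))) * taylor_coeff f k)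
       * z ^ n)"

definition F_fun :: "real measure \<Rightarrow> real \<Rightarrow> complex \<Rightarrow> complex" where
  "F_fun \<mu> \<alpha> = Cesaro_op \<mu> \<alpha> (\<lambda>z. 1)"

text \<open>\<open>P_fun\<close> may be infinite at \<open>\<zeta> = 1\<close>.\<close>

definition P_fun :: "real measure \<Rightarrow> real \<Rightarrow> complex \<Rightarrow> ennreal" where
  "P_fun \<mu> \<alpha> \<zeta> = (\<integral>\<^sup>+t. ennreal (1 / norm (1 - complex_of_real t * \<zeta>) powr \<alpha>) \<partial>\<mu>)"

definition seq_lq_norm :: "real \<Rightarrow> (nat \<Rightarrow> real) \<Rightarrow> ennreal" where
  "seq_lq_norm q x = enn_powr (\<Sum>j. ennreal (\<bar>x j\<bar> powr q)) (1 / q)"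

definition dyadic_seq :: "real measure \<Rightarrow> real \<Rightarrow> nat \<Rightarrow> real" where
  "dyadic_seq \<mu> s j = 2 powr (real j * s) * measure \<mu> {1 - 2 powr (- real j)..<1}"

definition tail_integral :: "real measure \<Rightarrow> real \<Rightarrow> real \<Rightarrow> ennreal" where
  "tail_integral \<mu> \<gamma> q =
     (\<integral>\<^sup>+t\<in>{0..<1}. ennreal ((measure \<mu> {t..<1} / (1 - t) powr (\<gamma> + 1)) powr q) \<partial>lborel)"

definition moment_sum :: "real measure \<Rightarrow> real \<Rightarrow> real \<Rightarrow> ennreal" where
  "moment_sum \<mu> \<gamma> q =
     (\<Sum>n. ennreal (real (n + 1) powr (q * (\<gamma> + 1) - 2) * moment \<mu> n powr q))"

definition comparable :: "real \<Rightarrow> ennreal \<Rightarrow> ennreal \<Rightarrow> bool" where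
  "comparable K X Y \<longleftrightarrow> X \<le> ennreal K * Y \<and> Y \<le> ennreal K * X"

text \<open>The integral forms of the operator and of \<^const>\<open>F_fun\<close>, with the principal branch of the
  power.\<close>

lemma Cesaro_op_sums_integral:
  assumes \<mu>: "finite_borel_measure_01 \<mu>" and \<gamma>: "\<gamma> > 0"
    and f: "f holomorphic_on ball 0 1" and z: "z \<in> ball 0 1"
  shows "(\<lambda>n. complex_of_real (moment \<mu> n) *
       (\<Sum>k\<le>n. complex_of_real (Gamma (real (n - k) + \<gamma>) / (Gamma \<gamma> * fact (n - k))) * taylor_coeff f k)
       * z ^ n) sums
     (\<integral>t. f (complex_of_real t * z) / (1 - complex_of_real t * z) powr complex_of_real \<gamma> \<partial>\<mu>)"
proof -
  interpret finite_measure \<mu> using \<mu> by (simp add: finite_borel_measure_01_def)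
  have sets: "sets \<mu> = sets (restrict_space borel {0..<1})"
    using \<mu> by (simp add: finite_borel_measure_01_def)
  have sp: "space \<mu> = {0..<1}"
    using sets_eq_imp_space_eq[OF sets] by (simp add: space_restrict_space)
  have id_meas: "(\<lambda>t. t) \<in> borel_measurable \<mu>"
    using measurable_restrict_space1[of "\<lambda>t::real. t" borel borel "{0..<1}"]
      measurable_cong_sets[OF sets refl] by auto
  define c where "c k = Gamma (real k + \<gamma>) / (Gamma \<gamma> * fact k)" for k
  define A where "A k = taylor_coeff f k * z ^ k" for k
  define B where "B k = complex_of_real (c k) * z ^ k" for k
  define D where "D n = (\<Sum>k\<le>n. A k * B (n - k))" for n
  have fsums: "(\<lambda>k. taylor_coeff f k * w ^ k) sums f w" if "w \<in> ball 0 1" for w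
    using holomorphic_power_series[OF f that] by (simp add: taylor_coeff_def)
  have c_eq: "complex_of_real (c k) * w ^ k = ((- complex_of_real \<gamma>) gchoose k) * (- w) ^ k" for k w
  proof -
    have "pochhammer \<gamma> k = Gamma (\<gamma> + real k) / Gamma \<gamma>"
      using \<gamma> by (intro pochhammer_Gamma) auto
    hence "c k = pochhammer \<gamma> k / fact k"
      by (simp add: c_def add.commute)
    hence "complex_of_real (c k) = pochhammer (complex_of_real \<gamma>) k / fact k"
      by (simp add: pochhammer_of_real)
    moreover have "(- 1) ^ k * (- w) ^ k = w ^ k"
      by (simp flip: power_mult_distrib)
    ultimately show ?thesis
      by (simp only: gbinomial_pochhammer minus_minus times_divide_eq_left mult.assoc mult.left_commute)
  qed
  have csums: "(\<lambda>k. complex_of_real (c k) * w ^ k) sums ((1 - w) powr (- complex_of_real \<gamma>))"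
    if "w \<in> ball 0 1" for w
    unfolding c_eq using gen_binomial_complex[of "- w" "- complex_of_real \<gamma>"] that by simp
  obtain r where r: "norm z < r" "r < 1"
    using z dense[of "norm z" 1] by auto
  have r0: "r \<ge> 0" using r norm_ge_zero[of z] by linarith
  have rb: "complex_of_real r \<in> ball 0 1" and zr: "norm z < norm (complex_of_real r)"
    using r r0 by simp_all
  have sA: "summable (\<lambda>k. norm (A k))"
    unfolding A_def by (rule powser_insidea[OF sums_summable[OF fsums[OF rb]] zr])
  have sB: "summable (\<lambda>k. norm (B k))"
    unfolding B_def by (rule powser_insidea[OF sums_summable[OF csums[OF rb]] zr])
  have sD: "summable (\<lambda>n. norm (D n))"
  proof (rule summable_comparison_test)
    have "summable (\<lambda>n. \<Sum>k\<le>n. norm (A k) * norm (B (n - k)))"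
      using summable_Cauchy_product[of "\<lambda>k. norm (A k)" "\<lambda>k. norm (B k)"] sA sB by simp
    thus "summable (\<lambda>n. \<Sum>k\<le>n. norm (A k) * norm (B (n - k)))" .
    show "\<exists>N. \<forall>n\<ge>N. norm (norm (D n)) \<le> (\<Sum>k\<le>n. norm (A k) * norm (B (n - k)))"
      unfolding D_def by (auto intro!: sum_norm_le simp: norm_mult)
  qed
  have pt: "(\<lambda>n. complex_of_real (t ^ n) * D n) sums
      (f (complex_of_real t * z) / (1 - complex_of_real t * z) powr complex_of_real \<gamma>)"
    if t: "t \<in> {0..<1}" for t
  proof -
    have le: "norm (complex_of_real t * z) \<le> norm z"
      using t by (simp add: norm_mult mult_left_le_one_le)
    hence w: "complex_of_real t * z \<in> ball 0 1" using z by simp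
    have w1: "norm (complex_of_real t * z) < norm (complex_of_real r)"
      using le zr by linarith
    have eq: "(\<Sum>k\<le>n. (taylor_coeff f k * (complex_of_real t * z) ^ k) *
        (complex_of_real (c (n - k)) * (complex_of_real t * z) ^ (n - k))) = complex_of_real (t ^ n) * D n" for n
      unfolding D_def A_def B_def sum_distrib_left
    proof (rule sum.cong[OF refl])
      fix k assume "k \<in> {..n}"
      hence "t ^ n = t ^ k * t ^ (n - k)" by (simp flip: power_add)
      thus "(taylor_coeff f k * (complex_of_real t * z) ^ k) *
        (complex_of_real (c (n - k)) * (complex_of_real t * z) ^ (n - k)) =
        complex_of_real (t ^ n) * (taylor_coeff f k * z ^ k * (complex_of_real (c (n - k)) * z ^ (n - k)))"
        by (simp add: power_mult_distrib)
    qed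
    have "(\<lambda>n. complex_of_real (t ^ n) * D n) sums
       ((\<Sum>k. taylor_coeff f k * (complex_of_real t * z) ^ k) * (\<Sum>k. complex_of_real (c k) * (complex_of_real t * z) ^ k))"
      unfolding eq[symmetric]
      by (rule Cauchy_product_sums[OF powser_insidea[OF sums_summable[OF fsums[OF rb]] w1]
            powser_insidea[OF sums_summable[OF csums[OF rb]] w1]])
    thus ?thesis
      by (simp add: sums_unique[OF fsums[OF w], symmetric] sums_unique[OF csums[OF w], symmetric]
          powr_minus divide_inverse)
  qed
  have integ_pow: "integrable \<mu> (\<lambda>t. t ^ n)" for n
    by (rule integrable_const_bound[of _ 1])
      (use id_meas in \<open>auto simp: sp power_le_one intro!: AE_I2\<close>)
  have integ: "integrable \<mu> (\<lambda>t. complex_of_real (t ^ n) * D n)" for n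
    by (intro integrable_mult_left integrable_of_real integ_pow)
  have val: "(\<integral>t. complex_of_real (t ^ n) * D n \<partial>\<mu>) = complex_of_real (moment \<mu> n) * D n" for n
    using integral_of_real[OF integ_pow[of n], where 'a = complex] by (simp add: moment_def)
  have "(\<lambda>n. \<integral>t. complex_of_real (t ^ n) * D n \<partial>\<mu>) sums (\<integral>t. (\<Sum>n. complex_of_real (t ^ n) * D n) \<partial>\<mu>)"
  proof (rule sums_integral[OF integ])
    show "AE t in \<mu>. summable (\<lambda>n. norm (complex_of_real (t ^ n) * D n))"
    proof (rule AE_I2)
      fix t assume "t \<in> space \<mu>"
      thus "summable (\<lambda>n. norm (complex_of_real (t ^ n) * D n))"
        by (intro summable_comparison_test[OF _ sD])
          (auto simp: sp norm_mult norm_power intro!: mult_left_le_one_le power_le_one)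
    qed
    have b: "(\<integral>t. norm (complex_of_real (t ^ n) * D n) \<partial>\<mu>) \<le> measure \<mu> (space \<mu>) * norm (D n)" for n
    proof -
      have "(\<integral>t. norm (complex_of_real (t ^ n) * D n) \<partial>\<mu>) \<le> (\<integral>t. norm (D n) \<partial>\<mu>)"
        by (rule integral_mono[OF integrable_norm[OF integ]])
          (auto simp: sp norm_mult norm_power intro!: mult_left_le_one_le power_le_one)
      thus ?thesis by simp
    qed
    show "summable (\<lambda>n. \<integral>t. norm (complex_of_real (t ^ n) * D n) \<partial>\<mu>)"
      by (rule summable_comparison_test[OF _ summable_mult[OF sD, of "measure \<mu> (space \<mu>)"]])
        (use b in \<open>auto intro!: exI[of _ 0] simp: abs_of_nonneg integral_nonneg_AE\<close>)
  qed
  also have "(\<integral>t. (\<Sum>n. complex_of_real (t ^ n) * D n) \<partial>\<mu>) =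
     (\<integral>t. f (complex_of_real t * z) / (1 - complex_of_real t * z) powr complex_of_real \<gamma> \<partial>\<mu>)"
    by (rule Bochner_Integration.integral_cong[OF refl]) (use pt in \<open>auto simp: sp sums_iff\<close>)
  also have "(\<lambda>n. \<integral>t. complex_of_real (t ^ n) * D n \<partial>\<mu>) = (\<lambda>n. complex_of_real (moment \<mu> n) *
       (\<Sum>k\<le>n. complex_of_real (Gamma (real (n - k) + \<gamma>) / (Gamma \<gamma> * fact (n - k))) * taylor_coeff f k)
       * z ^ n)"
  proof
    fix n
    have "D n = (\<Sum>k\<le>n. complex_of_real (c (n - k)) * taylor_coeff f k) * z ^ n"
      unfolding D_def A_def B_def sum_distrib_right
    proof (rule sum.cong[OF refl])
      fix k assume "k \<in> {..n}"
      hence "z ^ n = z ^ k * z ^ (n - k)" by (simp flip: power_add)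
      thus "taylor_coeff f k * z ^ k * (complex_of_real (c (n - k)) * z ^ (n - k)) =
         complex_of_real (c (n - k)) * taylor_coeff f k * z ^ n" by simp
    qed
    thus "(\<integral>t. complex_of_real (t ^ n) * D n \<partial>\<mu>) = complex_of_real (moment \<mu> n) *
       (\<Sum>k\<le>n. complex_of_real (Gamma (real (n - k) + \<gamma>) / (Gamma \<gamma> * fact (n - k))) * taylor_coeff f k)
       * z ^ n"
      unfolding val by (simp add: c_def mult.assoc)
  qed
  finally show ?thesis .
qed

lemma Cesaro_op_eq_integral:
  assumes "finite_borel_measure_01 \<mu>" "\<gamma> > 0" "f holomorphic_on ball 0 1" "z \<in> ball 0 1"
  shows "Cesaro_op \<mu> \<gamma> f z =
     (\<integral>t. f (complex_of_real t * z) / (1 - complex_of_real t * z) powr complex_of_real \<gamma> \<partial>\<mu>)"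
  using sums_unique[OF Cesaro_op_sums_integral[OF assms]] by (simp add: Cesaro_op_def)

lemma F_fun_eq_integral:
  assumes "finite_borel_measure_01 \<mu>" "\<alpha> > 0" "z \<in> ball 0 1"
  shows "F_fun \<mu> \<alpha> z =
     (\<integral>t. 1 / (1 - complex_of_real t * z) powr complex_of_real \<alpha> \<partial>\<mu>)"
  using Cesaro_op_eq_integral[OF assms(1,2) _ assms(3), of "\<lambda>z. 1"] by (simp add: F_fun_def)

end

theory Submission
  imports Defs
begin

text \<open>
  Write \<open>q = p'\<close>, \<open>\<alpha> = \<gamma> + 1\<close>, \<open>a\<^sub>j = 1 - 2\<^sup>-\<^sup>j\<close>. Everything is compared with \<open>\<parallel>b\<parallel>\<close> and \<open>\<parallel>P\<parallel>\<close>, where \<open>P = P_fun \<mu> \<alpha>\<close>.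

  Cauchy's formula for \<open>w \<mapsto> f (z w) / (1 - t w)\<^sup>\<gamma>\<close> at \<open>w = t\<close> bounds \<open>\<bar>f (t z)\<bar> (1 - t)\<^sup>-\<^sup>\<gamma>\<close> by a constant times
  the mean of \<open>\<bar>f (z \<zeta>)\<bar> \<bar>1 - t \<zeta>\<bar>\<^sup>-\<^sup>\<alpha>\<close> over the circle. Integrating in \<open>\<mu>\<close> and applying Hoelder's inequality
  bounds the operator norm by \<open>\<parallel>P\<parallel>\<close>, and \<open>\<parallel>F\<parallel>\<close> is bounded by \<open>\<parallel>P\<parallel>\<close> pointwise. In turn \<open>\<parallel>P\<parallel>\<close> is bounded by
  \<open>\<parallel>b\<parallel>\<close>: on the arcs \<open>\<bar>1 - \<zeta>\<bar> \<approx> 2\<^sup>-\<^sup>k\<close> the kernel is a convolution with a geometric sequence.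

  The same bound, used with exponent \<open>p\<close>, \<open>\<alpha> = 1\<close> and discrete measures on the points \<open>a\<^sub>j\<close>, controls the
  test functions \<open>\<Sum>\<^sub>j g\<^sub>j / (1 - a\<^sub>j z)\<close> and yields a Fejer--Riesz inequality; by duality \<open>\<parallel>b\<parallel>\<close> is bounded
  both by the operator norm and by \<open>\<parallel>F\<parallel>\<close>. The moments and the tail integral are inserted by elementary
  estimates \<open>\<parallel>b\<parallel> \<lesssim> tail integral \<lesssim> moments \<lesssim> \<parallel>P\<parallel>\<close>.
\<close>

section \<open>Powers and Hoelder's inequality for extended nonnegative functions\<close>

text \<open>The exponent \<open>s = \<alpha> - 1/q = \<gamma> + 1/p\<close> comes from a balance.
  Where \<open>\<bar>1 - \<zeta>\<bar>\<close> has size \<open>2^-k\<close>, the kernel of the point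
  \<open>a_j\<close> has size \<open>2^(\<alpha> min(j,k))\<close>, and the arc has length of order
  \<open>2^-k\<close>. After normalization by \<open>2^(k/q)\<close> and \<open>2^(j s)\<close> the
  matrix decays at rate \<open>1/q\<close> for \<open>j \<le> k\<close> and at rate
  \<open>\<alpha> - 1/q\<close> for \<open>j > k\<close>; both rates are positive because
  \<open>\<alpha> > 1/q\<close>. The lower bounds rest on positivity: at real points of the disc all
  integrands are positive, so nothing cancels and the range may be cut down to
  \<open>t \<ge> a_j\<close>. Hardy norms are suprema over circles of radius less than 1, so
  functions are tested at real points carrying an extra factor \<open>a_J\<close>, where
  \<open>J\<close> is the last index of a finite sum, or radius \<open>\<rho>\<close> is compared
  with radius 1. This costs only powers of 3 and 2. Duality is applied to finite sums, where
  division is legitimate.\<close>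

lemma enn_powr_ennreal: "x \<ge> 0 \<Longrightarrow> enn_powr (ennreal x) r = ennreal (x powr r)"
  by (simp add: enn_powr_def)

lemma enn_powr_top [simp]: "enn_powr \<infinity> r = \<infinity>" "enn_powr top r = top"
  by (simp_all add: enn_powr_def)

lemma enn_powr_0 [simp]: "enn_powr 0 r = 0"
  by (simp add: enn_powr_def)

lemma enn_powr_eq_top_iff [simp]: "enn_powr x r = top \<longleftrightarrow> x = top"
  by (simp add: enn_powr_def)

lemma enn_powr_less_top_iff: "enn_powr x r < \<infinity> \<longleftrightarrow> x < \<infinity>"
  by (cases x) (auto simp: enn_powr_ennreal)

lemma enn_powr_eq_0_iff [simp]: "enn_powr x r = 0 \<longleftrightarrow> x = 0"
  by (cases x) (auto simp: enn_powr_def)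

lemma enn_powr_1 [simp]: "enn_powr x 1 = x"
  by (cases x) (auto simp: enn_powr_def)

lemma enn_powr_mono: "r \<ge> 0 \<Longrightarrow> x \<le> y \<Longrightarrow> enn_powr x r \<le> enn_powr y r"
  by (cases x; cases y) (auto simp: enn_powr_def top_unique intro!: ennreal_leI powr_mono2)

lemma enn_powr_mult: "enn_powr (x * y) r = enn_powr x r * enn_powr y r"
proof (cases x; cases y)
  fix a b assume "0 \<le> a" "x = ennreal a" "0 \<le> b" "y = ennreal b"
  thus ?thesis by (simp add: enn_powr_ennreal powr_mult flip: ennreal_mult)
qed (auto simp: ennreal_mult_top ennreal_top_mult enn_powr_ennreal)

lemma enn_powr_powr: "enn_powr (enn_powr x a) b = enn_powr x (a * b)"
  by (cases x) (auto simp: enn_powr_ennreal powr_powr)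

lemma enn_powr_powr_cancel [simp]:
  "r \<noteq> 0 \<Longrightarrow> enn_powr (enn_powr x r) (1 / r) = x"
  "r \<noteq> 0 \<Longrightarrow> enn_powr (enn_powr x (1 / r)) r = x"
  by (simp_all add: enn_powr_powr)

lemma enn_powr_add: "a > 0 \<Longrightarrow> b > 0 \<Longrightarrow> enn_powr x a * enn_powr x b = enn_powr x (a + b)"
  by (cases x) (auto simp: enn_powr_ennreal powr_add ennreal_mult)

lemma measurable_enn_powr [measurable]:
  assumes [measurable]: "f \<in> borel_measurable M"
  shows "(\<lambda>x. enn_powr (f x) r) \<in> borel_measurable M"
  unfolding enn_powr_def by measurable

lemma enn_powr_le_iff: "r > 0 \<Longrightarrow> enn_powr x r \<le> y \<longleftrightarrow> x \<le> enn_powr y (1 / r)"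
  using enn_powr_mono[of r x "enn_powr y (1 / r)"] enn_powr_mono[of "1 / r" "enn_powr x r" y]
  by auto

lemma conjugate_exponent_gt_1:
  assumes "p > 1" "1 / p + 1 / q = (1::real)"
  shows "q > 1"
proof -
  have "0 < 1 / p" "1 / p < 1" using assms(1) by simp_all
  hence "0 < 1 / q" "1 / q < 1" using assms(2) by linarith+
  thus ?thesis by (simp add: divide_less_eq_1)
qed

lemma ennreal_Young:
  assumes "p > 1" "1 / p + 1 / q = (1::real)"
  shows "x * y \<le> ennreal (1 / p) * enn_powr x p + ennreal (1 / q) * enn_powr y q"
proof -
  have q: "q > 1" using conjugate_exponent_gt_1[OF assms] .
  show ?thesis
  proof (cases x; cases y)
    fix a b assume "0 \<le> a" "x = ennreal a" "0 \<le> b" "y = ennreal b"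
    thus ?thesis using Youngs_inequality[of p q a b] assms q
      by (simp add: enn_powr_ennreal flip: ennreal_mult ennreal_plus)
  qed (use assms q in \<open>auto simp: ennreal_mult_top\<close>)
qed

text \<open>Young's inequality is integrated after both factors are rescaled to unit norm, which
  requires norms that are positive and finite. If one norm vanishes, the integrand is zero almost
  everywhere; if one is infinite and the other nonzero, the right side is infinite.\<close>

lemma nn_integral_Hoelder:
  assumes p: "p > 1" "1 / p + 1 / q = (1::real)"
    and [measurable]: "f \<in> borel_measurable M" "g \<in> borel_measurable M"
  shows "(\<integral>\<^sup>+x. f x * g x \<partial>M) \<le>
    enn_powr (\<integral>\<^sup>+x. enn_powr (f x) p \<partial>M) (1 / p) * enn_powr (\<integral>\<^sup>+x. enn_powr (g x) q \<partial>M) (1 / q)"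
    (is "_ \<le> enn_powr ?A _ * enn_powr ?B _")
proof -
  have q: "q > 1" using conjugate_exponent_gt_1[OF p] .
  consider "?A = 0" | "?B = 0" | "?A \<noteq> 0" "?B \<noteq> 0" "?A = \<infinity> \<or> ?B = \<infinity>"
    | "?A \<noteq> 0" "?B \<noteq> 0" "?A \<noteq> \<infinity>" "?B \<noteq> \<infinity>" by blast
  thus ?thesis
  proof cases
    case 1
    hence "AE x in M. f x = 0" by (subst (asm) nn_integral_0_iff_AE) auto
    hence "(\<integral>\<^sup>+x. f x * g x \<partial>M) = 0" by (subst nn_integral_0_iff_AE) auto
    thus ?thesis by simp
  next
    case 2
    hence "AE x in M. g x = 0" by (subst (asm) nn_integral_0_iff_AE) auto
    hence "(\<integral>\<^sup>+x. f x * g x \<partial>M) = 0" by (subst nn_integral_0_iff_AE) auto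
    thus ?thesis by simp
  next
    case 3
    thus ?thesis by (auto simp: ennreal_mult_top ennreal_top_mult)
  next
    case 4
    obtain a where a: "?A = ennreal a" "a > 0" using 4 by (cases ?A) auto
    obtain b where b: "?B = ennreal b" "b > 0" using 4 by (cases ?B) auto
    define \<alpha> where "\<alpha> = (1 / a) powr (1 / p)"
    define \<beta> where "\<beta> = (1 / b) powr (1 / q)"
    have \<alpha>: "\<alpha> > 0" "\<alpha> powr p = 1 / a" and \<beta>: "\<beta> > 0" "\<beta> powr q = 1 / b"
      using a b p q by (auto simp: \<alpha>_def \<beta>_def powr_powr)
    have "(\<integral>\<^sup>+x. (ennreal \<alpha> * f x) * (ennreal \<beta> * g x) \<partial>M) \<le>
       (\<integral>\<^sup>+x. ennreal (1 / p) * enn_powr (ennreal \<alpha> * f x) p + ennreal (1 / q) * enn_powr (ennreal \<beta> * g x) q \<partial>M)"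
      by (intro nn_integral_mono ennreal_Young p)
    also have "\<dots> = ennreal (1 / p) * (ennreal (1 / a) * ?A) + ennreal (1 / q) * (ennreal (1 / b) * ?B)"
      using \<alpha> \<beta> by (simp add: nn_integral_add nn_integral_cmult enn_powr_mult enn_powr_ennreal)
    also have "\<dots> = 1"
      using a b p q by (simp flip: ennreal_mult ennreal_plus)
    finally have *: "(\<integral>\<^sup>+x. (ennreal \<alpha> * f x) * (ennreal \<beta> * g x) \<partial>M) \<le> 1" .
    have ab: "ennreal (1 / \<alpha>) * ennreal (1 / \<beta>) = enn_powr ?A (1 / p) * enn_powr ?B (1 / q)"
      using a b by (simp add: enn_powr_ennreal \<alpha>_def \<beta>_def powr_divide)
    have "(\<integral>\<^sup>+x. f x * g x \<partial>M) = (ennreal (1 / \<alpha>) * ennreal (1 / \<beta>) * (ennreal \<alpha> * ennreal \<beta>)) * (\<integral>\<^sup>+x. f x * g x \<partial>M)"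
      using \<alpha> \<beta> by (simp flip: ennreal_mult)
    also have "\<dots> = (ennreal (1 / \<alpha>) * ennreal (1 / \<beta>)) * ((ennreal \<alpha> * ennreal \<beta>) * (\<integral>\<^sup>+x. f x * g x \<partial>M))"
      by (simp only: mult.assoc)
    also have "(ennreal \<alpha> * ennreal \<beta>) * (\<integral>\<^sup>+x. f x * g x \<partial>M) = (\<integral>\<^sup>+x. (ennreal \<alpha> * f x) * (ennreal \<beta> * g x) \<partial>M)"
      by (simp add: nn_integral_cmult[symmetric] mult_ac)
    also have "(ennreal (1 / \<alpha>) * ennreal (1 / \<beta>)) * \<dots> \<le> (ennreal (1 / \<alpha>) * ennreal (1 / \<beta>)) * 1"
      by (intro mult_left_mono *) auto
    finally show ?thesis using ab by simp
  qed
qed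

text \<open>The normalizing factor \<open>1/(2 pi)\<close> splits into its powers \<open>1/p\<close>
  and \<open>1/q\<close>, so the normalized norms enter without a constant.\<close>

lemma circle_Hoelder:
  assumes p: "p > 1" "1 / p + 1 / q = (1::real)"
    and [measurable]: "(\<lambda>\<theta>. u (cis \<theta>)) \<in> borel_measurable borel" "(\<lambda>\<theta>. v (cis \<theta>)) \<in> borel_measurable borel"
  shows "ennreal (1 / (2 * pi)) * (\<integral>\<^sup>+\<theta>\<in>{0..2*pi}. u (cis \<theta>) * v (cis \<theta>) \<partial>lborel) \<le>
    circle_Lq_norm p u * circle_Lq_norm q v"
proof -
  have q: "q > 1" using conjugate_exponent_gt_1[OF p] .
  let ?c = "ennreal (1 / (2 * pi))"
  have ind: "enn_powr (x * indicator A t) r = enn_powr x r * indicator A t" for x A r and t :: real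
    by (auto simp: indicator_def)
  have "(\<integral>\<^sup>+\<theta>\<in>{0..2*pi}. u (cis \<theta>) * v (cis \<theta>) \<partial>lborel) =
     (\<integral>\<^sup>+\<theta>. (u (cis \<theta>) * indicator {0..2*pi} \<theta>) * (v (cis \<theta>) * indicator {0..2*pi} \<theta>) \<partial>lborel)"
    by (intro nn_integral_cong) (auto simp: indicator_def)
  also have "\<dots> \<le> enn_powr (\<integral>\<^sup>+\<theta>\<in>{0..2*pi}. enn_powr (u (cis \<theta>)) p \<partial>lborel) (1 / p) *
       enn_powr (\<integral>\<^sup>+\<theta>\<in>{0..2*pi}. enn_powr (v (cis \<theta>)) q \<partial>lborel) (1 / q)"
    using nn_integral_Hoelder[OF p, of "\<lambda>\<theta>. u (cis \<theta>) * indicator {0..2*pi} \<theta>" lborel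
       "\<lambda>\<theta>. v (cis \<theta>) * indicator {0..2*pi} \<theta>"] by (simp add: ind)
  finally have "?c * (\<integral>\<^sup>+\<theta>\<in>{0..2*pi}. u (cis \<theta>) * v (cis \<theta>) \<partial>lborel) \<le> (enn_powr ?c (1 / p) * enn_powr ?c (1 / q)) *
      (enn_powr (\<integral>\<^sup>+\<theta>\<in>{0..2*pi}. enn_powr (u (cis \<theta>)) p \<partial>lborel) (1 / p) *
       enn_powr (\<integral>\<^sup>+\<theta>\<in>{0..2*pi}. enn_powr (v (cis \<theta>)) q \<partial>lborel) (1 / q))"
    using p q by (subst enn_powr_add) (auto intro: mult_left_mono)
  thus ?thesis by (simp add: circle_Lq_norm_def enn_powr_mult mult_ac)
qed

lemma suminf_Hoelder:
  assumes p: "p > 1" "1 / p + 1 / q = (1::real)"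
  shows "(\<Sum>n. f n * g n) \<le> enn_powr (\<Sum>n. enn_powr (f n) p) (1 / p) * enn_powr (\<Sum>n. enn_powr (g n) q) (1 / q)"
  using nn_integral_Hoelder[OF p, of f "count_space UNIV" g] by (simp add: nn_integral_count_space_nat)

section \<open>The dyadic kernel on the circle\<close>

text \<open>The sets may overlap: for the upper bound it is enough that each covered point selects
  one term of the series.\<close>

lemma nn_integral_cover_le:
  assumes A: "\<And>k::nat. A k \<in> sets M"
    and cover: "AE x in M. x \<in> B \<longrightarrow> (\<exists>k. x \<in> A k)"
    and le: "\<And>k x. x \<in> A k \<Longrightarrow> f x \<le> c k"
  shows "(\<integral>\<^sup>+x\<in>B. f x \<partial>M) \<le> (\<Sum>k. c k * emeasure M (A k))"
proof -
  have "(\<integral>\<^sup>+x\<in>B. f x \<partial>M) \<le> (\<integral>\<^sup>+x. (\<Sum>k. c k * indicator (A k) x) \<partial>M)"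
  proof (rule nn_integral_mono_AE, use cover in eventually_elim)
    case (elim x)
    show ?case
    proof (cases "x \<in> B")
      case True
      then obtain k where k: "x \<in> A k" using elim by blast
      have "f x * indicator B x \<le> c k * indicator (A k) x" using le[OF k] True k by simp
      also have "\<dots> = (\<Sum>i\<in>{k}. c i * indicator (A i) x)"
        using sum.insert[of "{}" k "\<lambda>i. c i * indicator (A i) x"] by (simp only: finite.emptyI empty_iff not_False_eq_True sum.empty add_0_right simp_thms)
      also have "\<dots> \<le> (\<Sum>i. c i * indicator (A i) x)" by (rule sum_le_suminf) auto
      finally show ?thesis .
    qed auto
  qed
  also have "\<dots> = (\<Sum>k. c k * emeasure M (A k))"
    using A by (subst nn_integral_suminf) (auto simp: nn_integral_cmult_indicator)
  finally show ?thesis .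
qed

lemma nn_integral_disjoint_ge:
  assumes A: "\<And>k::nat. A k \<in> sets M" "disjoint_family A" "\<And>k. A k \<subseteq> B"
    and le: "\<And>k x. x \<in> A k \<Longrightarrow> c k \<le> f x"
  shows "(\<Sum>k. c k * emeasure M (A k)) \<le> (\<integral>\<^sup>+x\<in>B. f x \<partial>M)"
proof -
  have "(\<Sum>k. c k * emeasure M (A k)) = (\<integral>\<^sup>+x. (\<Sum>k. c k * indicator (A k) x) \<partial>M)"
    using A by (subst nn_integral_suminf) (auto simp: nn_integral_cmult_indicator)
  also have "\<dots> \<le> (\<integral>\<^sup>+x\<in>B. f x \<partial>M)"
  proof (rule nn_integral_mono)
    fix x
    show "(\<Sum>k. c k * indicator (A k) x) \<le> f x * indicator B x"
    proof (cases "\<exists>k. x \<in> A k")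
      case True
      then obtain k where k: "x \<in> A k" by blast
      have "i = k" if "x \<in> A i" for i
        using A(2) k that by (auto simp: disjoint_family_on_def)
      hence "(\<Sum>i. c i * indicator (A i) x) = (\<Sum>i\<in>{k}. c i * indicator (A i) x)"
        by (intro suminf_finite) (auto simp: indicator_def)
      thus ?thesis using k le[OF k] A(3)[of k] by (auto simp: indicator_def)
    qed auto
  qed
  finally show ?thesis .
qed

section \<open>Discrete convolution with a geometric sequence\<close>

lemma suminf_ennreal_swap:
  fixes f :: "nat \<Rightarrow> nat \<Rightarrow> ennreal"
  shows "(\<Sum>i. \<Sum>j. f i j) = (\<Sum>j. \<Sum>i. f i j)"
  using nn_integral_suminf[of "\<lambda>i j. f i j" "count_space UNIV"]
  by (simp add: nn_integral_count_space_nat)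

definition nat_dist :: "nat \<Rightarrow> nat \<Rightarrow> nat" where
  "nat_dist j k = (if j \<le> k then k - j else j - k)"

lemma nat_dist_commute: "nat_dist j k = nat_dist k j"
  by (auto simp: nat_dist_def)

text \<open>The sum splits at \<open>k\<close> into two geometric series, the lower one read
  backwards; each is at most \<open>1/(1 - r)\<close>.\<close>

lemma suminf_power_nat_dist_le:
  fixes r :: real
  assumes "0 < r" "r < 1"
  shows "(\<Sum>j. ennreal (r ^ nat_dist j k)) \<le> ennreal (2 / (1 - r))"
proof -
  have geo: "(\<Sum>j. ennreal (r ^ j)) = ennreal (1 / (1 - r))"
    using assms by (simp add: suminf_ennreal_eq geometric_sums)
  have "(\<Sum>j. ennreal (r ^ nat_dist j k)) =
      (\<Sum>j. ennreal (r ^ nat_dist (j + k) k)) + (\<Sum>j<k. ennreal (r ^ nat_dist j k))"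
    by (rule suminf_offset) auto
  also have "(\<Sum>j. ennreal (r ^ nat_dist (j + k) k)) = (\<Sum>j. ennreal (r ^ j))"
    by (intro suminf_cong) (auto simp: nat_dist_def)
  also have "(\<Sum>j<k. ennreal (r ^ nat_dist j k)) = (\<Sum>j<k. ennreal (r ^ Suc (k - Suc j)))"
  proof (intro sum.cong refl)
    fix j assume "j \<in> {..<k}"
    hence "nat_dist j k = Suc (k - Suc j)" unfolding nat_dist_def lessThan_iff by arith
    thus "ennreal (r ^ nat_dist j k) = ennreal (r ^ Suc (k - Suc j))" by (simp only:)
  qed
  also have "\<dots> = (\<Sum>j<k. ennreal (r ^ Suc j))"
    by (rule sum.nat_diff_reindex)
  also have "\<dots> \<le> (\<Sum>j<k. ennreal (r ^ j))"
    using assms by (intro sum_mono ennreal_leI power_decreasing) auto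
  also have "\<dots> \<le> (\<Sum>j. ennreal (r ^ j))" by (rule sum_le_suminf) auto
  finally have "(\<Sum>j. ennreal (r ^ nat_dist j k)) \<le> ennreal (1 / (1 - r)) + ennreal (1 / (1 - r))"
    unfolding geo by (simp add: add_left_mono)
  also have "\<dots> = ennreal (2 / (1 - r))"
    using assms by (subst ennreal_plus[symmetric]) auto
  finally show ?thesis .
qed

text \<open>The weight is split as \<open>w = w^(1/p) w^(1/q)\<close>. Hoelder turns the
  \<open>q\<close>-th power into \<open>W^(q/p) = W^(q-1)\<close> times a weighted sum, and
  exchanging the sums yields the last factor \<open>W\<close>, because rows and columns of the
  symmetric matrix have the same bound.\<close>

lemma discrete_Young:
  fixes r :: real and y :: "nat \<Rightarrow> ennreal"
  assumes p: "p > 1" "1 / p + 1 / q = (1::real)" and r: "0 < r" "r < 1"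
  shows "(\<Sum>k. enn_powr (\<Sum>j. ennreal (r ^ nat_dist j k) * y j) q) \<le>
           ennreal ((2 / (1 - r)) powr q) * (\<Sum>j. enn_powr (y j) q)"
proof -
  have q: "q > 1" by (rule conjugate_exponent_gt_1[OF p])
  define W where "W = 2 / (1 - r)"
  have W: "W > 0" using r by (simp add: W_def)
  have qp: "q / p = q - 1" using p q by (simp add: field_simps)
  have "enn_powr (\<Sum>j. ennreal (r ^ nat_dist j k) * y j) q \<le>
      ennreal (W powr (q - 1)) * (\<Sum>j. ennreal (r ^ nat_dist j k) * enn_powr (y j) q)" for k
  proof -
    define w where "w j = ennreal (r ^ nat_dist j k)" for j
    have "(\<Sum>j. w j * y j) = (\<Sum>j. enn_powr (w j) (1 / p) * (enn_powr (w j) (1 / q) * y j))"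
      using p q by (simp add: mult.assoc[symmetric] enn_powr_add)
    also have "\<dots> \<le> enn_powr (\<Sum>j. w j) (1 / p) * enn_powr (\<Sum>j. w j * enn_powr (y j) q) (1 / q)"
      using suminf_Hoelder[OF p, of "\<lambda>j. enn_powr (w j) (1 / p)" "\<lambda>j. enn_powr (w j) (1 / q) * y j"] p q
      by (simp add: enn_powr_mult enn_powr_powr)
    finally have "enn_powr (\<Sum>j. w j * y j) q \<le> enn_powr \<dots> q" using q by (intro enn_powr_mono) auto
    also have "\<dots> = enn_powr (\<Sum>j. w j) (q - 1) * (\<Sum>j. w j * enn_powr (y j) q)"
      using q qp by (simp add: enn_powr_mult enn_powr_powr)
    also have "enn_powr (\<Sum>j. w j) (q - 1) \<le> enn_powr (ennreal W) (q - 1)"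
      using q suminf_power_nat_dist_le[OF r] by (intro enn_powr_mono) (auto simp: w_def W_def)
    finally show ?thesis using W by (simp add: w_def enn_powr_ennreal mult_right_mono)
  qed
  hence "(\<Sum>k. enn_powr (\<Sum>j. ennreal (r ^ nat_dist j k) * y j) q) \<le>
      (\<Sum>k. ennreal (W powr (q - 1)) * (\<Sum>j. ennreal (r ^ nat_dist j k) * enn_powr (y j) q))"
    by (intro suminf_le) auto
  also have "\<dots> = ennreal (W powr (q - 1)) * (\<Sum>j. (\<Sum>k. ennreal (r ^ nat_dist k j)) * enn_powr (y j) q)"
    by (subst ennreal_suminf_cmult, subst suminf_ennreal_swap) (simp add: nat_dist_commute)
  also have "\<dots> \<le> ennreal (W powr (q - 1)) * (\<Sum>j. ennreal W * enn_powr (y j) q)"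
    using suminf_power_nat_dist_le[OF r] unfolding W_def
    by (intro mult_left_mono suminf_le mult_right_mono) auto
  also have "\<dots> = ennreal (W powr (q - 1) * W) * (\<Sum>j. enn_powr (y j) q)"
    using W by (simp add: ennreal_suminf_cmult mult.assoc ennreal_mult)
  also have "W powr (q - 1) * W = W powr q"
    using W by (simp add: powr_diff)
  finally show ?thesis by (simp add: W_def)
qed

section \<open>Distance to the point 1 on the circle, and dyadic scales\<close>

lemma norm_one_minus_cis: "norm (1 - cis \<theta>) = 2 * \<bar>sin (\<theta> / 2)\<bar>"
proof -
  have "(norm (1 - cis \<theta>))\<^sup>2 = (1 - cos \<theta>)\<^sup>2 + (sin \<theta>)\<^sup>2"
    by (simp add: cmod_power2)
  also have "\<dots> = 2 - 2 * cos \<theta>"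
    by (simp add: power2_diff sin_squared_eq)
  also have "cos \<theta> = 1 - 2 * (sin (\<theta> / 2))\<^sup>2"
    using cos_double_sin[of "\<theta> / 2"] by simp
  finally have "(norm (1 - cis \<theta>))\<^sup>2 = (2 * \<bar>sin (\<theta> / 2)\<bar>)\<^sup>2"
    by (simp add: power_mult_distrib)
  thus ?thesis by (subst (asm) power2_eq_iff_nonneg) auto
qed

text \<open>By concavity the sine lies above its chord from the origin to
  \<open>(pi/2, 1)\<close>.\<close>

lemma Jordan_sin:
  assumes "0 \<le> x" "x \<le> pi / 2"
  shows "2 / pi * x \<le> sin x"
proof -
  have "convex_on {0..pi/2} (\<lambda>x. - sin x)"
    by (rule f''_ge0_imp_convex[where f' = "\<lambda>x. - cos x" and f'' = "\<lambda>x. sin x"])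
      (auto intro!: derivative_eq_intros sin_ge_zero)
  from convex_onD[OF this, of "2 / pi * x" 0 "pi / 2"] assms show ?thesis
    by (simp add: field_simps)
qed

text \<open>Jordan's inequality is applied at \<open>\<theta>/2\<close>, or on the second half of
  the period at the reflected angle \<open>pi - \<theta>/2\<close>. Both ends of the parameter
  interval represent the point 1, hence the minimum.\<close>

lemma norm_one_minus_cis_ge:
  assumes "0 \<le> \<theta>" "\<theta> \<le> 2 * pi"
  shows "min \<theta> (2 * pi - \<theta>) \<le> pi / 2 * norm (1 - cis \<theta>)"
proof -
  have s: "sin (\<theta> / 2) \<ge> 0" using assms by (intro sin_ge_zero) auto
  show ?thesis
  proof (cases "\<theta> \<le> pi")
    case True
    with Jordan_sin[of "\<theta> / 2"] assms s show ?thesis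
      by (simp add: norm_one_minus_cis field_simps min_def)
  next
    case False
    have "sin (pi - \<theta> / 2) = sin (\<theta> / 2)" by (simp add: sin_diff)
    with Jordan_sin[of "pi - \<theta> / 2"] assms s False show ?thesis
      by (simp add: norm_one_minus_cis field_simps min_def)
  qed
qed

definition dyadic_pt :: "nat \<Rightarrow> real" where
  "dyadic_pt j = 1 - 2 powr (- real j)"

lemma dyadic_pt_nonneg: "0 \<le> dyadic_pt j" and dyadic_pt_less_1: "dyadic_pt j < 1"
  by (use powr_mono[of "- real j" 0 2] in \<open>auto simp: dyadic_pt_def\<close>)

lemma dyadic_pt_mono: "i \<le> j \<Longrightarrow> dyadic_pt i \<le> dyadic_pt j"
  by (auto simp: dyadic_pt_def)

text \<open>In \<open>1 - \<zeta> = (1 - t \<zeta>) - (1 - t) \<zeta>\<close> the last term is at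
  most \<open>\<bar>1 - t \<zeta>\<bar>\<close>. With \<open>t\<close> read as a radius, the second
  inequality compares a kernel inside the disc with its values on the boundary, uniformly in the
  radius.\<close>

lemma norm_one_minus_le:
  fixes \<zeta> :: complex
  assumes "0 \<le> t" "t \<le> 1" "norm \<zeta> \<le> 1"
  shows "1 - t \<le> norm (1 - of_real t * \<zeta>)" "norm (1 - \<zeta>) \<le> 2 * norm (1 - of_real t * \<zeta>)"
proof -
  have "norm (of_real t * \<zeta>) \<le> t" using assms mult_left_le[of "norm \<zeta>" t] by (simp add: norm_mult)
  thus 1: "1 - t \<le> norm (1 - of_real t * \<zeta>)"
    using norm_triangle_ineq2[of 1 "of_real t * \<zeta>"] by simp
  have "norm (1 - \<zeta>) \<le> norm (1 - of_real t * \<zeta>) + norm (of_real (1 - t) * \<zeta>)"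
    using norm_triangle_ineq4[of "1 - of_real t * \<zeta>" "of_real (1 - t) * \<zeta>"]
    by (simp add: algebra_simps)
  also have "norm (of_real (1 - t) * \<zeta>) \<le> 1 - t"
    by (simp only: norm_mult norm_of_real) (use assms mult_left_le[of "norm \<zeta>" "1 - t"] in simp)
  finally show "norm (1 - \<zeta>) \<le> 2 * norm (1 - of_real t * \<zeta>)" using 1 by simp
qed


text \<open>This is \<open>P_fun\<close> for the discrete measure with mass \<open>m j\<close> at
  \<open>dyadic_pt j\<close>, written as a series so that the total mass may be infinite.\<close>

definition dyadic_kernel :: "real \<Rightarrow> (nat \<Rightarrow> real) \<Rightarrow> complex \<Rightarrow> ennreal" where
  "dyadic_kernel \<alpha> m \<zeta> = (\<Sum>j. ennreal (m j / norm (1 - of_real (dyadic_pt j) * \<zeta>) powr \<alpha>))"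

lemma measurable_dyadic_kernel [measurable]:
  "(\<lambda>\<theta>. dyadic_kernel \<alpha> m (cis \<theta>)) \<in> borel_measurable borel"
proof -
  have [measurable]: "(\<lambda>\<theta>. norm (1 - of_real (dyadic_pt j) * cis \<theta>)) \<in> borel_measurable borel" for j
    by (intro borel_measurable_continuous_onI continuous_intros)
  show ?thesis unfolding dyadic_kernel_def by measurable
qed

lemma ex_dyadic_scale:
  assumes "0 < x" "x \<le> (2::real)"
  shows "\<exists>k::nat. 2 powr (- real k) < x \<and> x \<le> 2 powr (1 - real k)"
proof -
  have ex: "\<exists>k::nat. (1/2) ^ k < x" using real_arch_pow_inv[of x "1/2"] assms by auto
  \<comment> \<open>Minimality supplies the other inequality: the predecessor of \<open>k\<close>
    fails, and for \<open>k = 0\<close> the bound \<open>x \<le> 2\<close> takes its place.\<close>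
  define k where "k = (LEAST k::nat. (1/2) ^ k < x)"
  have pw: "2 powr (- real k) = (1/2) ^ k" for k :: nat
    by (simp add: powr_minus powr_realpow power_divide inverse_eq_divide)
  have k: "(1/2) ^ k < x" unfolding k_def by (rule LeastI_ex[OF ex])
  have "x \<le> 2 powr (1 - real k)"
  proof (cases k)
    case 0
    thus ?thesis using assms by simp
  next
    case (Suc i)
    hence "\<not> (1/2) ^ i < x" using not_less_Least[of i "\<lambda>k. (1/2) ^ k < x"] by (simp add: k_def)
    thus ?thesis using Suc pw[of i] by simp
  qed
  moreover have "2 powr (- real k) < x" using k unfolding pw .
  ultimately show ?thesis by blast
qed

text \<open>The denominators are at least \<open>2^(-1 - min(j,k))\<close>. The exponent
  \<open>\<alpha> min(j,k)\<close> equals \<open>k/q + j (\<alpha> - 1/q)\<close> minus a decay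
  term, which is \<open>(k - j)/q\<close> for \<open>j \<le> k\<close> and
  \<open>(j - k)(\<alpha> - 1/q)\<close> otherwise. The ratio \<open>r\<close> records the smaller
  of the two rates.\<close>

lemma dyadic_kernel_arc_le:
  assumes \<alpha>: "\<alpha> > 1 / q" and q: "q > 1" and m: "\<And>j. m j \<ge> 0"
    and \<zeta>: "norm \<zeta> = 1" "2 powr (- real k) \<le> norm (1 - \<zeta>)"
    and r: "r = 2 powr (- min (1 / q) (\<alpha> - 1 / q))"
  shows "dyadic_kernel \<alpha> m \<zeta> \<le> ennreal (2 powr \<alpha> * 2 powr (real k / q)) *
    (\<Sum>j. ennreal (r ^ nat_dist j k) * ennreal (2 powr (real j * (\<alpha> - 1 / q)) * m j))"
proof -
  have \<alpha>0: "\<alpha> > 0" using \<alpha> q by (smt (verit) divide_pos_pos)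
  define \<epsilon> where "\<epsilon> = min (1 / q) (\<alpha> - 1 / q)"
  have \<epsilon>: "\<epsilon> \<le> 1 / q" "\<epsilon> \<le> \<alpha> - 1 / q" by (auto simp: \<epsilon>_def)
  have "m j / norm (1 - of_real (dyadic_pt j) * \<zeta>) powr \<alpha> \<le>
      2 powr \<alpha> * 2 powr (real k / q) * (r ^ nat_dist j k * (2 powr (real j * (\<alpha> - 1 / q)) * m j))" for j
  proof -
    define d where "d = real (min j k)"
    define N where "N = norm (1 - of_real (dyadic_pt j) * \<zeta>)"
    have N: "2 powr (- real j) \<le> N" "norm (1 - \<zeta>) \<le> 2 * N"
      using norm_one_minus_le[of "dyadic_pt j" \<zeta>] dyadic_pt_nonneg[of j] dyadic_pt_less_1[of j] \<zeta>
      by (auto simp: N_def dyadic_pt_def)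
    have "2 powr (- 1 - d) \<le> N"
    proof (cases "j \<le> k")
      case True
      have "2 powr (- 1 - d) \<le> 2 powr (- real j)" using True by (intro powr_mono) (auto simp: d_def)
      thus ?thesis using N(1) by (rule order.trans)
    next
      case False
      have "2 powr (- 1 - d) = 2 powr (- real k) / 2" using False by (simp add: d_def powr_diff powr_minus field_simps)
      thus ?thesis using N \<zeta> by simp
    qed
    hence "(2 powr (- 1 - d)) powr \<alpha> \<le> N powr \<alpha>" using \<alpha>0 by (intro powr_mono2) auto
    hence "m j / N powr \<alpha> \<le> m j / (2 powr (- 1 - d)) powr \<alpha>"
      using m[of j] by (intro divide_left_mono mult_pos_pos) (auto simp: order.strict_trans2[rotated])
    also have "\<dots> = 2 powr ((1 + d) * \<alpha>) * m j"
      by (simp add: powr_powr powr_minus_divide[symmetric] divide_powr_uminus) (simp add: algebra_simps)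
    also have "\<dots> \<le> 2 powr (\<alpha> + real k / q - \<epsilon> * real (nat_dist j k) + real j * (\<alpha> - 1 / q)) * m j"
    proof (intro mult_right_mono m)
      have "(1 + d) * \<alpha> \<le> \<alpha> + real k / q - \<epsilon> * real (nat_dist j k) + real j * (\<alpha> - 1 / q)"
      proof (cases "j \<le> k")
        case True
        have "\<epsilon> * (real k - real j) \<le> 1 / q * (real k - real j)"
          using True \<epsilon> by (intro mult_right_mono) auto
        thus ?thesis using True by (simp add: d_def nat_dist_def of_nat_diff algebra_simps)
      next
        case False
        have "\<epsilon> * (real j - real k) \<le> (\<alpha> - 1 / q) * (real j - real k)"
          using False \<epsilon> by (intro mult_right_mono) auto
        thus ?thesis using False by (simp add: d_def nat_dist_def of_nat_diff algebra_simps)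
      qed
      thus "2 powr ((1 + d) * \<alpha>) \<le> 2 powr (\<alpha> + real k / q - \<epsilon> * real (nat_dist j k) + real j * (\<alpha> - 1 / q))"
        by (intro powr_mono) auto
    qed
    also have "r ^ nat_dist j k = 2 powr (- (\<epsilon> * real (nat_dist j k)))"
      by (simp add: r \<epsilon>_def[symmetric] powr_powr flip: powr_realpow)
    hence "2 powr (\<alpha> + real k / q - \<epsilon> * real (nat_dist j k) + real j * (\<alpha> - 1 / q)) * m j =
      2 powr \<alpha> * 2 powr (real k / q) * (r ^ nat_dist j k * (2 powr (real j * (\<alpha> - 1 / q)) * m j))"
      by (simp add: powr_add powr_diff powr_minus field_simps)
    finally show ?thesis by (simp add: N_def)
  qed
  hence "dyadic_kernel \<alpha> m \<zeta> \<le> (\<Sum>j. ennreal (2 powr \<alpha> * 2 powr (real k / q) *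
      (r ^ nat_dist j k * (2 powr (real j * (\<alpha> - 1 / q)) * m j))))"
    unfolding dyadic_kernel_def by (intro suminf_le ennreal_leI) auto
  also have "\<dots> = (\<Sum>j. ennreal (2 powr \<alpha> * 2 powr (real k / q)) * (ennreal (r ^ nat_dist j k) *
      ennreal (2 powr (real j * (\<alpha> - 1 / q)) * m j)))"
    using m by (intro suminf_cong) (simp add: ennreal_mult r)
  finally show ?thesis by simp
qed

text \<open>The chord bound confines the angle to two intervals of length \<open>pi x / 2\<close>,
  one at each end of the period.\<close>

lemma emeasure_arc_le:
  "emeasure lborel {\<theta>\<in>{0..2*pi}. norm (1 - cis \<theta>) \<le> x} \<le> ennreal (pi * x)"
proof (cases "x \<ge> 0")
  case True
  have sub: "{\<theta>\<in>{0..2*pi}. norm (1 - cis \<theta>) \<le> x} \<subseteq> {0..pi/2*x} \<union> {2*pi - pi/2*x..2*pi}"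
  proof
    fix \<theta> assume "\<theta> \<in> {\<theta>\<in>{0..2*pi}. norm (1 - cis \<theta>) \<le> x}"
    hence *: "0 \<le> \<theta>" "\<theta> \<le> 2 * pi" "norm (1 - cis \<theta>) \<le> x" by auto
    have "pi / 2 * norm (1 - cis \<theta>) \<le> pi / 2 * x" using * by (intro mult_left_mono) auto
    hence "min \<theta> (2 * pi - \<theta>) \<le> pi / 2 * x" using norm_one_minus_cis_ge[of \<theta>] * by linarith
    thus "\<theta> \<in> {0..pi/2*x} \<union> {2*pi - pi/2*x..2*pi}" using * by (auto simp: min_def split: if_splits)
  qed
  have "emeasure lborel {\<theta>\<in>{0..2*pi}. norm (1 - cis \<theta>) \<le> x} \<le>
      emeasure lborel ({0..pi/2*x} \<union> {2*pi - pi/2*x..2*pi})"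
    by (intro emeasure_mono[OF sub]) auto
  also have "\<dots> \<le> emeasure lborel {0..pi/2*x} + emeasure lborel {2*pi - pi/2*x..2*pi}"
    by (intro emeasure_subadditive) auto
  also have "\<dots> = ennreal (pi / 2 * x) + ennreal (pi / 2 * x)" using True by simp
  also have "\<dots> = ennreal (pi * x)" using True by (subst ennreal_plus[symmetric]) auto
  finally show ?thesis .
next
  case False
  hence "\<not> norm (1 - cis \<theta>) \<le> x" for \<theta> using norm_ge_zero[of "1 - cis \<theta>"] by linarith
  hence "{\<theta>\<in>{0..2*pi}. norm (1 - cis \<theta>) \<le> x} = {}" by blast
  thus ?thesis by (simp only: emeasure_empty zero_le)
qed

text \<open>On the arc \<open>\<bar>1 - \<zeta>\<bar> \<approx> 2\<^sup>-\<^sup>k\<close> the kernel is a discrete convolution with a geometric sequence.\<close>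

lemma circle_Lq_norm_dyadic_kernel_le:
  assumes p: "p > 1" "1 / p + 1 / q = (1::real)" and \<alpha>: "\<alpha> > 1 / q"
  shows "\<exists>C>0. \<forall>m. (\<forall>j. m j \<ge> 0) \<longrightarrow> circle_Lq_norm q (dyadic_kernel \<alpha> m) \<le>
    ennreal C * seq_lq_norm q (\<lambda>j. 2 powr (real j * (\<alpha> - 1 / q)) * m j)"
proof -
  have q: "q > 1" by (rule conjugate_exponent_gt_1[OF p])
  define r where "r = (2::real) powr (- min (1 / q) (\<alpha> - 1 / q))"
  have r: "0 < r" "r < 1" using \<alpha> q powr_less_mono[of "- min (1 / q) (\<alpha> - 1 / q)" 0 "2::real"] by (auto simp: r_def)
  define W where "W = 2 / (1 - r)"
  have W: "W > 0" using r by (simp add: W_def)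
  define C where "C = 2 powr \<alpha> * W"
  have "circle_Lq_norm q (dyadic_kernel \<alpha> m) \<le> ennreal C * seq_lq_norm q (\<lambda>j. 2 powr (real j * (\<alpha> - 1 / q)) * m j)"
    if m: "\<And>j. m j \<ge> 0" for m
  proof -
    define y where "y j = 2 powr (real j * (\<alpha> - 1 / q)) * m j" for j
    have y: "y j \<ge> 0" for j using m by (simp add: y_def)
    define S where "S k = (\<Sum>j. ennreal (r ^ nat_dist j k) * ennreal (y j))" for k
    define A where "A k = {\<theta>\<in>{0..2*pi}. 2 powr (- real k) < norm (1 - cis \<theta>) \<and> norm (1 - cis \<theta>) \<le> 2 powr (1 - real k)}" for k
    have [measurable]: "(\<lambda>\<theta>. norm (1 - cis \<theta>)) \<in> borel_measurable borel"
      by (intro borel_measurable_continuous_onI continuous_intros)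
    have A: "A k \<in> sets lborel" for k unfolding A_def by measurable
    \<comment> \<open>The point \<open>\<zeta> = 1\<close>, that is \<open>\<theta> = 0\<close> or
      \<open>\<theta> = 2 pi\<close>, belongs to no dyadic scale, so the arcs cover only almost
      everywhere.\<close>
    have cover: "AE \<theta> in lborel. \<theta> \<in> {0..2*pi} \<longrightarrow> (\<exists>k. \<theta> \<in> A k)"
      using AE_lborel_singleton[of 0] AE_lborel_singleton[of "2 * pi"]
    proof eventually_elim
      case (elim \<theta>)
      have "\<exists>k. \<theta> \<in> A k" if "\<theta> \<in> {0..2*pi}"
      proof -
        have "0 < norm (1 - cis \<theta>)"
          using norm_one_minus_cis_ge[of \<theta>] elim that by (auto simp: min_def zero_less_mult_iff split: if_splits) 
        moreover have "norm (1 - cis \<theta>) \<le> 2" using norm_triangle_ineq4[of 1 "cis \<theta>"] by simp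
        ultimately show ?thesis using ex_dyadic_scale that by (simp add: A_def)
      qed
      thus ?case by blast
    qed
    have le: "enn_powr (dyadic_kernel \<alpha> m (cis \<theta>)) q \<le> ennreal (2 powr (\<alpha> * q + real k)) * enn_powr (S k) q"
      if "\<theta> \<in> A k" for \<theta> k
    proof -
      have "dyadic_kernel \<alpha> m (cis \<theta>) \<le> ennreal (2 powr \<alpha> * 2 powr (real k / q)) * S k"
        unfolding S_def y_def using that by (intro dyadic_kernel_arc_le \<alpha> q m) (auto simp: A_def r_def)
      hence "enn_powr (dyadic_kernel \<alpha> m (cis \<theta>)) q \<le> enn_powr (ennreal (2 powr \<alpha> * 2 powr (real k / q)) * S k) q"
        using q by (intro enn_powr_mono) auto
      also have "\<dots> = ennreal (2 powr (\<alpha> * q + real k)) * enn_powr (S k) q"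
        using q by (simp add: enn_powr_mult enn_powr_ennreal powr_mult powr_powr powr_add)
      finally show ?thesis .
    qed
    have "(\<integral>\<^sup>+\<theta>\<in>{0..2*pi}. enn_powr (dyadic_kernel \<alpha> m (cis \<theta>)) q \<partial>lborel) \<le>
        (\<Sum>k. (ennreal (2 powr (\<alpha> * q + real k)) * enn_powr (S k) q) * emeasure lborel (A k))"
      by (rule nn_integral_cover_le[OF A cover le])
    \<comment> \<open>The arc length, of order \<open>2^-k\<close>, cancels the factor
      \<open>2^k\<close> that arose as the \<open>q\<close>-th power of \<open>2^(k/q)\<close>. What
      remains is the \<open>q\<close>-th power sum of a convolution.\<close>
    also have "\<dots> \<le> (\<Sum>k. ennreal (2 * pi * 2 powr (\<alpha> * q)) * enn_powr (S k) q)"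
    proof (intro suminf_le)
      fix k
      have "emeasure lborel (A k) \<le> emeasure lborel {\<theta>\<in>{0..2*pi}. norm (1 - cis \<theta>) \<le> 2 powr (1 - real k)}"
        by (intro emeasure_mono) (auto simp: A_def)
      also have "\<dots> \<le> ennreal (pi * 2 powr (1 - real k))" by (rule emeasure_arc_le)
      finally have "(ennreal (2 powr (\<alpha> * q + real k)) * enn_powr (S k) q) * emeasure lborel (A k) \<le>
        (ennreal (2 powr (\<alpha> * q + real k)) * enn_powr (S k) q) * ennreal (pi * 2 powr (1 - real k))"
        by (rule mult_left_mono) auto
      also have "\<dots> = ennreal (2 powr (\<alpha> * q + real k) * (pi * 2 powr (1 - real k))) * enn_powr (S k) q"
        by (simp add: ennreal_mult mult_ac)
      also have "2 powr (\<alpha> * q + real k) * (pi * 2 powr (1 - real k)) = 2 * pi * 2 powr (\<alpha> * q)"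
        by (simp add: powr_add powr_diff)
      finally show "(ennreal (2 powr (\<alpha> * q + real k)) * enn_powr (S k) q) * emeasure lborel (A k) \<le>
        ennreal (2 * pi * 2 powr (\<alpha> * q)) * enn_powr (S k) q" .
    qed auto
    also have "\<dots> = ennreal (2 * pi * 2 powr (\<alpha> * q)) * (\<Sum>k. enn_powr (S k) q)" by simp
    also have "\<dots> \<le> ennreal (2 * pi * 2 powr (\<alpha> * q)) * (ennreal (W powr q) * (\<Sum>j. enn_powr (ennreal (y j)) q))"
      unfolding S_def W_def by (intro mult_left_mono discrete_Young[OF p r]) auto
    finally have "ennreal (1 / (2 * pi)) * (\<integral>\<^sup>+\<theta>\<in>{0..2*pi}. enn_powr (dyadic_kernel \<alpha> m (cis \<theta>)) q \<partial>lborel) \<le>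
      ennreal (1 / (2 * pi)) * (ennreal (2 * pi * 2 powr (\<alpha> * q)) * (ennreal (W powr q) * (\<Sum>j. enn_powr (ennreal (y j)) q)))"
      by (rule mult_left_mono) auto
    also have "\<dots> = ennreal (1 / (2 * pi) * (2 * pi * 2 powr (\<alpha> * q)) * W powr q) * (\<Sum>j. ennreal (\<bar>y j\<bar> powr q))"
    proof -
      have "ennreal a * (ennreal b * (ennreal c * X)) = ennreal (a * b * c) * X"
        if "a \<ge> 0" "b \<ge> 0" "c \<ge> 0" for a b c X
        using that by (simp add: ennreal_mult mult.assoc)
      thus ?thesis using y by (simp add: enn_powr_ennreal del: times_divide_eq_left times_divide_eq_right)
    qed
    also have "1 / (2 * pi) * (2 * pi * 2 powr (\<alpha> * q)) * W powr q = C powr q"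
      using W by (simp add: C_def powr_mult powr_powr)
    finally have "enn_powr (ennreal (1 / (2 * pi)) * (\<integral>\<^sup>+\<theta>\<in>{0..2*pi}. enn_powr (dyadic_kernel \<alpha> m (cis \<theta>)) q \<partial>lborel)) (1 / q) \<le>
      enn_powr (ennreal (C powr q) * (\<Sum>j. ennreal (\<bar>y j\<bar> powr q))) (1 / q)"
      using q by (intro enn_powr_mono) auto
    also have "\<dots> = ennreal C * seq_lq_norm q y"
      using q W by (simp add: enn_powr_mult enn_powr_ennreal powr_powr seq_lq_norm_def C_def)
    finally show ?thesis by (simp add: circle_Lq_norm_def y_def[abs_def])
  qed
  thus ?thesis using W by (intro exI[of _ C]) (auto simp: C_def)
qed

section \<open>Cauchy's formula and the kernel of the operator\<close>

text \<open>The shifted interval is cut at \<open>T\<close>, and the part beyond \<open>T\<close> is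
  moved back by one period.\<close>

lemma nn_integral_periodic_shift:
  fixes h :: "real \<Rightarrow> ennreal"
  assumes [measurable]: "h \<in> borel_measurable borel" and per: "\<And>x. h (T + x) = h x"
    and c: "0 \<le> c" "c \<le> T"
  shows "(\<integral>\<^sup>+x\<in>{0..T}. h (c + x) \<partial>lborel) = (\<integral>\<^sup>+x\<in>{0..T}. h x \<partial>lborel)"
proof -
  have shift: "(\<integral>\<^sup>+x\<in>{0..a}. h (d + x) \<partial>lborel) = (\<integral>\<^sup>+x\<in>{d..d+a}. h x \<partial>lborel)" for a d
  proof -
    have "(\<integral>\<^sup>+x\<in>{d..d+a}. h x \<partial>lborel) = (\<integral>\<^sup>+x. h (d + x) * indicator {d..d+a} (d + x) \<partial>lborel)"
      using nn_integral_real_affine[of "\<lambda>x. h x * indicator {d..d+a} x" 1 d] by simp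
    also have "\<dots> = (\<integral>\<^sup>+x\<in>{0..a}. h (d + x) \<partial>lborel)"
      by (intro nn_integral_cong) (simp add: indicator_def)
    finally show ?thesis ..
  qed
  have split: "(\<integral>\<^sup>+x\<in>{a..b}. h x \<partial>lborel) = (\<integral>\<^sup>+x\<in>{a..d}. h x \<partial>lborel) + (\<integral>\<^sup>+x\<in>{d..b}. h x \<partial>lborel)"
    if "a \<le> d" "d \<le> b" for a b d
  proof -
    have "(\<integral>\<^sup>+x\<in>{a..b}. h x \<partial>lborel) = (\<integral>\<^sup>+x. h x * indicator {a..d} x + h x * indicator {d..b} x \<partial>lborel)"
      by (rule nn_integral_cong_AE, rule AE_mp[OF AE_lborel_singleton[of d]], rule AE_I2)
        (use that in \<open>auto simp: indicator_def\<close>)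
    also have "\<dots> = (\<integral>\<^sup>+x\<in>{a..d}. h x \<partial>lborel) + (\<integral>\<^sup>+x\<in>{d..b}. h x \<partial>lborel)"
      by (rule nn_integral_add) auto
    finally show ?thesis .
  qed
  have "(\<integral>\<^sup>+x\<in>{0..T}. h (c + x) \<partial>lborel) = (\<integral>\<^sup>+x\<in>{c..T}. h x \<partial>lborel) + (\<integral>\<^sup>+x\<in>{T..c+T}. h x \<partial>lborel)"
    unfolding shift by (rule split) (use c in auto)
  also have "(\<integral>\<^sup>+x\<in>{T..c+T}. h x \<partial>lborel) = (\<integral>\<^sup>+x\<in>{0..c}. h x \<partial>lborel)"
    using shift[where a = c and d = T] by (simp add: per add.commute[of c T])
  also have "(\<integral>\<^sup>+x\<in>{c..T}. h x \<partial>lborel) + \<dots> = (\<integral>\<^sup>+x\<in>{0..T}. h x \<partial>lborel)"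
    using split[of 0 c T] c by (simp add: add.commute)
  finally show ?thesis .
qed

lemma measurable_circle_norm [measurable]:
  assumes "f holomorphic_on ball 0 1" "z \<in> ball 0 1"
  shows "(\<lambda>\<theta>. ennreal (norm (f (z * cis \<theta>)))) \<in> borel_measurable borel"
proof -
  have "continuous_on UNIV (\<lambda>\<theta>. f (z * cis \<theta>))"
    using assms
    by (intro continuous_on_compose2[OF holomorphic_on_imp_continuous_on[OF assms(1)]] continuous_intros)
      (auto simp: norm_mult)
  thus ?thesis by (intro measurable_compose[OF _ measurable_ennreal] borel_measurable_continuous_onI continuous_intros)
qed

text \<open>Multiplication by a complex \<open>z\<close> is a real dilation followed by a rotation,
  and the circle mean is rotation invariant. Allowing complex \<open>z\<close> makes the later
  estimates uniform over the whole disc.\<close>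

lemma circle_Lq_norm_le_Hardy_norm:
  assumes f: "f holomorphic_on ball 0 1" and z: "z \<in> ball 0 1"
  shows "circle_Lq_norm p (\<lambda>\<zeta>. ennreal (norm (f (z * \<zeta>)))) \<le> Hardy_norm p f"
proof -
  let ?r = "complex_of_real (norm z)"
  have zr: "z = ?r * cis (Arg2pi z)"
    using Arg2pi[of z] by (simp add: cis_conv_exp is_Arg_def)
  have r: "?r \<in> ball 0 1" using z by simp
  have "z * cis \<theta> = ?r * cis (Arg2pi z + \<theta>)" for \<theta>
    by (subst zr) (simp add: cis_mult[symmetric])
  hence "(\<integral>\<^sup>+\<theta>\<in>{0..2*pi}. enn_powr (ennreal (norm (f (z * cis \<theta>)))) p \<partial>lborel) =
      (\<integral>\<^sup>+\<theta>\<in>{0..2*pi}. enn_powr (ennreal (norm (f (?r * cis (Arg2pi z + \<theta>))))) p \<partial>lborel)"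
    by (simp only:)
  also have "\<dots> = (\<integral>\<^sup>+\<theta>\<in>{0..2*pi}. enn_powr (ennreal (norm (f (?r * cis \<theta>)))) p \<partial>lborel)"
    using Arg2pi_ge_0[of z] Arg2pi_lt_2pi[of z]
    by (intro nn_integral_periodic_shift measurable_enn_powr measurable_circle_norm[OF f r])
      (auto simp: cis_mult[symmetric])
  finally have "circle_Lq_norm p (\<lambda>\<zeta>. ennreal (norm (f (z * \<zeta>)))) = circle_Lq_norm p (\<lambda>\<zeta>. ennreal (norm (f (?r * \<zeta>))))"
    by (simp add: circle_Lq_norm_def)
  also have "\<dots> \<le> Hardy_norm p f" unfolding Hardy_norm_def
    by (rule SUP_upper) (use z in auto)
  finally show ?thesis .
qed

text \<open>On the unit circle \<open>\<bar>\<zeta> - t\<bar> = \<bar>1 - t \<zeta>\<bar>\<close>,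
  which turns the Cauchy kernel into the kernel of exponent 1.\<close>

lemma Cauchy_circle_bound:
  assumes g: "g holomorphic_on cball 0 1" and t: "0 \<le> t" "t < 1"
  shows "ennreal (norm (g (of_real t))) \<le>
    ennreal (1 / (2 * pi)) * (\<integral>\<^sup>+\<theta>\<in>{0..2*pi}. ennreal (norm (g (cis \<theta>)) / norm (1 - of_real t * cis \<theta>)) \<partial>lborel)"
proof -
  define G where "G \<theta> = g (cis \<theta>) / (cis \<theta> - of_real t) * \<i> * cis \<theta>" for \<theta>
  have ne: "cis \<theta> \<noteq> of_real t" for \<theta>
  proof
    assume "cis \<theta> = of_real t"
    hence "norm (cis \<theta>) = \<bar>t\<bar>" by simp
    thus False using t by simp
  qed
  have "((\<lambda>u. g u / (u - of_real t)) has_contour_integral (2 * of_real pi * \<i> * g (of_real t))) (circlepath 0 1)"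
    using t by (intro Cauchy_integral_circlepath_simple g) auto
  hence 1: "(G has_integral (2 * of_real pi * \<i> * g (of_real t))) {0..2*pi}"
    unfolding circlepath_def by (subst (asm) has_contour_integral_part_circlepath_iff) (auto simp: G_def[abs_def])
  have "continuous_on {0..2*pi} G" unfolding G_def
    using ne by (intro continuous_intros continuous_on_compose2[OF holomorphic_on_imp_continuous_on[OF g]]) auto
  hence 2: "set_integrable lborel {0..2*pi} G" by (rule borel_integrable_atLeastAtMost')
  have 3: "2 * of_real pi * \<i> * g (of_real t) = (LINT \<theta>:{0..2*pi}|lborel. G \<theta>)"
    by (simp only: set_borel_integral_eq_integral(2)[OF 2] integral_unique[OF 1])
  have "ennreal (2 * pi * norm (g (of_real t))) = ennreal (norm (LINT \<theta>:{0..2*pi}|lborel. G \<theta>))"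
    unfolding 3[symmetric] by (simp add: norm_mult)
  also have "\<dots> \<le> (\<integral>\<^sup>+\<theta>. ennreal (norm (indicator {0..2*pi} \<theta> *\<^sub>R G \<theta>)) \<partial>lborel)"
    using 2 unfolding set_lebesgue_integral_def set_integrable_def by (rule integral_norm_bound_ennreal)
  also have "\<dots> = (\<integral>\<^sup>+\<theta>\<in>{0..2*pi}. ennreal (norm (g (cis \<theta>)) / norm (1 - of_real t * cis \<theta>)) \<partial>lborel)"
  proof (intro nn_integral_cong)
    fix \<theta>
    have "norm (cis \<theta> - of_real t) = norm (cnj (cis \<theta>) * (cis \<theta> - of_real t))" by (simp add: norm_mult)
    also have "cnj (cis \<theta>) * (cis \<theta> - of_real t) = cnj (1 - of_real t * cis \<theta>)"
      by (simp add: right_diff_distrib cis_cnj cis_mult mult.commute)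
    finally have "norm (cis \<theta> - of_real t) = norm (1 - of_real t * cis \<theta>)" by (simp only: complex_mod_cnj)
    thus "ennreal (norm (indicator {0..2*pi} \<theta> *\<^sub>R G \<theta>)) =
        ennreal (norm (g (cis \<theta>)) / norm (1 - of_real t * cis \<theta>)) * indicator {0..2*pi} \<theta>"
      by (simp add: G_def norm_mult norm_divide indicator_def)
  qed
  finally have "ennreal (1 / (2 * pi)) * ennreal (2 * pi * norm (g (of_real t))) \<le> ennreal (1 / (2 * pi)) * \<dots>"
    by (rule mult_left_mono) auto
  thus ?thesis by (simp flip: ennreal_mult)
qed

lemma norm_powr_of_real:
  assumes "w \<noteq> 0"
  shows "norm (w powr complex_of_real a) = norm w powr a"
  using assms by (simp add: powr_def norm_exp_eq_Re)

lemma one_minus_notin_nonpos_Reals: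
  assumes "norm (w::complex) < 1"
  shows "1 - w \<notin> \<real>\<^sub>\<le>\<^sub>0" "1 - w \<noteq> 0"
proof -
  have "Re (1 - w) > 0" using complex_Re_le_cmod[of w] assms by simp
  thus "1 - w \<notin> \<real>\<^sub>\<le>\<^sub>0" by (auto simp: complex_nonpos_Reals_iff)
  thus "1 - w \<noteq> 0" by force
qed

text \<open>Cauchy's formula for \<open>w \<mapsto> f (z w) / (1 - t w)\<^sup>\<gamma>\<close> at the point \<open>w = t\<close>; this choice makes the
  kernel of \<^const>\<open>P_fun\<close> appear.\<close>

lemma Cauchy_kernel_bound:
  assumes f: "f holomorphic_on ball 0 1" and z: "z \<in> ball 0 1" and t: "0 \<le> t" "t < 1" and \<gamma>: "\<gamma> \<ge> 0"
  shows "ennreal (norm (f (of_real t * z)) / (1 - t) powr \<gamma>) \<le> ennreal (2 powr \<gamma>) *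
    (ennreal (1 / (2 * pi)) * (\<integral>\<^sup>+\<theta>\<in>{0..2*pi}. ennreal (norm (f (z * cis \<theta>))) *
       ennreal (1 / norm (1 - of_real t * cis \<theta>) powr (\<gamma> + 1)) \<partial>lborel))"
proof -
  define g where "g w = f (z * w) / (1 - of_real t * w) powr complex_of_real \<gamma>" for w
  have tw: "norm (of_real t * w) < 1" if "norm w \<le> 1" for w :: complex
    using mult_left_le[of "norm w" t] that t by (simp add: norm_mult)
  have "g holomorphic_on cball 0 1" unfolding g_def
  proof (intro holomorphic_intros holomorphic_on_compose_gen[OF _ f, unfolded o_def])
    show "(*) z ` cball 0 1 \<subseteq> ball 0 1"
      using z by (auto simp: norm_mult intro!: order.strict_trans1[OF mult_left_le])
  next
    fix w :: complex assume "w \<in> cball 0 1"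
    thus "1 - of_real t * w \<notin> \<real>\<^sub>\<le>\<^sub>0" using one_minus_notin_nonpos_Reals tw[of w] by simp
  next
    fix w :: complex assume "w \<in> cball 0 1"
    thus "(1 - of_real t * w) powr complex_of_real \<gamma> \<noteq> 0" using one_minus_notin_nonpos_Reals(2) tw[of w] by auto
  qed
  from Cauchy_circle_bound[OF this t]
  have *: "ennreal (norm (g (of_real t))) \<le> ennreal (1 / (2 * pi)) *
    (\<integral>\<^sup>+\<theta>\<in>{0..2*pi}. ennreal (norm (g (cis \<theta>)) / norm (1 - of_real t * cis \<theta>)) \<partial>lborel)" .
  have tt: "1 - of_real t * of_real t = complex_of_real (1 - t * t)" by simp
  have t2: "t * t < 1" using t tw[of "of_real t"] by (simp add: norm_mult)
  have "norm (g (of_real t)) = norm (f (of_real t * z)) / (1 - t * t) powr \<gamma>"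
    unfolding g_def tt using t2 by (subst norm_divide, subst norm_powr_of_real) (simp_all add: mult.commute del: of_real_diff of_real_mult)
  \<comment> \<open>At \<open>w = t\<close> the denominator of \<open>g\<close> is
    \<open>(1 - t^2)^\<gamma>\<close>; replacing it by \<open>(1 - t)^\<gamma>\<close> is the origin
    of the constant \<open>2 powr \<gamma>\<close>.\<close>
  moreover have "(1 - t * t) powr \<gamma> \<le> 2 powr \<gamma> * (1 - t) powr \<gamma>"
  proof -
    have "1 - t * t = (1 + t) * (1 - t)" by (simp add: algebra_simps)
    also have "\<dots> \<le> 2 * (1 - t)" using t by (intro mult_right_mono) auto
    finally have "(1 - t * t) powr \<gamma> \<le> (2 * (1 - t)) powr \<gamma>" using \<gamma> t2 by (intro powr_mono2) auto
    thus ?thesis using t by (subst powr_mult[symmetric]) auto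
  qed
  ultimately have "norm (f (of_real t * z)) \<le> norm (g (of_real t)) * (2 powr \<gamma> * (1 - t) powr \<gamma>)"
    using t t2 mult_left_mono[of "(1 - t * t) powr \<gamma>" "2 powr \<gamma> * (1 - t) powr \<gamma>" "norm (g (of_real t))"]
    by simp
  hence "norm (f (of_real t * z)) / (1 - t) powr \<gamma> \<le> 2 powr \<gamma> * norm (g (of_real t))"
    using t by (simp add: field_simps)
  hence "ennreal (norm (f (of_real t * z)) / (1 - t) powr \<gamma>) \<le> ennreal (2 powr \<gamma>) * ennreal (norm (g (of_real t)))"
    by (simp add: ennreal_leI flip: ennreal_mult)
  also have "\<dots> \<le> ennreal (2 powr \<gamma>) * (ennreal (1 / (2 * pi)) *
    (\<integral>\<^sup>+\<theta>\<in>{0..2*pi}. ennreal (norm (g (cis \<theta>)) / norm (1 - of_real t * cis \<theta>)) \<partial>lborel))"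
    by (intro mult_left_mono *) auto
  also have "(\<lambda>\<theta>. ennreal (norm (g (cis \<theta>)) / norm (1 - of_real t * cis \<theta>))) =
     (\<lambda>\<theta>. ennreal (norm (f (z * cis \<theta>))) * ennreal (1 / norm (1 - of_real t * cis \<theta>) powr (\<gamma> + 1)))"
  proof
    fix \<theta>
    have "1 - of_real t * cis \<theta> \<noteq> 0" using one_minus_notin_nonpos_Reals(2) tw[of "cis \<theta>"] by simp
    thus "ennreal (norm (g (cis \<theta>)) / norm (1 - of_real t * cis \<theta>)) =
      ennreal (norm (f (z * cis \<theta>))) * ennreal (1 / norm (1 - of_real t * cis \<theta>) powr (\<gamma> + 1))"
      by (simp add: g_def norm_divide norm_powr_of_real powr_add flip: ennreal_mult)
  qed
  finally show ?thesis .
qed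

section \<open>Integrating the Cauchy bound against \<mu>\<close>

lemma finite_borel_measure_01D:
  assumes "finite_borel_measure_01 \<mu>"
  shows "finite_measure \<mu>" "sets \<mu> = sets (restrict_space borel {0..<1})" "space \<mu> = {0..<1}"
    and "(\<lambda>t. t) \<in> borel_measurable \<mu>"
proof -
  show "finite_measure \<mu>" and s: "sets \<mu> = sets (restrict_space borel {0..<1})"
    using assms by (auto simp: finite_borel_measure_01_def)
  show "space \<mu> = {0..<1}"
    using sets_eq_imp_space_eq[OF s] by (simp add: space_restrict_space)
  show "(\<lambda>t. t) \<in> borel_measurable \<mu>"
    using measurable_restrict_space1[of "\<lambda>t::real. t" borel borel "{0..<1}"]
      measurable_cong_sets[OF s refl] by auto
qed

lemma measurable_P_kernel:
  assumes \<mu>: "finite_borel_measure_01 \<mu>"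
  shows "(\<lambda>(\<theta>, t). ennreal (1 / norm (1 - complex_of_real t * cis \<theta>) powr \<alpha>)) \<in> borel_measurable (borel \<Otimes>\<^sub>M \<mu>)"
    "(\<lambda>t. ennreal (1 / norm (1 - complex_of_real t * \<zeta>) powr \<alpha>)) \<in> borel_measurable \<mu>"
proof -
  note finite_borel_measure_01D(4)[OF \<mu>, measurable]
  have [measurable]: "cis \<in> borel_measurable borel"
    by (intro borel_measurable_continuous_onI continuous_intros)
  have [measurable]: "(\<lambda>t. complex_of_real t) \<in> borel_measurable \<mu>"
    using measurable_compose[OF finite_borel_measure_01D(4)[OF \<mu>] borel_measurable_of_real] by simp
  show "(\<lambda>(\<theta>, t). ennreal (1 / norm (1 - complex_of_real t * cis \<theta>) powr \<alpha>)) \<in> borel_measurable (borel \<Otimes>\<^sub>M \<mu>)"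
    by measurable
  show "(\<lambda>t. ennreal (1 / norm (1 - complex_of_real t * \<zeta>) powr \<alpha>)) \<in> borel_measurable \<mu>"
    by measurable
qed

lemma measurable_P_fun [measurable]:
  assumes \<mu>: "finite_borel_measure_01 \<mu>"
  shows "(\<lambda>\<theta>. P_fun \<mu> \<alpha> (cis \<theta>)) \<in> borel_measurable borel"
proof -
  interpret finite_measure \<mu> by (rule finite_borel_measure_01D(1)[OF \<mu>])
  show ?thesis unfolding P_fun_def
    using measurable_P_kernel(1)[OF \<mu>] by (rule borel_measurable_nn_integral)
qed

text \<open>Fubini collects the kernels into \<open>P_fun\<close>, and Hoelder separates it from
  \<open>f\<close>. The modulus stands inside the integral and the bound is uniform in
  \<open>z\<close>, so the estimate can also be used for a part of the measure alone, as compactness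
  requires.\<close>

lemma nn_integral_weighted_le:
  assumes p: "p > 1" "1 / p + 1 / q = (1::real)" and \<mu>: "finite_borel_measure_01 \<mu>"
    and f: "f holomorphic_on ball 0 1" and z: "z \<in> ball 0 1" and \<gamma>: "\<gamma> \<ge> 0"
  shows "(\<integral>\<^sup>+t. ennreal (norm (f (of_real t * z)) / (1 - t) powr \<gamma>) \<partial>\<mu>) \<le>
     ennreal (2 powr \<gamma>) * (Hardy_norm p f * circle_Lq_norm q (P_fun \<mu> (\<gamma> + 1)))"
proof -
  interpret finite_measure \<mu> by (rule finite_borel_measure_01D(1)[OF \<mu>])
  interpret pair_sigma_finite lborel \<mu> ..
  let ?u = "\<lambda>\<theta>. ennreal (norm (f (z * cis \<theta>)))"
  let ?k = "\<lambda>\<theta> t. ennreal (1 / norm (1 - complex_of_real t * cis \<theta>) powr (\<gamma> + 1))"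
  let ?c = "ennreal (2 powr \<gamma>) * ennreal (1 / (2 * pi))"
  note measurable_circle_norm[OF f z, measurable]
  have [measurable]: "(\<lambda>(\<theta>, t). ?k \<theta> t) \<in> borel_measurable (lborel \<Otimes>\<^sub>M \<mu>)"
    using measurable_P_kernel(1)[OF \<mu>, of "\<gamma> + 1"] by (simp cong: measurable_cong_sets sets_pair_measure_cong)
  note measurable_P_kernel(2)[OF \<mu>, measurable]
  have "(\<integral>\<^sup>+t. ennreal (norm (f (of_real t * z)) / (1 - t) powr \<gamma>) \<partial>\<mu>) \<le>
      (\<integral>\<^sup>+t. ?c * (\<integral>\<^sup>+\<theta>. ?u \<theta> * indicator {0..2*pi} \<theta> * ?k \<theta> t \<partial>lborel) \<partial>\<mu>)"
    using Cauchy_kernel_bound[OF f z _ _ \<gamma>] finite_borel_measure_01D(3)[OF \<mu>]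
    by (intro nn_integral_mono) (auto simp: mult_ac)
  also have "\<dots> = ?c * (\<integral>\<^sup>+t. (\<integral>\<^sup>+\<theta>. ?u \<theta> * indicator {0..2*pi} \<theta> * ?k \<theta> t \<partial>lborel) \<partial>\<mu>)"
    by (rule nn_integral_cmult) measurable
  also have "(\<integral>\<^sup>+t. (\<integral>\<^sup>+\<theta>. ?u \<theta> * indicator {0..2*pi} \<theta> * ?k \<theta> t \<partial>lborel) \<partial>\<mu>) =
      (\<integral>\<^sup>+\<theta>. (\<integral>\<^sup>+t. ?u \<theta> * indicator {0..2*pi} \<theta> * ?k \<theta> t \<partial>\<mu>) \<partial>lborel)"
    by (rule Fubini') measurable
  also have "\<dots> = (\<integral>\<^sup>+\<theta>\<in>{0..2*pi}. ?u \<theta> * P_fun \<mu> (\<gamma> + 1) (cis \<theta>) \<partial>lborel)"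
    unfolding P_fun_def
  proof (intro nn_integral_cong)
    fix \<theta> :: real
    have "(\<integral>\<^sup>+t. ?u \<theta> * indicator {0..2*pi} \<theta> * ?k \<theta> t \<partial>\<mu>) =
        ?u \<theta> * indicator {0..2*pi} \<theta> * (\<integral>\<^sup>+t. ?k \<theta> t \<partial>\<mu>)"
      by (rule nn_integral_cmult) measurable
    also have "\<dots> = ?u \<theta> * (\<integral>\<^sup>+t. ?k \<theta> t \<partial>\<mu>) * indicator {0..2*pi} \<theta>"
      by (simp only: mult_ac)
    finally show "(\<integral>\<^sup>+t. ?u \<theta> * indicator {0..2*pi} \<theta> * ?k \<theta> t \<partial>\<mu>) =
        ?u \<theta> * (\<integral>\<^sup>+t. ?k \<theta> t \<partial>\<mu>) * indicator {0..2*pi} \<theta>" .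
  qed
  also have "?c * \<dots> = ennreal (2 powr \<gamma>) * (ennreal (1 / (2 * pi)) * \<dots>)" by (rule mult.assoc)
  also have "\<dots> \<le> ennreal (2 powr \<gamma>) * (circle_Lq_norm p (\<lambda>\<zeta>. ennreal (norm (f (z * \<zeta>)))) * circle_Lq_norm q (P_fun \<mu> (\<gamma> + 1)))"
    by (intro mult_left_mono circle_Hoelder[OF p] measurable_P_fun[OF \<mu>] measurable_circle_norm[OF f z]) auto
  also have "\<dots> \<le> ennreal (2 powr \<gamma>) * (Hardy_norm p f * circle_Lq_norm q (P_fun \<mu> (\<gamma> + 1)))"
    by (intro mult_left_mono mult_right_mono circle_Lq_norm_le_Hardy_norm f z) auto
  finally show ?thesis .
qed

section \<open>Upper bounds by dyadic masses\<close>

lemma norm_integral_le_nn_integral: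
  fixes f :: "'a \<Rightarrow> 'b::{banach, second_countable_topology}"
  shows "ennreal (norm (integral\<^sup>L M f)) \<le> (\<integral>\<^sup>+x. ennreal (norm (f x)) \<partial>M)"
  by (cases "integrable M f") (simp_all add: integral_norm_bound_ennreal not_integrable_integral_eq)

lemma circle_Lq_norm_le_cmult:
  assumes "q > 0" "c \<ge> 0" and [measurable]: "(\<lambda>\<theta>. v (cis \<theta>)) \<in> borel_measurable borel"
    and le: "\<And>\<zeta>. norm \<zeta> = 1 \<Longrightarrow> u \<zeta> \<le> ennreal c * v \<zeta>"
  shows "circle_Lq_norm q u \<le> ennreal c * circle_Lq_norm q v"
proof -
  have "(\<integral>\<^sup>+\<theta>\<in>{0..2*pi}. enn_powr (u (cis \<theta>)) q \<partial>lborel) \<le>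
      (\<integral>\<^sup>+\<theta>. ennreal (c powr q) * (enn_powr (v (cis \<theta>)) q * indicator {0..2*pi} \<theta>) \<partial>lborel)"
  proof (rule nn_integral_mono)
    fix \<theta> :: real
    have "enn_powr (u (cis \<theta>)) q \<le> enn_powr (ennreal c * v (cis \<theta>)) q"
      using assms(1) by (intro enn_powr_mono le) auto
    also have "\<dots> = ennreal (c powr q) * enn_powr (v (cis \<theta>)) q"
      using assms(2) by (simp add: enn_powr_mult enn_powr_ennreal)
    finally show "enn_powr (u (cis \<theta>)) q * indicator {0..2*pi} \<theta> \<le>
        ennreal (c powr q) * (enn_powr (v (cis \<theta>)) q * indicator {0..2*pi} \<theta>)"
      by (simp add: mult.assoc[symmetric] mult_right_mono)
  qed
  also have "\<dots> = ennreal (c powr q) * (\<integral>\<^sup>+\<theta>\<in>{0..2*pi}. enn_powr (v (cis \<theta>)) q \<partial>lborel)"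
    by (rule nn_integral_cmult) measurable
  finally have "circle_Lq_norm q u \<le> enn_powr (ennreal (1 / (2 * pi)) * \<dots>) (1 / q)"
    unfolding circle_Lq_norm_def using assms(1) by (intro enn_powr_mono mult_left_mono) auto
  also have "\<dots> = ennreal c * circle_Lq_norm q v"
    unfolding circle_Lq_norm_def using assms(1,2)
    by (simp only: enn_powr_mult mult.left_commute[of _ "enn_powr (ennreal (c powr q)) _"])
      (simp add: enn_powr_ennreal powr_powr)
  finally show ?thesis .
qed

text \<open>Blocks, in contrast to the tails in \<open>dyadic_seq\<close>: they partition
  \<open>[0,1)\<close>, and restricting the measure to \<open>[a_J,1)\<close> merely deletes the
  terms before \<open>J\<close>.\<close>

definition dyadic_mass :: "real measure \<Rightarrow> nat \<Rightarrow> real" where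
  "dyadic_mass \<mu> j = measure \<mu> {dyadic_pt j..<dyadic_pt (Suc j)}"

lemma interval_in_sets:
  assumes "finite_borel_measure_01 \<mu>" "0 \<le> a" "b \<le> 1"
  shows "{a..<b} \<in> sets \<mu>"
  using assms by (auto simp: finite_borel_measure_01D(2) sets_restrict_space_iff)

lemma dyadic_pt_Suc: "1 - dyadic_pt j = 2 * (1 - dyadic_pt (Suc j))"
  using powr_add[of 2 1 "- real (Suc j)"] by (simp add: dyadic_pt_def)

lemma ex_dyadic_interval:
  assumes "0 \<le> t" "t < 1"
  shows "\<exists>j. dyadic_pt j \<le> t \<and> t < dyadic_pt (Suc j)"
proof -
  obtain k :: nat where k: "2 powr (- real k) < 1 - t" "1 - t \<le> 2 powr (1 - real k)"
    using ex_dyadic_scale[of "1 - t"] assms by auto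
  with assms obtain j where j: "k = Suc j" by (cases k) auto
  show ?thesis using k unfolding j by (intro exI[of _ j]) (auto simp: dyadic_pt_def)
qed

text \<open>Moving \<open>t\<close> to the left end of its block changes
  \<open>1 - t \<zeta>\<close> by at most the block length
  \<open>a_(j+1) - a_j = 1 - a_(j+1) \<le> 1 - t\<close>, which is itself at most
  \<open>\<bar>1 - t \<zeta>\<bar>\<close>. So the modulus at most doubles.\<close>

lemma P_fun_le_dyadic_kernel:
  assumes \<mu>: "finite_borel_measure_01 \<mu>" and \<alpha>: "\<alpha> > 0" and \<zeta>: "norm \<zeta> \<le> 1"
  shows "P_fun \<mu> \<alpha> \<zeta> \<le> ennreal (2 powr \<alpha>) * dyadic_kernel \<alpha> (dyadic_mass \<mu>) \<zeta>"
proof -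
  interpret finite_measure \<mu> by (rule finite_borel_measure_01D(1)[OF \<mu>])
  let ?A = "\<lambda>j. {dyadic_pt j..<dyadic_pt (Suc j)}"
  let ?k = "\<lambda>t. norm (1 - complex_of_real t * \<zeta>)"
  have pos: "?k t > 0" if "0 \<le> t" "t < 1" for t
    using norm_one_minus_le(1)[of t \<zeta>] that \<zeta> by linarith
  have "(\<integral>\<^sup>+t\<in>UNIV. ennreal (1 / ?k t powr \<alpha>) \<partial>\<mu>) \<le>
      (\<Sum>j. ennreal (2 powr \<alpha> / ?k (dyadic_pt j) powr \<alpha>) * emeasure \<mu> (?A j))"
  proof (rule nn_integral_cover_le)
    show "?A j \<in> sets \<mu>" for j
      by (intro interval_in_sets \<mu> dyadic_pt_nonneg less_imp_le[OF dyadic_pt_less_1])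
    show "AE t in \<mu>. t \<in> UNIV \<longrightarrow> (\<exists>k. t \<in> ?A k)"
      by (rule AE_I2) (auto simp: finite_borel_measure_01D(3)[OF \<mu>] intro!: ex_dyadic_interval)
    fix j t assume t: "t \<in> ?A j"
    have t01: "0 \<le> t" "t < 1" using t dyadic_pt_nonneg[of j] dyadic_pt_less_1[of "Suc j"] by auto
    have "?k (dyadic_pt j) \<le> ?k t + norm (of_real (t - dyadic_pt j) * \<zeta>)"
      using norm_triangle_ineq[of "1 - complex_of_real t * \<zeta>" "of_real (t - dyadic_pt j) * \<zeta>"]
      by (simp add: algebra_simps)
    also have "norm (of_real (t - dyadic_pt j) * \<zeta>) \<le> 1 - t"
      using t \<zeta> dyadic_pt_Suc[of j] mult_left_le[of "norm \<zeta>" "t - dyadic_pt j"]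
      by (simp only: norm_mult norm_of_real) auto
    also have "1 - t \<le> ?k t" using norm_one_minus_le(1)[of t \<zeta>] t01 \<zeta> by simp
    finally have "?k (dyadic_pt j) / 2 \<le> ?k t" by simp
    hence "(?k (dyadic_pt j) / 2) powr \<alpha> \<le> ?k t powr \<alpha>" using \<alpha> by (intro powr_mono2) auto
    moreover have "?k (dyadic_pt j) > 0" by (intro pos dyadic_pt_nonneg dyadic_pt_less_1)
    ultimately have "1 / ?k t powr \<alpha> \<le> 1 / (?k (dyadic_pt j) / 2) powr \<alpha>"
      using pos[OF t01] by (intro divide_left_mono mult_pos_pos) auto
    also have "\<dots> = 2 powr \<alpha> / ?k (dyadic_pt j) powr \<alpha>" by (simp add: powr_divide)
    finally show "ennreal (1 / ?k t powr \<alpha>) \<le> ennreal (2 powr \<alpha> / ?k (dyadic_pt j) powr \<alpha>)"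
      by (rule ennreal_leI)
  qed
  also have "\<dots> = (\<Sum>j. ennreal (2 powr \<alpha>) * ennreal (dyadic_mass \<mu> j / ?k (dyadic_pt j) powr \<alpha>))"
    by (intro suminf_cong) (simp add: emeasure_eq_measure dyadic_mass_def flip: ennreal_mult)
  finally show ?thesis by (simp add: P_fun_def dyadic_kernel_def)
qed

lemma circle_Lq_norm_P_fun_le:
  assumes p: "p > 1" "1 / p + 1 / q = (1::real)" and \<alpha>: "\<alpha> > 1 / q"
  shows "\<exists>C>0. \<forall>\<mu>. finite_borel_measure_01 \<mu> \<longrightarrow> circle_Lq_norm q (P_fun \<mu> \<alpha>) \<le>
    ennreal C * seq_lq_norm q (\<lambda>j. 2 powr (real j * (\<alpha> - 1 / q)) * dyadic_mass \<mu> j)"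
proof -
  have q: "q > 1" by (rule conjugate_exponent_gt_1[OF p])
  have \<alpha>0: "\<alpha> > 0" using \<alpha> q by (smt (verit) divide_pos_pos)
  obtain C where C: "C > 0" "\<And>m. (\<forall>j. m j \<ge> 0) \<Longrightarrow> circle_Lq_norm q (dyadic_kernel \<alpha> m) \<le>
    ennreal C * seq_lq_norm q (\<lambda>j. 2 powr (real j * (\<alpha> - 1 / q)) * m j)"
    using circle_Lq_norm_dyadic_kernel_le[OF p \<alpha>] by blast
  have "circle_Lq_norm q (P_fun \<mu> \<alpha>) \<le>
    ennreal (2 powr \<alpha> * C) * seq_lq_norm q (\<lambda>j. 2 powr (real j * (\<alpha> - 1 / q)) * dyadic_mass \<mu> j)"
    if \<mu>: "finite_borel_measure_01 \<mu>" for \<mu>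
  proof -
    have "circle_Lq_norm q (P_fun \<mu> \<alpha>) \<le> ennreal (2 powr \<alpha>) * circle_Lq_norm q (dyadic_kernel \<alpha> (dyadic_mass \<mu>))"
      using q by (intro circle_Lq_norm_le_cmult P_fun_le_dyadic_kernel \<mu> \<alpha>0 measurable_dyadic_kernel) auto
    also have "\<dots> \<le> ennreal (2 powr \<alpha>) * (ennreal C * seq_lq_norm q (\<lambda>j. 2 powr (real j * (\<alpha> - 1 / q)) * dyadic_mass \<mu> j))"
      by (intro mult_left_mono C) (auto simp: dyadic_mass_def)
    finally show ?thesis using C(1) by (simp add: ennreal_mult mult.assoc)
  qed
  thus ?thesis using C(1) by (intro exI[of _ "2 powr \<alpha> * C"]) auto
qed

lemma seq_lq_norm_mono:
  assumes "q > 0" "\<And>j. \<bar>x j\<bar> \<le> \<bar>y j\<bar>"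
  shows "seq_lq_norm q x \<le> seq_lq_norm q y"
  unfolding seq_lq_norm_def using assms
  by (intro enn_powr_mono suminf_le ennreal_leI powr_mono2) auto

lemma seq_lq_norm_dyadic_mass_le:
  assumes \<mu>: "finite_borel_measure_01 \<mu>" and q: "q > 0"
  shows "seq_lq_norm q (\<lambda>j. 2 powr (real j * s) * dyadic_mass \<mu> j) \<le> seq_lq_norm q (dyadic_seq \<mu> s)"
proof (rule seq_lq_norm_mono[OF q])
  fix j
  interpret finite_measure \<mu> by (rule finite_borel_measure_01D(1)[OF \<mu>])
  have "dyadic_mass \<mu> j \<le> measure \<mu> {dyadic_pt j..<1}" unfolding dyadic_mass_def
    using dyadic_pt_less_1[of "Suc j"]
    by (intro finite_measure_mono interval_in_sets \<mu> dyadic_pt_nonneg) auto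
  thus "\<bar>2 powr (real j * s) * dyadic_mass \<mu> j\<bar> \<le> \<bar>dyadic_seq \<mu> s j\<bar>"
    by (auto simp: dyadic_seq_def dyadic_pt_def dyadic_mass_def abs_mult intro!: mult_left_mono)
qed

text \<open>For every radius \<open>\<rho>\<close> the kernel at \<open>\<rho> \<zeta>\<close> is at
  most \<open>2^\<alpha>\<close> times the kernel at \<open>\<zeta>\<close>, so one function on the
  circle dominates all dilates at once.\<close>

lemma Hardy_norm_F_fun_le:
  assumes \<mu>: "finite_borel_measure_01 \<mu>" and \<alpha>: "\<alpha> > 0" and q: "q > 0"
  shows "Hardy_norm q (F_fun \<mu> \<alpha>) \<le> ennreal (2 powr \<alpha>) * circle_Lq_norm q (P_fun \<mu> \<alpha>)"
  unfolding Hardy_norm_def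
proof (rule SUP_least, rule circle_Lq_norm_le_cmult)
  fix \<rho> :: real and \<zeta> :: complex assume \<rho>: "\<rho> \<in> {0..<1}" and \<zeta>: "norm \<zeta> = 1"
  have "ennreal (norm (F_fun \<mu> \<alpha> (of_real \<rho> * \<zeta>))) \<le>
      (\<integral>\<^sup>+t. ennreal (norm (1 / (1 - complex_of_real t * (of_real \<rho> * \<zeta>)) powr complex_of_real \<alpha>)) \<partial>\<mu>)"
    using \<rho> \<zeta> by (subst F_fun_eq_integral[OF \<mu> \<alpha>]) (auto simp: norm_mult norm_integral_le_nn_integral)
  also have "\<dots> \<le> (\<integral>\<^sup>+t. ennreal (2 powr \<alpha>) * ennreal (1 / norm (1 - complex_of_real t * \<zeta>) powr \<alpha>) \<partial>\<mu>)"
  proof (rule nn_integral_mono)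
    fix t assume "t \<in> space \<mu>"
    hence t: "0 \<le> t" "t < 1" by (auto simp: finite_borel_measure_01D(3)[OF \<mu>])
    let ?x = "norm (1 - complex_of_real t * \<zeta>)" and ?y = "norm (1 - complex_of_real t * (of_real \<rho> * \<zeta>))"
    have x: "?x > 0" using norm_one_minus_le(1)[of t \<zeta>] t \<zeta> by linarith
    have xy: "?x \<le> 2 * ?y"
      using norm_one_minus_le(2)[of \<rho> "complex_of_real t * \<zeta>"] \<rho> \<zeta> t by (simp add: norm_mult mult_ac)
    hence y: "?y > 0" using x by linarith
    have "?x powr \<alpha> \<le> 2 powr \<alpha> * ?y powr \<alpha>"
      using powr_mono2[of \<alpha> ?x "2 * ?y"] xy \<alpha> by (simp add: powr_mult)
    hence "1 / ?y powr \<alpha> \<le> 2 powr \<alpha> * (1 / ?x powr \<alpha>)"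
      using x y by (simp add: field_simps)
    moreover have "norm (1 / (1 - complex_of_real t * (of_real \<rho> * \<zeta>)) powr complex_of_real \<alpha>) = 1 / ?y powr \<alpha>"
      using y by (subst norm_divide, subst norm_powr_of_real) auto
    ultimately show "ennreal (norm (1 / (1 - complex_of_real t * (of_real \<rho> * \<zeta>)) powr complex_of_real \<alpha>)) \<le>
        ennreal (2 powr \<alpha>) * ennreal (1 / ?x powr \<alpha>)"
      by (simp only: flip: ennreal_mult'[OF powr_ge_zero]) (rule ennreal_leI)
  qed
  also have "\<dots> = ennreal (2 powr \<alpha>) * P_fun \<mu> \<alpha> \<zeta>"
    unfolding P_fun_def by (rule nn_integral_cmult[OF measurable_P_kernel(2)[OF \<mu>]])
  finally show "ennreal (norm (F_fun \<mu> \<alpha> (of_real \<rho> * \<zeta>))) \<le> ennreal (2 powr \<alpha>) * P_fun \<mu> \<alpha> \<zeta>" .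
qed (use q measurable_P_fun[OF \<mu>] in auto)

section \<open>Moments and the tail integral\<close>

lemma integrable_moment:
  assumes "finite_borel_measure_01 \<mu>"
  shows "integrable \<mu> (\<lambda>t. t ^ n)"
proof -
  interpret finite_measure \<mu> by (rule finite_borel_measure_01D(1)[OF assms])
  note finite_borel_measure_01D(4)[OF assms, measurable]
  show ?thesis
    by (rule integrable_const_bound[of _ 1])
      (auto simp: finite_borel_measure_01D(3)[OF assms] power_le_one)
qed

lemma moment_nonneg:
  assumes "finite_borel_measure_01 \<mu>"
  shows "moment \<mu> n \<ge> 0"
  unfolding moment_def by (intro Bochner_Integration.integral_nonneg)
    (auto simp: finite_borel_measure_01D(3)[OF assms])

lemma ennreal_moment:
  assumes "finite_borel_measure_01 \<mu>"
  shows "ennreal (moment \<mu> n) = (\<integral>\<^sup>+t. ennreal (t ^ n) \<partial>\<mu>)"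
  unfolding moment_def using integrable_moment[OF assms]
  by (intro nn_integral_eq_integral[symmetric]) (auto simp: finite_borel_measure_01D(3)[OF assms])

text \<open>With \<open>v = (n+1)(1-t)\<close> one has
  \<open>(n+1) \<bar>1 - t cis \<theta>\<bar> \<le> 1 + v\<close> and
  \<open>t^n \<le> e exp(-v)\<close>. The bound
  \<open>1 + v \<le> (\<alpha>+1) exp(v/\<alpha>)\<close> is shaped so that its
  \<open>\<alpha>\<close>-th power produces exactly the \<open>exp v\<close> that the second
  estimate cancels.\<close>

lemma power_mult_kernel_le:
  assumes \<alpha>: "\<alpha> > 0" and t: "0 \<le> t" "t < 1" and \<theta>: "0 \<le> \<theta>" "\<theta> \<le> 1 / real (n + 1)"
  shows "real (n + 1) powr \<alpha> * t ^ n \<le> exp 1 * (\<alpha> + 1) powr \<alpha> * (1 / norm (1 - complex_of_real t * cis \<theta>) powr \<alpha>)"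
proof -
  let ?x = "norm (1 - complex_of_real t * cis \<theta>)"
  define v where "v = real (n + 1) * (1 - t)"
  have v: "v \<ge> 0" using t by (simp add: v_def)
  have x: "?x > 0" using norm_one_minus_le(1)[of t "cis \<theta>"] t by auto
  have "?x \<le> norm (1 - complex_of_real t) + norm (of_real t * (1 - cis \<theta>))"
    using norm_triangle_ineq[of "1 - complex_of_real t" "of_real t * (1 - cis \<theta>)"] by (simp add: algebra_simps)
  also have "norm (1 - complex_of_real t) = 1 - t"
    by (subst of_real_1[symmetric], subst of_real_diff[symmetric], subst norm_of_real) (use t in simp)
  also have "norm (of_real t * (1 - cis \<theta>)) \<le> norm (1 - cis \<theta>)"
    using t by (simp add: norm_mult mult_left_le_one_le)
  also have "\<dots> \<le> \<theta>"
    using abs_sin_x_le_abs_x[of "\<theta> / 2"] \<theta> by (simp add: norm_one_minus_cis)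
  finally have "?x \<le> (1 - t) + 1 / real (n + 1)" using \<theta> by simp
  hence "real (n + 1) * ?x \<le> real (n + 1) * ((1 - t) + 1 / real (n + 1))" by (intro mult_left_mono) auto
  also have "\<dots> = 1 + v" by (simp add: v_def field_simps)
  also have "1 + v \<le> (\<alpha> + 1) * (1 + v / \<alpha>)" using \<alpha> v by (simp add: field_simps)
  also have "\<dots> \<le> (\<alpha> + 1) * exp (v / \<alpha>)" using \<alpha> exp_ge_add_one_self[of "v / \<alpha>"] by (intro mult_left_mono) auto
  finally have "(real (n + 1) * ?x) powr \<alpha> \<le> ((\<alpha> + 1) * exp (v / \<alpha>)) powr \<alpha>"
    using \<alpha> by (intro powr_mono2) auto
  also have "\<dots> = (\<alpha> + 1) powr \<alpha> * exp v"
    using \<alpha> by (simp add: powr_mult exp_powr_real)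
  finally have 1: "real (n + 1) powr \<alpha> * ?x powr \<alpha> \<le> (\<alpha> + 1) powr \<alpha> * exp v" by (simp add: powr_mult)
  have "t ^ n \<le> exp (- (1 - t)) ^ n"
    using exp_ge_add_one_self[of "- (1 - t)"] t by (intro power_mono) auto
  also have "\<dots> = exp (1 - t) * exp (- v)"
    by (simp add: v_def exp_of_nat_mult[symmetric] exp_add[symmetric] algebra_simps)
  also have "\<dots> \<le> exp 1 * exp (- v)" using t by (intro mult_right_mono) auto
  finally have 2: "t ^ n \<le> exp 1 * exp (- v)" .
  have "(real (n + 1) powr \<alpha> * ?x powr \<alpha>) * t ^ n \<le> ((\<alpha> + 1) powr \<alpha> * exp v) * (exp 1 * exp (- v))"
    using t by (intro mult_mono 1 2) auto
  also have "\<dots> = exp 1 * (\<alpha> + 1) powr \<alpha>" by (simp add: exp_minus)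
  finally show ?thesis using x by (simp add: field_simps)
qed

lemma moment_le_P_fun:
  assumes \<mu>: "finite_borel_measure_01 \<mu>" and \<alpha>: "\<alpha> > 0" and \<theta>: "0 \<le> \<theta>" "\<theta> \<le> 1 / real (n + 1)"
  shows "ennreal (real (n + 1) powr \<alpha> * moment \<mu> n) \<le> ennreal (exp 1 * (\<alpha> + 1) powr \<alpha>) * P_fun \<mu> \<alpha> (cis \<theta>)"
proof -
  note finite_borel_measure_01D(4)[OF \<mu>, measurable]
  have "ennreal (real (n + 1) powr \<alpha> * moment \<mu> n) = (\<integral>\<^sup>+t. ennreal (real (n + 1) powr \<alpha>) * ennreal (t ^ n) \<partial>\<mu>)"
    by (simp add: ennreal_mult moment_nonneg[OF \<mu>] ennreal_moment[OF \<mu>] nn_integral_cmult)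
  also have "\<dots> \<le> (\<integral>\<^sup>+t. ennreal (exp 1 * (\<alpha> + 1) powr \<alpha>) * ennreal (1 / norm (1 - complex_of_real t * cis \<theta>) powr \<alpha>) \<partial>\<mu>)"
    using power_mult_kernel_le[OF \<alpha> _ _ \<theta>] \<alpha>
    by (intro nn_integral_mono) (auto simp: finite_borel_measure_01D(3)[OF \<mu>] intro!: ennreal_leI simp flip: ennreal_mult)
  also have "\<dots> = ennreal (exp 1 * (\<alpha> + 1) powr \<alpha>) * P_fun \<mu> \<alpha> (cis \<theta>)"
    unfolding P_fun_def by (rule nn_integral_cmult[OF measurable_P_kernel(2)[OF \<mu>]])
  finally show ?thesis .
qed

text \<open>The pointwise bound holds for all angles up to \<open>1/(n+1)\<close>. Integrating it
  over the disjoint intervals between \<open>1/(n+2)\<close> and \<open>1/(n+1)\<close>, whose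
  length is of order \<open>(n+1)^-2\<close>, produces the exponent \<open>-2\<close> in the weight
  of the moment sum.\<close>

lemma moment_sum_le:
  assumes \<gamma>: "\<gamma> > 0" and q: "q > 0"
  shows "\<exists>C>0. \<forall>\<mu>. finite_borel_measure_01 \<mu> \<longrightarrow>
    enn_powr (moment_sum \<mu> \<gamma> q) (1 / q) \<le> ennreal C * circle_Lq_norm q (P_fun \<mu> (\<gamma> + 1))"
proof -
  define \<alpha> where "\<alpha> = \<gamma> + 1"
  have \<alpha>: "\<alpha> > 0" using \<gamma> by (simp add: \<alpha>_def)
  define K where "K = exp 1 * (\<alpha> + 1) powr \<alpha>"
  have K: "K > 0" using \<alpha> by (simp add: K_def)
  \<comment> \<open>\<open>K powr q\<close> and a factor 2 come from the pointwise bound and the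
    interval length; \<open>2 pi\<close> undoes the normalization of arc measure.\<close>
  define L where "L = 4 * pi * K powr q"
  have L: "L > 0" using K by (simp add: L_def)
  have "enn_powr (moment_sum \<mu> \<gamma> q) (1 / q) \<le> ennreal (L powr (1 / q)) * circle_Lq_norm q (P_fun \<mu> \<alpha>)"
    if \<mu>: "finite_borel_measure_01 \<mu>" for \<mu>
  proof -
    let ?A = "\<lambda>n::nat. {1 / real (n + 2)<..1 / real (n + 1)}"
    let ?I = "\<integral>\<^sup>+\<theta>\<in>{0..2*pi}. enn_powr (P_fun \<mu> \<alpha> (cis \<theta>)) q \<partial>lborel"
    define c where "c n = ennreal ((real (n + 1) powr \<alpha> * moment \<mu> n / K) powr q)" for n
    have "(\<Sum>n. c n * emeasure lborel (?A n)) \<le> ?I"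
    proof (rule nn_integral_disjoint_ge)
      show "disjoint_family ?A"
      proof (unfold disjoint_family_on_def, intro ballI impI)
        fix m n :: nat assume "m \<noteq> n"
        thus "?A m \<inter> ?A n = {}"
        proof (induction m n rule: linorder_wlog)
          case (le m n)
          hence "1 / real (n + 1) \<le> 1 / real (m + 2)" by (intro divide_left_mono) auto
          thus ?case by auto
        qed (auto simp: Int_commute)
      qed
      show "?A n \<subseteq> {0..2*pi}" for n
      proof
        fix x assume x: "x \<in> ?A n"
        have "0 \<le> 1 / real (n + 2)" "1 / real (n + 1) \<le> 1" by (simp_all add: field_simps)
        thus "x \<in> {0..2*pi}" using x pi_gt3
          unfolding greaterThanAtMost_iff atLeastAtMost_iff by linarith
      qed
      fix n \<theta> assume \<theta>: "\<theta> \<in> ?A n"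
      have "0 \<le> 1 / real (n + 2)" by simp
      hence "0 \<le> \<theta>" "\<theta> \<le> 1 / real (n + 1)"
        using \<theta> unfolding greaterThanAtMost_iff by linarith+
      hence "ennreal (real (n + 1) powr \<alpha> * moment \<mu> n) \<le> ennreal K * P_fun \<mu> \<alpha> (cis \<theta>)"
        unfolding K_def by (rule moment_le_P_fun[OF \<mu> \<alpha>])
      hence "ennreal (1 / K) * ennreal (real (n + 1) powr \<alpha> * moment \<mu> n) \<le> ennreal (1 / K) * (ennreal K * P_fun \<mu> \<alpha> (cis \<theta>))"
        by (rule mult_left_mono) auto
      also have "\<dots> = P_fun \<mu> \<alpha> (cis \<theta>)" using K by (simp add: mult.assoc[symmetric] flip: ennreal_mult)
      also have "ennreal (1 / K) * ennreal (real (n + 1) powr \<alpha> * moment \<mu> n) = ennreal (real (n + 1) powr \<alpha> * moment \<mu> n / K)"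
        using K moment_nonneg[OF \<mu>] by (simp flip: ennreal_mult)
      finally have "enn_powr (ennreal (real (n + 1) powr \<alpha> * moment \<mu> n / K)) q \<le> enn_powr (P_fun \<mu> \<alpha> (cis \<theta>)) q"
        using q by (intro enn_powr_mono) auto
      thus "c n \<le> enn_powr (P_fun \<mu> \<alpha> (cis \<theta>)) q"
        using K moment_nonneg[OF \<mu>] by (simp add: c_def enn_powr_ennreal)
    qed simp
    have "moment_sum \<mu> \<gamma> q \<le> (\<Sum>n. ennreal (2 * K powr q) * (c n * emeasure lborel (?A n)))"
      unfolding moment_sum_def
    proof (intro suminf_le)
      fix n
      have d: "1 / real (n + 1) - 1 / real (n + 2) \<ge> 1 / (2 * real (n + 1) ^ 2)"
      proof -
        have "1 / real (n + 1) - 1 / real (n + 2) = 1 / (real (n + 1) * real (n + 2))" by (simp add: field_simps)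
        moreover have "real (n + 1) * real (n + 2) \<le> 2 * real (n + 1) ^ 2" by (simp add: power2_eq_square algebra_simps)
        ultimately show ?thesis by (simp add: frac_le del: of_nat_add)
      qed
      have d0: "1 / real (n + 2) \<le> 1 / real (n + 1)" by (intro divide_left_mono) auto
      have "real (n + 1) powr (q * (\<gamma> + 1) - 2) * moment \<mu> n powr q =
          2 * K powr q * ((real (n + 1) powr \<alpha> * moment \<mu> n / K) powr q * (1 / (2 * real (n + 1) ^ 2)))"
        using K moment_nonneg[OF \<mu>, of n]
        by (simp add: powr_mult powr_divide powr_powr \<alpha>_def powr_diff mult.commute[of q])
      also have "\<dots> \<le> 2 * K powr q * ((real (n + 1) powr \<alpha> * moment \<mu> n / K) powr q * (1 / real (n + 1) - 1 / real (n + 2)))"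
        by (intro mult_left_mono d) auto
      finally have "ennreal (real (n + 1) powr (q * (\<gamma> + 1) - 2) * moment \<mu> n powr q) \<le>
          ennreal (2 * K powr q * ((real (n + 1) powr \<alpha> * moment \<mu> n / K) powr q * (1 / real (n + 1) - 1 / real (n + 2))))"
        by (rule ennreal_leI)
      also have "\<dots> = ennreal (2 * K powr q) * (c n * emeasure lborel (?A n))"
        using d0 by (subst ennreal_mult, simp, simp, subst ennreal_mult, simp, simp) (simp add: c_def)
      finally show "ennreal (real (n + 1) powr (q * (\<gamma> + 1) - 2) * moment \<mu> n powr q) \<le>
          ennreal (2 * K powr q) * (c n * emeasure lborel (?A n))" .
    qed auto
    also have "\<dots> \<le> ennreal (2 * K powr q) * ?I"
      unfolding ennreal_suminf_cmult by (intro mult_left_mono \<open>_ \<le> ?I\<close>) auto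
    also have "\<dots> = ennreal L * (ennreal (1 / (2 * pi)) * ?I)"
      by (subst mult.assoc[symmetric], subst ennreal_mult[symmetric]) (auto simp: L_def)
    finally have "enn_powr (moment_sum \<mu> \<gamma> q) (1 / q) \<le> enn_powr (ennreal L * (ennreal (1 / (2 * pi)) * ?I)) (1 / q)"
      using q by (intro enn_powr_mono) auto
    also have "\<dots> = ennreal (L powr (1 / q)) * circle_Lq_norm q (P_fun \<mu> \<alpha>)"
      using L by (simp only: enn_powr_mult[of "ennreal L"] circle_Lq_norm_def enn_powr_ennreal less_imp_le)
    finally show ?thesis .
  qed
  thus ?thesis using L unfolding \<alpha>_def by (intro exI[of _ "L powr (1 / q)"]) auto
qed

text \<open>Since \<open>(1 - 1/(n+1))^n \<ge> 1/e\<close>, the integrand \<open>t^n\<close> is at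
  least \<open>1/e\<close> on the tail; for \<open>n = 0\<close> this uses
  \<open>0^0 = 1\<close>.\<close>

lemma measure_tail_le_moment:
  assumes \<mu>: "finite_borel_measure_01 \<mu>" and t: "1 - 1 / real (n + 1) \<le> t"
  shows "measure \<mu> {t..<1} \<le> exp 1 * moment \<mu> n"
proof -
  interpret finite_measure \<mu> by (rule finite_borel_measure_01D(1)[OF \<mu>])
  define a where "a = real n / real (n + 1)"
  have a: "0 \<le> a" "a \<le> t" using t by (auto simp: a_def field_simps)
  have "1 \<le> exp 1 * a ^ n"
  proof (cases "n = 0")
    case False
    have "1 / a = 1 + 1 / real n" using False by (simp add: a_def field_simps)
    also have "\<dots> \<le> exp (1 / real n)" by (rule exp_ge_add_one_self)
    finally have "(1 / a) ^ n \<le> exp (1 / real n) ^ n" using a by (intro power_mono) auto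
    also have "\<dots> = exp 1" using False by (simp flip: exp_of_nat_mult)
    finally show ?thesis using False by (simp add: a_def power_divide field_simps)
  qed simp
  hence ind: "indicator {t..<1} x \<le> exp 1 * x ^ n" if "x \<in> space \<mu>" for x :: real
  proof (cases "x \<in> {t..<1}")
    case True
    have "1 \<le> exp 1 * a ^ n" by fact
    also have "\<dots> \<le> exp 1 * x ^ n" using True a by (intro mult_left_mono power_mono) auto
    finally show ?thesis using True by simp
  qed (use that in \<open>auto simp: finite_borel_measure_01D(3)[OF \<mu>]\<close>)
  have sets: "{t..<1} \<in> sets \<mu>" using a by (intro interval_in_sets \<mu>) auto
  have "measure \<mu> {t..<1} = (\<integral>x. indicator {t..<1} x \<partial>\<mu>)"
    using sets sets.sets_into_space[OF sets] by (simp add: Int_absorb1)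
  also have "\<dots> \<le> (\<integral>x. exp 1 * x ^ n \<partial>\<mu>)"
    using sets integrable_moment[OF \<mu>] ind by (intro integral_mono) (auto simp: emeasure_eq_measure)
  finally show ?thesis by (simp add: moment_def)
qed

lemma ex_reciprocal_interval:
  assumes "0 \<le> t" "t < (1::real)"
  shows "\<exists>n::nat. 1 - 1 / real (n + 1) \<le> t \<and> t < 1 - 1 / real (n + 2)"
proof -
  define x where "x = 1 / (1 - t)"
  have x: "1 \<le> x" "1 - t = 1 / x" using assms by (auto simp: x_def)
  \<comment> \<open>\<open>n + 1\<close> is the integer part of \<open>1/(1-t)\<close>; that part is
    at least 1, so the subtraction does not truncate.\<close>
  define n where "n = nat \<lfloor>x\<rfloor> - 1"
  have "real (n + 1) \<le> x" "x < real (n + 2)" using x unfolding n_def by linarith+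
  hence "1 / x \<le> 1 / real (n + 1)" "1 / real (n + 2) < 1 / x" using x
    by (auto intro!: divide_left_mono divide_strict_left_mono simp del: of_nat_add)
  thus ?thesis using x(2) by (intro exI[of _ n]) linarith
qed

text \<open>The integral is cut at the points \<open>1 - 1/(n+1)\<close>. On the \<open>n\<close>-th
  interval the tail is controlled by the \<open>n\<close>-th moment, and the length is at most
  \<open>(n+1)^-2\<close>. The total mass is the moment of index 0, hence the first term of the
  moment sum.\<close>

lemma tail_integral_le:
  assumes \<gamma>: "\<gamma> > 0" and q: "q > 0"
  shows "\<exists>C>0. \<forall>\<mu>. finite_borel_measure_01 \<mu> \<longrightarrow>
    enn_powr (ennreal (measure \<mu> {0..<1} powr q) + tail_integral \<mu> \<gamma> q) (1 / q) \<le>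
      ennreal C * enn_powr (moment_sum \<mu> \<gamma> q) (1 / q)"
proof -
  define \<alpha> where "\<alpha> = \<gamma> + 1"
  have \<alpha>: "\<alpha> > 0" using \<gamma> by (simp add: \<alpha>_def)
  define K where "K = (exp 1 * 2 powr \<alpha>) powr q"
  have K: "K > 0" by (simp add: K_def)
  have "enn_powr (ennreal (measure \<mu> {0..<1} powr q) + tail_integral \<mu> \<gamma> q) (1 / q) \<le>
      ennreal ((1 + K) powr (1 / q)) * enn_powr (moment_sum \<mu> \<gamma> q) (1 / q)"
    if \<mu>: "finite_borel_measure_01 \<mu>" for \<mu>
  proof -
    interpret finite_measure \<mu> by (rule finite_borel_measure_01D(1)[OF \<mu>])
    let ?f = "\<lambda>n. ennreal (real (n + 1) powr (q * (\<gamma> + 1) - 2) * moment \<mu> n powr q)"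
    let ?A = "\<lambda>n::nat. {1 - 1 / real (n + 1)..<1 - 1 / real (n + 2)}"
    define c where "c n = ennreal ((exp 1 * moment \<mu> n * (2 powr \<alpha> * real (n + 1) powr \<alpha>)) powr q)" for n
    have m0: "measure \<mu> {0..<1} = moment \<mu> 0"
      using finite_borel_measure_01D(3)[OF \<mu>] by (simp add: moment_def)
    have "ennreal (measure \<mu> {0..<1} powr q) = (\<Sum>n\<in>{0}. ?f n)" by (simp add: m0)
    also have "\<dots> \<le> moment_sum \<mu> \<gamma> q" unfolding moment_sum_def by (rule sum_le_suminf) auto
    finally have 1: "ennreal (measure \<mu> {0..<1} powr q) \<le> moment_sum \<mu> \<gamma> q" .
    have "tail_integral \<mu> \<gamma> q \<le> (\<Sum>n. c n * emeasure lborel (?A n))"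
      unfolding tail_integral_def
    proof (rule nn_integral_cover_le)
      show "AE t in lborel. t \<in> {0..<1} \<longrightarrow> (\<exists>n. t \<in> ?A n)"
        using ex_reciprocal_interval by auto
      fix n t assume t: "t \<in> ?A n"
      have lt: "1 / real (n + 2) < 1 - t" using t by simp
      hence t1: "t < 1" by (smt (verit) divide_nonneg_nonneg of_nat_0_le_iff)
      have "1 / (1 - t) < real (n + 2)" using lt t1 by (simp add: field_simps)
      also have "\<dots> \<le> 2 * real (n + 1)" by simp
      finally have "(1 / (1 - t)) powr \<alpha> \<le> (2 * real (n + 1)) powr \<alpha>"
        using t1 \<alpha> by (intro powr_mono2) auto
      hence "1 / (1 - t) powr \<alpha> \<le> 2 powr \<alpha> * real (n + 1) powr \<alpha>"
        by (simp only: powr_divide powr_mult powr_one_eq_one)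
      moreover have "measure \<mu> {t..<1} \<le> exp 1 * moment \<mu> n"
        using t by (intro measure_tail_le_moment \<mu>) simp
      ultimately have "measure \<mu> {t..<1} * (1 / (1 - t) powr \<alpha>) \<le> exp 1 * moment \<mu> n * (2 powr \<alpha> * real (n + 1) powr \<alpha>)"
        by (intro mult_mono) (auto simp: moment_nonneg[OF \<mu>])
      thus "ennreal ((measure \<mu> {t..<1} / (1 - t) powr (\<gamma> + 1)) powr q) \<le> c n"
        unfolding c_def using q by (intro ennreal_leI powr_mono2) (auto simp: \<alpha>_def)
    qed simp
    also have "\<dots> \<le> (\<Sum>n. ennreal K * ?f n)"
    proof (intro suminf_le)
      fix n
      have d: "1 / real (n + 1) - 1 / real (n + 2) \<le> 1 / real (n + 1) ^ 2"
      proof -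
        have "1 / real (n + 1) - 1 / real (n + 2) = 1 / (real (n + 1) * real (n + 2))" by (simp add: field_simps)
        moreover have "real (n + 1) ^ 2 \<le> real (n + 1) * real (n + 2)" by (simp add: power2_eq_square algebra_simps)
        ultimately show ?thesis by (simp add: frac_le del: of_nat_add)
      qed
      have d0: "1 - 1 / real (n + 1) \<le> 1 - 1 / real (n + 2)" by (simp add: field_simps)
      have "c n * emeasure lborel (?A n) = c n * ennreal (1 / real (n + 1) - 1 / real (n + 2))"
        using d0 by simp
      also have "\<dots> \<le> c n * ennreal (1 / real (n + 1) ^ 2)" by (intro mult_left_mono ennreal_leI d) auto
      also have "\<dots> = ennreal ((exp 1 * moment \<mu> n * (2 powr \<alpha> * real (n + 1) powr \<alpha>)) powr q * (1 / real (n + 1) ^ 2))"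
        by (simp only: c_def flip: ennreal_mult'[OF powr_ge_zero])
      also have "(exp 1 * moment \<mu> n * (2 powr \<alpha> * real (n + 1) powr \<alpha>)) powr q * (1 / real (n + 1) ^ 2) =
         K * (real (n + 1) powr (q * (\<gamma> + 1) - 2) * moment \<mu> n powr q)"
        using moment_nonneg[OF \<mu>, of n]
        by (simp add: K_def powr_mult powr_powr \<alpha>_def powr_diff mult.commute[of q])
      finally show "c n * emeasure lborel (?A n) \<le> ennreal K * ?f n"
        using K by (simp add: ennreal_mult)
    qed auto
    also have "\<dots> = ennreal K * moment_sum \<mu> \<gamma> q" by (simp add: moment_sum_def)
    finally have "ennreal (measure \<mu> {0..<1} powr q) + tail_integral \<mu> \<gamma> q \<le>
        moment_sum \<mu> \<gamma> q + ennreal K * moment_sum \<mu> \<gamma> q" by (intro add_mono 1)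
    also have "\<dots> = ennreal (1 + K) * moment_sum \<mu> \<gamma> q" using K by (simp add: distrib_right)
    finally have "enn_powr (ennreal (measure \<mu> {0..<1} powr q) + tail_integral \<mu> \<gamma> q) (1 / q) \<le>
        enn_powr (ennreal (1 + K) * moment_sum \<mu> \<gamma> q) (1 / q)" using q by (intro enn_powr_mono) auto
    thus ?thesis using K by (simp only: enn_powr_mult enn_powr_ennreal)
  qed
  thus ?thesis using K by (intro exI[of _ "(1 + K) powr (1 / q)"]) auto
qed

text \<open>On block \<open>j\<close> the tail at \<open>t\<close> is at least the tail at
  \<open>a_(j+1)\<close>, so the integral over block \<open>j\<close> controls the term of index
  \<open>j+1\<close>. The term of index 0 is left over, and this is why the total mass is added to
  the integral. The powers of 2 match because \<open>s q = \<alpha> q - 1\<close>.\<close>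

lemma dyadic_seq_le_tail_integral:
  assumes \<mu>: "finite_borel_measure_01 \<mu>" and \<gamma>: "\<gamma> > 0" and q: "q > 0" and s: "s = \<gamma> + 1 - 1 / q"
  shows "seq_lq_norm q (dyadic_seq \<mu> s) \<le> ennreal (2 powr (\<gamma> + 1)) *
    enn_powr (ennreal (measure \<mu> {0..<1} powr q) + tail_integral \<mu> \<gamma> q) (1 / q)"
proof -
  interpret finite_measure \<mu> by (rule finite_borel_measure_01D(1)[OF \<mu>])
  define \<alpha> where "\<alpha> = \<gamma> + 1"
  have \<alpha>: "\<alpha> > 0" using \<gamma> by (simp add: \<alpha>_def)
  let ?A = "\<lambda>j. {dyadic_pt j..<dyadic_pt (Suc j)}"
  let ?T = "\<lambda>j. measure \<mu> {dyadic_pt j..<1}"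
  let ?b = "\<lambda>j. ennreal (\<bar>dyadic_seq \<mu> s j\<bar> powr q)"
  define c where "c j = ennreal ((2 powr (real j * \<alpha>) * ?T (Suc j)) powr q)" for j
  have b: "dyadic_seq \<mu> s j = 2 powr (real j * s) * ?T j" for j by (simp add: dyadic_seq_def dyadic_pt_def)
  have "(\<Sum>j. c j * emeasure lborel (?A j)) \<le> tail_integral \<mu> \<gamma> q"
    unfolding tail_integral_def
  proof (rule nn_integral_disjoint_ge)
    show "disjoint_family ?A"
    proof (unfold disjoint_family_on_def, intro ballI impI)
      fix m n :: nat assume "m \<noteq> n"
      thus "?A m \<inter> ?A n = {}"
      proof (induction m n rule: linorder_wlog)
        case (le m n)
        hence "dyadic_pt (Suc m) \<le> dyadic_pt n" by (intro dyadic_pt_mono) auto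
        thus ?case by auto
      qed (auto simp: Int_commute)
    qed
    show "?A j \<subseteq> {0..<1}" for j using dyadic_pt_nonneg[of j] dyadic_pt_less_1[of "Suc j"] by auto
    fix j t assume t: "t \<in> ?A j"
    have t01: "0 \<le> t" "t < 1" using t dyadic_pt_nonneg[of j] dyadic_pt_less_1[of "Suc j"] by auto
    have "1 - t \<le> 2 powr (- real j)" using t by (simp add: dyadic_pt_def)
    hence "(1 - t) powr \<alpha> \<le> (2 powr (- real j)) powr \<alpha>" using t01 \<alpha> by (intro powr_mono2) auto
    hence "2 powr (real j * \<alpha>) * (1 - t) powr \<alpha> \<le> 2 powr (real j * \<alpha>) * (2 powr (- real j)) powr \<alpha>"
      by (rule mult_left_mono) simp
    also have "\<dots> = 1" by (simp only: powr_powr flip: powr_add) simp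
    finally have "2 powr (real j * \<alpha>) \<le> 1 / (1 - t) powr \<alpha>"
      using t01 by (simp add: field_simps)
    moreover have "?T (Suc j) \<le> measure \<mu> {t..<1}"
      using t t01 by (intro finite_measure_mono interval_in_sets \<mu>) auto
    ultimately have "2 powr (real j * \<alpha>) * ?T (Suc j) \<le> 1 / (1 - t) powr \<alpha> * measure \<mu> {t..<1}"
      by (intro mult_mono) auto
    thus "c j \<le> ennreal ((measure \<mu> {t..<1} / (1 - t) powr (\<gamma> + 1)) powr q)"
      unfolding c_def using q by (intro ennreal_leI powr_mono2) (auto simp: \<alpha>_def)
  qed simp
  have "?b (Suc j) = ennreal (2 powr (\<alpha> * q)) * (c j * emeasure lborel (?A j))" for j
  proof -
    have "emeasure lborel (?A j) = ennreal (dyadic_pt (Suc j) - dyadic_pt j)"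
      by (simp add: dyadic_pt_mono)
    also have "dyadic_pt (Suc j) - dyadic_pt j = 2 powr (- real (Suc j))"
      using dyadic_pt_Suc[of j] by (simp add: dyadic_pt_def)
    finally have "ennreal (2 powr (\<alpha> * q)) * (c j * emeasure lborel (?A j)) =
      ennreal (2 powr (\<alpha> * q) * ((2 powr (real j * \<alpha>) * ?T (Suc j)) powr q * 2 powr (- real (Suc j))))"
      by (simp add: c_def ennreal_mult)
    also have "2 powr (\<alpha> * q) * ((2 powr (real j * \<alpha>) * ?T (Suc j)) powr q * 2 powr (- real (Suc j))) =
      2 powr (\<alpha> * q + real j * \<alpha> * q - real (Suc j)) * ?T (Suc j) powr q"
      by (simp add: powr_mult powr_powr powr_add powr_diff powr_minus field_simps)
    also have "\<alpha> * q + real j * \<alpha> * q - real (Suc j) = real (Suc j) * s * q"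
      using q by (simp add: s \<alpha>_def field_simps)
    also have "2 powr (real (Suc j) * s * q) * ?T (Suc j) powr q = \<bar>dyadic_seq \<mu> s (Suc j)\<bar> powr q"
      by (simp add: b powr_mult powr_powr abs_mult)
    finally show ?thesis ..
  qed
  hence "(\<Sum>j. ?b (Suc j)) \<le> ennreal (2 powr (\<alpha> * q)) * tail_integral \<mu> \<gamma> q"
    using \<open>_ \<le> tail_integral \<mu> \<gamma> q\<close> by (simp add: mult_left_mono)
  moreover have "?b 0 \<le> ennreal (2 powr (\<alpha> * q)) * ennreal (measure \<mu> {0..<1} powr q)"
  proof -
    have "1 \<le> 2 powr (\<alpha> * q)" using \<alpha> q by (intro ge_one_powr_ge_zero) auto
    hence "1 * measure \<mu> {0..<1} powr q \<le> 2 powr (\<alpha> * q) * measure \<mu> {0..<1} powr q" by (intro mult_right_mono) auto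
    thus ?thesis by (simp add: b dyadic_pt_def ennreal_leI flip: ennreal_mult)
  qed
  moreover have "(\<Sum>j. f j) = (\<Sum>j. f (Suc j)) + f 0" for f :: "nat \<Rightarrow> ennreal"
    using suminf_offset[of f 1] by simp
  note this[of ?b]
  ultimately have "(\<Sum>j. ?b j) \<le> ennreal (2 powr (\<alpha> * q)) * (ennreal (measure \<mu> {0..<1} powr q) + tail_integral \<mu> \<gamma> q)"
    using add_mono[of "\<Sum>j. ?b (Suc j)" _ "?b 0"] by (simp only: distrib_left add.commute)
  hence "seq_lq_norm q (dyadic_seq \<mu> s) \<le>
      enn_powr (ennreal (2 powr (\<alpha> * q)) * (ennreal (measure \<mu> {0..<1} powr q) + tail_integral \<mu> \<gamma> q)) (1 / q)"
    unfolding seq_lq_norm_def using q by (intro enn_powr_mono) auto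
  thus ?thesis using q by (simp add: enn_powr_mult enn_powr_ennreal powr_powr \<alpha>_def)
qed

section \<open>Duality and test functions\<close>

text \<open>The extremal choice \<open>x = b^(q-1)\<close>, cut off at \<open>J\<close>, satisfies
  \<open>x^p = b^q\<close> termwise. The finite sum \<open>S\<close> of these terms then obeys
  \<open>S \<le> D S^(1/p)\<close>, which can be divided to give
  \<open>S^(1/q) \<le> D\<close>.\<close>

lemma seq_lq_norm_le_dual:
  assumes p: "p > 1" "1 / p + 1 / q = (1::real)" and b: "\<And>j. b j \<ge> 0"
    and le: "\<And>J x. (\<And>j. x j \<ge> 0) \<Longrightarrow> ennreal (\<Sum>j\<le>J. x j * b j) \<le> D * ennreal ((\<Sum>j\<le>J. x j powr p) powr (1 / p))"
  shows "seq_lq_norm q b \<le> D"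
proof (cases D)
  case (real d)
  have q: "q > 1" by (rule conjugate_exponent_gt_1[OF p])
  have qp: "(q - 1) * p = q" "1 - 1 / p = 1 / q" using p q by (auto simp: field_simps)
  have S: "(\<Sum>j\<le>J. b j powr q) \<le> d powr q" for J
  proof -
    define S where "S = (\<Sum>j\<le>J. b j powr q)"
    have S0: "S \<ge> 0" unfolding S_def by (intro sum_nonneg) auto
    have xb: "b j powr (q - 1) * b j = b j powr q" for j
      using b[of j] q by (cases "b j = 0") (auto simp: powr_diff)
    have "ennreal S \<le> D * ennreal (S powr (1 / p))"
      using le[of "\<lambda>j. b j powr (q - 1)" J] by (simp add: xb powr_powr qp S_def)
    hence *: "S \<le> d * S powr (1 / p)" using real by (simp flip: ennreal_mult)
    show ?thesis
    proof (cases "S = 0")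
      case False
      hence "S powr (1 / q) = S / S powr (1 / p)" using S0 qp by (simp add: powr_diff flip: qp(2))
      also have "\<dots> \<le> d" using * S0 False by (simp add: field_simps)
      finally have "(S powr (1 / q)) powr q \<le> d powr q" using q by (intro powr_mono2) auto
      thus ?thesis using S0 q by (simp add: powr_powr S_def)
    qed (use S_def in auto)
  qed
  have "(\<Sum>j. ennreal (\<bar>b j\<bar> powr q)) \<le> ennreal (d powr q)"
    unfolding suminf_eq_SUP
  proof (rule SUP_least)
    fix n
    have "(\<Sum>j<n. ennreal (\<bar>b j\<bar> powr q)) \<le> (\<Sum>j\<le>n. ennreal (\<bar>b j\<bar> powr q))"
      by (rule sum_mono2) auto
    also have "\<dots> = ennreal (\<Sum>j\<le>n. b j powr q)" using b by simp
    also have "\<dots> \<le> ennreal (d powr q)" by (intro ennreal_leI S)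
    finally show "(\<Sum>j<n. ennreal (\<bar>b j\<bar> powr q)) \<le> ennreal (d powr q)" .
  qed
  hence "seq_lq_norm q b \<le> enn_powr (ennreal (d powr q)) (1 / q)"
    unfolding seq_lq_norm_def using q by (intro enn_powr_mono) auto
  also have "\<dots> = D" using real q by (simp add: enn_powr_ennreal powr_powr)
  finally show ?thesis .
qed simp

text \<open>The function \<open>1/(1 - a_j z)\<close> has norm of order \<open>2^(j/q)\<close> in
  the Hardy space with the conjugate exponent \<open>p\<close>; the factor \<open>2^(-j/q)\<close>
  normalizes it. The cut-off at \<open>J\<close> keeps all sums finite.\<close>

definition test_weight :: "real \<Rightarrow> nat \<Rightarrow> (nat \<Rightarrow> real) \<Rightarrow> nat \<Rightarrow> real" where
  "test_weight q J x j = (if j \<le> J then 2 powr (- real j / q) * x j else 0)"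

lemma test_weight_nonneg: "(\<And>j. x j \<ge> 0) \<Longrightarrow> test_weight q J x j \<ge> 0"
  by (simp add: test_weight_def)

lemma dyadic_kernel_test_weight:
  assumes "\<And>j. x j \<ge> 0"
  shows "dyadic_kernel \<alpha> (test_weight q J x) \<zeta> =
    (\<Sum>j\<le>J. ennreal (test_weight q J x j / norm (1 - of_real (dyadic_pt j) * \<zeta>) powr \<alpha>))"
  unfolding dyadic_kernel_def by (rule suminf_finite) (auto simp: test_weight_def)

text \<open>The dyadic kernel estimate is used with the two exponents exchanged and kernel exponent
  1. Its weight \<open>2^(j(1 - 1/p)) = 2^(j/q)\<close> undoes the normalization, leaving the plain
  power sum of \<open>x\<close>.\<close>

lemma circle_norm_test_weight_le:
  assumes p: "p > 1" "1 / p + 1 / q = (1::real)"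
  shows "\<exists>C>0. \<forall>x J. (\<forall>j. x j \<ge> 0) \<longrightarrow> circle_Lq_norm p (dyadic_kernel 1 (test_weight q J x)) \<le>
    ennreal C * ennreal ((\<Sum>j\<le>J. x j powr p) powr (1 / p))"
proof -
  have q: "q > 1" by (rule conjugate_exponent_gt_1[OF p])
  obtain C where C: "C > 0" "\<And>m. (\<forall>j. m j \<ge> 0) \<Longrightarrow> circle_Lq_norm p (dyadic_kernel 1 m) \<le>
    ennreal C * seq_lq_norm p (\<lambda>j. 2 powr (real j * (1 - 1 / p)) * m j)"
    using circle_Lq_norm_dyadic_kernel_le[of q p 1] p q by (auto simp: add.commute)
  have "circle_Lq_norm p (dyadic_kernel 1 (test_weight q J x)) \<le>
    ennreal C * ennreal ((\<Sum>j\<le>J. x j powr p) powr (1 / p))" if x: "\<And>j. x j \<ge> 0" for x J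
  proof -
    have pq: "1 - 1 / p = 1 / q" using p by simp
    have "(\<lambda>j. 2 powr (real j * (1 - 1 / p)) * test_weight q J x j) = (\<lambda>j. if j \<le> J then x j else 0)"
      by (auto simp: test_weight_def pq simp flip: powr_add mult.assoc)
    moreover have "(\<Sum>j. ennreal (\<bar>if j \<le> J then x j else 0\<bar> powr p)) = (\<Sum>j\<le>J. ennreal (\<bar>if j \<le> J then x j else 0\<bar> powr p))"
      by (rule suminf_finite) auto
    moreover have "(\<Sum>j\<le>J. ennreal (\<bar>if j \<le> J then x j else 0\<bar> powr p)) = ennreal (\<Sum>j\<le>J. x j powr p)"
      using x by (simp add: sum_ennreal)
    ultimately have "seq_lq_norm p (\<lambda>j. 2 powr (real j * (1 - 1 / p)) * test_weight q J x j) =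
      ennreal ((\<Sum>j\<le>J. x j powr p) powr (1 / p))"
      by (simp add: seq_lq_norm_def enn_powr_ennreal sum_nonneg)
    thus ?thesis using C(2)[of "test_weight q J x"] x by (simp add: test_weight_nonneg)
  qed
  thus ?thesis using C(1) by blast
qed

text \<open>A nonnegative integrand admits no cancellation, so taking the modulus outside the
  integral loses nothing; the bound \<open>B\<close> provides integrability.\<close>

lemma ennreal_norm_integral_of_real:
  assumes \<mu>: "finite_borel_measure_01 \<mu>" and [measurable]: "h \<in> borel_measurable \<mu>"
    and h: "\<And>t. 0 \<le> t \<Longrightarrow> t < 1 \<Longrightarrow> 0 \<le> h t \<and> h t \<le> B"
  shows "ennreal (norm (\<integral>t. complex_of_real (h t) \<partial>\<mu>)) = (\<integral>\<^sup>+t. ennreal (h t) \<partial>\<mu>)"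
proof -
  interpret finite_measure \<mu> by (rule finite_borel_measure_01D(1)[OF \<mu>])
  note sp = finite_borel_measure_01D(3)[OF \<mu>]
  have int: "integrable \<mu> h"
    by (rule integrable_const_bound[of _ B]) (use h in \<open>auto simp: sp\<close>)
  have "(\<integral>t. complex_of_real (h t) \<partial>\<mu>) = of_real (\<integral>t. h t \<partial>\<mu>)" by (rule integral_of_real[OF int])
  moreover have "(\<integral>t. h t \<partial>\<mu>) \<ge> 0" by (intro Bochner_Integration.integral_nonneg) (use h in \<open>auto simp: sp\<close>)
  moreover have "AE t in \<mu>. 0 \<le> h t" by (rule AE_I2) (use h in \<open>auto simp: sp\<close>)
  ultimately show ?thesis using nn_integral_eq_integral[OF int] by simp
qed

lemma nn_integral_ge_tails:
  assumes \<mu>: "finite_borel_measure_01 \<mu>" and c: "\<And>j. c j \<ge> 0"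
    and le: "\<And>t. 0 \<le> t \<Longrightarrow> t < 1 \<Longrightarrow> (\<Sum>j\<le>J. c j * indicator {dyadic_pt j..<1} t) \<le> h t"
  shows "ennreal (\<Sum>j\<le>J. c j * measure \<mu> {dyadic_pt j..<1}) \<le> (\<integral>\<^sup>+t. ennreal (h t) \<partial>\<mu>)"
proof -
  interpret finite_measure \<mu> by (rule finite_borel_measure_01D(1)[OF \<mu>])
  have sets [measurable]: "{dyadic_pt j..<1} \<in> sets \<mu>" for j
    by (intro interval_in_sets \<mu> dyadic_pt_nonneg) simp
  have "ennreal (\<Sum>j\<le>J. c j * measure \<mu> {dyadic_pt j..<1}) = (\<Sum>j\<le>J. ennreal (c j) * emeasure \<mu> {dyadic_pt j..<1})"
    using c by (simp add: emeasure_eq_measure ennreal_mult flip: sum_ennreal)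
  also have "\<dots> = (\<integral>\<^sup>+t. (\<Sum>j\<le>J. ennreal (c j) * indicator {dyadic_pt j..<1} t) \<partial>\<mu>)"
    using sets by (subst nn_integral_sum) (auto simp: nn_integral_cmult_indicator)
  also have "\<dots> \<le> (\<integral>\<^sup>+t. ennreal (h t) \<partial>\<mu>)"
  proof (rule nn_integral_mono)
    fix t assume "t \<in> space \<mu>"
    hence t: "0 \<le> t" "t < 1" by (auto simp: finite_borel_measure_01D(3)[OF \<mu>])
    have "(\<Sum>j\<le>J. ennreal (c j) * indicator {dyadic_pt j..<1} t) = (\<Sum>j\<le>J. ennreal (c j * indicator {dyadic_pt j..<1} t))"
      by (intro sum.cong) (auto simp: indicator_def)
    also have "\<dots> = ennreal (\<Sum>j\<le>J. c j * indicator {dyadic_pt j..<1} t)"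
      using c by (subst sum_ennreal) auto
    also have "\<dots> \<le> ennreal (h t)" by (intro ennreal_leI le t)
    finally show "(\<Sum>j\<le>J. ennreal (c j) * indicator {dyadic_pt j..<1} t) \<le> ennreal (h t)" .
  qed
  finally show ?thesis .
qed

text \<open>Every factor is within \<open>2^-j\<close> of 1, and the defect of a product is at most
  the sum of the defects. The 3 counts the factors of the longer product.\<close>

lemma one_minus_prod_le:
  assumes "j \<le> J" "dyadic_pt j \<le> t" "t < 1" "0 \<le> t"
  shows "1 - t * dyadic_pt J \<le> 3 * 2 powr (- real j)" "1 - t * (dyadic_pt J * dyadic_pt j) \<le> 3 * 2 powr (- real j)"
    "0 < 1 - t * dyadic_pt J" "0 < 1 - t * (dyadic_pt J * dyadic_pt j)"
proof -
  have J: "1 - dyadic_pt J \<le> 2 powr (- real j)" using dyadic_pt_mono[OF assms(1)] by (simp add: dyadic_pt_def)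
  have j: "1 - dyadic_pt j = 2 powr (- real j)" "1 - t \<le> 2 powr (- real j)" using assms(2) by (auto simp: dyadic_pt_def)
  have aux: "1 - a * b \<le> (1 - a) + (1 - b)" if "a \<le> 1" "b \<le> 1" for a b :: real
    using mult_nonneg_nonneg[of "1 - a" "1 - b"] that by (simp add: algebra_simps)
  have lt: "a * b < 1" if "0 \<le> a" "a < 1" "0 \<le> b" "b < 1" for a b :: real
    using mult_left_le[of b a] that by linarith
  note d = dyadic_pt_nonneg[of j] dyadic_pt_nonneg[of J] dyadic_pt_less_1[of j] dyadic_pt_less_1[of J]
  show 1: "0 < 1 - t * dyadic_pt J" using lt[of t "dyadic_pt J"] d assms by simp
  have jj: "dyadic_pt J * dyadic_pt j < 1" "0 \<le> dyadic_pt J * dyadic_pt j" using lt[of "dyadic_pt J" "dyadic_pt j"] d by auto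
  show "0 < 1 - t * (dyadic_pt J * dyadic_pt j)" using lt[of t "dyadic_pt J * dyadic_pt j"] jj assms by simp
  have p: "2 powr (- real j) > 0" by simp
  show "1 - t * dyadic_pt J \<le> 3 * 2 powr (- real j)" using aux[of t "dyadic_pt J"] J j p d assms by linarith
  show "1 - t * (dyadic_pt J * dyadic_pt j) \<le> 3 * 2 powr (- real j)"
    using aux[of t "dyadic_pt J * dyadic_pt j"] aux[of "dyadic_pt J" "dyadic_pt j"] jj J j p d assms by linarith
qed

lemma powr_reciprocal_ge:
  assumes "0 < y" "y \<le> 3 * 2 powr (- real j)" "a \<ge> 0"
  shows "2 powr (real j * a) / 3 powr a \<le> 1 / y powr a"
proof -
  have "y powr a \<le> (3 * 2 powr (- real j)) powr a" using assms by (intro powr_mono2) auto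
  hence "1 / (3 * 2 powr (- real j)) powr a \<le> 1 / y powr a" using assms by (intro divide_left_mono) auto
  moreover have "1 / (3 * 2 powr (- real j)) powr a = 2 powr (real j * a) / 3 powr a"
  proof -
    have "(3 * 2 powr (- real j)) powr a = 3 powr a * 2 powr (- (real j * a))"
      by (simp only: powr_mult powr_powr) simp
    thus ?thesis by (simp add: powr_minus field_simps)
  qed
  ultimately show ?thesis by simp
qed

section \<open>Pairing the dyadic tails with test weights\<close>

lemma dyadic_seq_nonneg: "dyadic_seq \<mu> s j \<ge> 0"
  by (simp add: dyadic_seq_def)

text \<open>The splitting \<open>2^(j s) = 2^(-j/q) 2^(j \<alpha>)\<close> separates the
  normalization of the test weight from \<open>2^(j \<alpha>)\<close>, the order of magnitude that
  the integrands reach on \<open>t \<ge> a_j\<close>.\<close>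

lemma sum_test_weight:
  assumes "s = \<alpha> - 1 / q"
  shows "(\<Sum>j\<le>J. x j * dyadic_seq \<mu> s j) = (\<Sum>j\<le>J. test_weight q J x j * 2 powr (real j * \<alpha>) * measure \<mu> {dyadic_pt j..<1})"
proof (rule sum.cong[OF refl])
  fix j assume "j \<in> {..J}"
  moreover have "2 powr (real j * s) = 2 powr (- real j / q) * 2 powr (real j * \<alpha>)"
    unfolding assms by (simp add: powr_add[symmetric] algebra_simps)
  ultimately show "x j * dyadic_seq \<mu> s j = test_weight q J x j * 2 powr (real j * \<alpha>) * measure \<mu> {dyadic_pt j..<1}"
    by (simp add: test_weight_def dyadic_seq_def dyadic_pt_def)
qed

lemma Cesaro_op_holomorphic:
  assumes "finite_borel_measure_01 \<mu>" "\<gamma> > 0" "f holomorphic_on ball 0 1"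
  shows "Cesaro_op \<mu> \<gamma> f holomorphic_on ball 0 1"
proof (rule power_series_holomorphic)
  fix w :: complex assume w: "w \<in> ball 0 1"
  show "(\<lambda>n. complex_of_real (moment \<mu> n) *
       (\<Sum>k\<le>n. complex_of_real (Gamma (real (n - k) + \<gamma>) / (Gamma \<gamma> * fact (n - k))) * taylor_coeff f k)
       * (w - 0) ^ n) sums Cesaro_op \<mu> \<gamma> f w"
    using Cesaro_op_sums_integral[OF assms w] Cesaro_op_eq_integral[OF assms w] by simp
qed

lemma F_fun_holomorphic:
  assumes "finite_borel_measure_01 \<mu>" "\<alpha> > 0"
  shows "F_fun \<mu> \<alpha> holomorphic_on ball 0 1"
  unfolding F_fun_def by (intro Cesaro_op_holomorphic assms holomorphic_intros)

lemma norm_integral_Cesaro_le: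
  assumes \<mu>: "finite_borel_measure_01 \<mu>" and \<gamma>: "\<gamma> \<ge> 0" and z: "z \<in> ball 0 1"
  shows "ennreal (norm (\<integral>t. f t / (1 - complex_of_real t * z) powr complex_of_real \<gamma> \<partial>\<mu>)) \<le>
    (\<integral>\<^sup>+t. ennreal (norm (f t) / (1 - t) powr \<gamma>) \<partial>\<mu>)"
proof -
  have "ennreal (norm (\<integral>t. f t / (1 - complex_of_real t * z) powr complex_of_real \<gamma> \<partial>\<mu>)) \<le>
    (\<integral>\<^sup>+t. ennreal (norm (f t / (1 - complex_of_real t * z) powr complex_of_real \<gamma>)) \<partial>\<mu>)"
    by (rule norm_integral_le_nn_integral)
  also have "\<dots> \<le> (\<integral>\<^sup>+t. ennreal (norm (f t) / (1 - t) powr \<gamma>) \<partial>\<mu>)"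
  proof (rule nn_integral_mono)
    fix t assume "t \<in> space \<mu>"
    hence t: "0 \<le> t" "t < 1" by (auto simp: finite_borel_measure_01D(3)[OF \<mu>])
    have ge: "1 - t \<le> norm (1 - complex_of_real t * z)" using norm_one_minus_le(1)[of t z] t z by simp
    hence ne: "1 - complex_of_real t * z \<noteq> 0" using t by auto
    have "(1 - t) powr \<gamma> \<le> norm (1 - complex_of_real t * z) powr \<gamma>" using ge \<gamma> t by (intro powr_mono2) auto
    hence "norm (f t) / norm (1 - complex_of_real t * z) powr \<gamma> \<le> norm (f t) / (1 - t) powr \<gamma>"
      using t ne by (intro divide_left_mono) auto
    thus "ennreal (norm (f t / (1 - complex_of_real t * z) powr complex_of_real \<gamma>)) \<le> ennreal (norm (f t) / (1 - t) powr \<gamma>)"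
      by (intro ennreal_leI) (simp only: norm_divide norm_powr_of_real[OF ne])
  qed
  finally show ?thesis .
qed

lemma Hinf_norm_Cesaro_le:
  assumes p: "p > 1" "1 / p + 1 / q = (1::real)" and \<mu>: "finite_borel_measure_01 \<mu>" and \<gamma>: "\<gamma> > 0"
    and f: "f holomorphic_on ball 0 1"
  shows "Hinf_norm (Cesaro_op \<mu> \<gamma> f) \<le> ennreal (2 powr \<gamma>) * circle_Lq_norm q (P_fun \<mu> (\<gamma> + 1)) * Hardy_norm p f"
  unfolding Hinf_norm_def
proof (rule SUP_least)
  fix z :: complex assume z: "z \<in> ball 0 1"
  have "ennreal (norm (Cesaro_op \<mu> \<gamma> f z)) \<le> (\<integral>\<^sup>+t. ennreal (norm (f (of_real t * z)) / (1 - t) powr \<gamma>) \<partial>\<mu>)"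
    unfolding Cesaro_op_eq_integral[OF \<mu> \<gamma> f z] using \<gamma> by (intro norm_integral_Cesaro_le \<mu> z) auto
  also have "\<dots> \<le> ennreal (2 powr \<gamma>) * (Hardy_norm p f * circle_Lq_norm q (P_fun \<mu> (\<gamma> + 1)))"
    using \<gamma> by (intro nn_integral_weighted_le p \<mu> f z) auto
  finally show "ennreal (norm (Cesaro_op \<mu> \<gamma> f z)) \<le> ennreal (2 powr \<gamma>) * circle_Lq_norm q (P_fun \<mu> (\<gamma> + 1)) * Hardy_norm p f"
    by (simp add: mult_ac)
qed

lemma Hardy_Hinf_opnorm_Cesaro_le:
  assumes "p > 1" "1 / p + 1 / q = (1::real)" "finite_borel_measure_01 \<mu>" "\<gamma> > 0"
  shows "Hardy_Hinf_opnorm p (Cesaro_op \<mu> \<gamma>) \<le> ennreal (2 powr \<gamma>) * circle_Lq_norm q (P_fun \<mu> (\<gamma> + 1))"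
  unfolding Hardy_Hinf_opnorm_def
  using Hinf_norm_Cesaro_le[OF assms] by (intro Inf_lower) (auto simp: Hardy_def)

text \<open>At the real point \<open>a_j a_J\<close> the integrand is positive, and it is at least
  \<open>2^(j \<alpha>) / 3^\<alpha>\<close> for \<open>t \<ge> a_j\<close>. The factor
  \<open>a_J\<close> will be the point \<open>z\<close> in the inequality for sums of values of
  \<open>F\<close>; it is harmless because \<open>j \<le> J\<close>.\<close>

lemma F_fun_dyadic_ge:
  assumes \<mu>: "finite_borel_measure_01 \<mu>" and \<alpha>: "\<alpha> > 0" and jJ: "j \<le> J"
  shows "ennreal (2 powr (real j * \<alpha>) * measure \<mu> {dyadic_pt j..<1}) \<le>
    ennreal (3 powr \<alpha>) * ennreal (norm (F_fun \<mu> \<alpha> (of_real (dyadic_pt j) * of_real (dyadic_pt J))))"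
proof -
  interpret finite_measure \<mu> by (rule finite_borel_measure_01D(1)[OF \<mu>])
  note sp = finite_borel_measure_01D(3)[OF \<mu>]
  note finite_borel_measure_01D(4)[OF \<mu>, measurable]
  define r where "r = dyadic_pt j * dyadic_pt J"
  have r: "0 \<le> r" "r < 1"
    using dyadic_pt_nonneg[of j] dyadic_pt_nonneg[of J] dyadic_pt_less_1[of j] dyadic_pt_less_1[of J]
      mult_left_le[of "dyadic_pt J" "dyadic_pt j"] by (auto simp: r_def)
  have rc: "of_real (dyadic_pt j) * of_real (dyadic_pt J) = complex_of_real r" by (simp add: r_def)
  let ?h = "\<lambda>t. 1 / (1 - t * r) powr \<alpha>"
  have tr: "1 - r \<le> 1 - t * r" "0 < 1 - t * r" if "0 \<le> t" "t < 1" for t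
    using r that mult_left_le_one_le[of r t] by auto
  have "F_fun \<mu> \<alpha> (complex_of_real r) = (\<integral>t. 1 / (1 - complex_of_real t * of_real r) powr complex_of_real \<alpha> \<partial>\<mu>)"
    using r by (intro F_fun_eq_integral[OF \<mu> \<alpha>]) auto
  also have "\<dots> = (\<integral>t. complex_of_real (?h t) \<partial>\<mu>)"
    by (intro Bochner_Integration.integral_cong refl)
      (use tr in \<open>auto simp: sp less_imp_le simp flip: powr_of_real\<close>)
  finally have "ennreal (norm (F_fun \<mu> \<alpha> (complex_of_real r))) = (\<integral>\<^sup>+t. ennreal (?h t) \<partial>\<mu>)"
  proof (simp only:, intro ennreal_norm_integral_of_real[OF \<mu>, where B = "1 / (1 - r) powr \<alpha>"])
    fix t :: real assume t: "0 \<le> t" "t < 1"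
    have "(1 - r) powr \<alpha> \<le> (1 - t * r) powr \<alpha>" using tr[OF t] r \<alpha> by (intro powr_mono2) auto
    thus "0 \<le> ?h t \<and> ?h t \<le> 1 / (1 - r) powr \<alpha>" using r by (auto intro!: frac_le)
  qed measurable
  moreover have "ennreal (2 powr (real j * \<alpha>) / 3 powr \<alpha> * measure \<mu> {dyadic_pt j..<1}) \<le> (\<integral>\<^sup>+t. ennreal (?h t) \<partial>\<mu>)"
  proof -
    have sets: "{dyadic_pt j..<1} \<in> sets \<mu>" by (intro interval_in_sets \<mu> dyadic_pt_nonneg) simp
    have "ennreal (2 powr (real j * \<alpha>) / 3 powr \<alpha> * measure \<mu> {dyadic_pt j..<1}) =
       (\<integral>\<^sup>+t. ennreal (2 powr (real j * \<alpha>) / 3 powr \<alpha>) * indicator {dyadic_pt j..<1} t \<partial>\<mu>)"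
      using sets by (simp add: nn_integral_cmult_indicator emeasure_eq_measure flip: ennreal_mult)
    also have "\<dots> \<le> (\<integral>\<^sup>+t. ennreal (?h t) \<partial>\<mu>)"
    proof (rule nn_integral_mono)
      fix t assume "t \<in> space \<mu>"
      hence t: "0 \<le> t" "t < 1" by (auto simp: sp)
      show "ennreal (2 powr (real j * \<alpha>) / 3 powr \<alpha>) * indicator {dyadic_pt j..<1} t \<le> ennreal (?h t)"
      proof (cases "dyadic_pt j \<le> t")
        case True
        have "1 - t * r \<le> 3 * 2 powr (- real j)" using one_minus_prod_le(2)[OF jJ True t(2,1)] by (simp add: r_def mult_ac)
        thus ?thesis using powr_reciprocal_ge[of "1 - t * r" j \<alpha>] tr[OF t] \<alpha> True t by (simp add: ennreal_leI)
      qed auto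
    qed
    finally show ?thesis .
  qed
  ultimately have "ennreal (2 powr (real j * \<alpha>) / 3 powr \<alpha> * measure \<mu> {dyadic_pt j..<1}) \<le>
      ennreal (norm (F_fun \<mu> \<alpha> (complex_of_real r)))" by simp
  hence "ennreal (3 powr \<alpha>) * ennreal (2 powr (real j * \<alpha>) / 3 powr \<alpha> * measure \<mu> {dyadic_pt j..<1}) \<le>
      ennreal (3 powr \<alpha>) * ennreal (norm (F_fun \<mu> \<alpha> (complex_of_real r)))" by (rule mult_left_mono) auto
  thus ?thesis by (simp add: rc flip: ennreal_mult)
qed

text \<open>Cauchy's formula on a circle of radius \<open>\<rho> < 1\<close>, tested against a discrete measure on the
  points \<open>1 - 2\<^sup>-\<^sup>j\<close>, yields a Fejer--Riesz type inequality.\<close>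

lemma sum_test_weight_norm_le:
  assumes p: "p > 1" "1 / p + 1 / q = (1::real)" and F: "F holomorphic_on ball 0 1"
    and \<rho>: "z \<in> ball 0 1" and x: "\<And>j. x j \<ge> 0"
  shows "(\<Sum>j\<le>J. ennreal (test_weight q J x j) * ennreal (norm (F (of_real (dyadic_pt j) * z)))) \<le>
    Hardy_norm q F * circle_Lq_norm p (dyadic_kernel 1 (test_weight q J x))"
proof -
  let ?g = "test_weight q J x"
  let ?u = "\<lambda>\<theta>. ennreal (norm (F (z * cis \<theta>)))"
  let ?k = "\<lambda>j \<theta>. ennreal (1 / norm (1 - of_real (dyadic_pt j) * cis \<theta>) powr 1)"
  let ?c = "ennreal (1 / (2 * pi))"
  have q: "q > 1" by (rule conjugate_exponent_gt_1[OF p])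
  note measurable_circle_norm[OF F \<rho>, measurable]
  have [measurable]: "(\<lambda>\<theta>. norm (1 - of_real (dyadic_pt j) * cis \<theta>)) \<in> borel_measurable borel" for j
    by (intro borel_measurable_continuous_onI continuous_intros)
  \<comment> \<open>The Cauchy bound is taken with \<open>\<gamma> = 0\<close>: no weight on the
    left, and the kernel of exponent 1 on the right.\<close>
  have "(\<Sum>j\<le>J. ennreal (?g j) * ennreal (norm (F (of_real (dyadic_pt j) * z)))) \<le>
      (\<Sum>j\<le>J. ennreal (?g j) * (?c * (\<integral>\<^sup>+\<theta>\<in>{0..2*pi}. ?u \<theta> * ?k j \<theta> \<partial>lborel)))"
    using Cauchy_kernel_bound[OF F \<rho> dyadic_pt_nonneg dyadic_pt_less_1 order_refl]
    by (intro sum_mono mult_left_mono) (use dyadic_pt_less_1 in \<open>auto simp: less_imp_neq\<close>)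
  also have "\<dots> = (\<Sum>j\<le>J. ?c * (\<integral>\<^sup>+\<theta>. ennreal (?g j) * (?u \<theta> * ?k j \<theta> * indicator {0..2*pi} \<theta>) \<partial>lborel))"
    by (subst nn_integral_cmult) (auto simp: mult.left_commute)
  also have "\<dots> = ?c * (\<integral>\<^sup>+\<theta>. (\<Sum>j\<le>J. ennreal (?g j) * (?u \<theta> * ?k j \<theta> * indicator {0..2*pi} \<theta>)) \<partial>lborel)"
    by (subst nn_integral_sum) (auto simp: sum_distrib_left)
  also have "(\<lambda>\<theta>. \<Sum>j\<le>J. ennreal (?g j) * (?u \<theta> * ?k j \<theta> * indicator {0..2*pi} \<theta>)) =
      (\<lambda>\<theta>. ?u \<theta> * dyadic_kernel 1 ?g (cis \<theta>) * indicator {0..2*pi} \<theta>)"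
  proof
    fix \<theta> :: real
    have "ennreal (?g j) * (?u \<theta> * ?k j \<theta> * indicator {0..2*pi} \<theta>) =
      ?u \<theta> * ennreal (?g j / norm (1 - of_real (dyadic_pt j) * cis \<theta>) powr 1) * indicator {0..2*pi} \<theta>" for j
    proof -
      have "ennreal (?g j / norm (1 - of_real (dyadic_pt j) * cis \<theta>) powr 1) = ennreal (?g j) * ?k j \<theta>"
        using test_weight_nonneg[of x q J j] x by (simp flip: ennreal_mult)
      thus ?thesis by (simp only: mult_ac)
    qed
    thus "(\<Sum>j\<le>J. ennreal (?g j) * (?u \<theta> * ?k j \<theta> * indicator {0..2*pi} \<theta>)) =
      ?u \<theta> * dyadic_kernel 1 ?g (cis \<theta>) * indicator {0..2*pi} \<theta>"
      unfolding dyadic_kernel_test_weight[OF x] by (simp only: sum_distrib_left sum_distrib_right)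
  qed
  also have "?c * (\<integral>\<^sup>+\<theta>. ?u \<theta> * dyadic_kernel 1 ?g (cis \<theta>) * indicator {0..2*pi} \<theta> \<partial>lborel) \<le>
      circle_Lq_norm q (\<lambda>\<zeta>. ennreal (norm (F (z * \<zeta>)))) * circle_Lq_norm p (dyadic_kernel 1 ?g)"
    using p q by (intro circle_Hoelder measurable_dyadic_kernel measurable_circle_norm[OF F \<rho>]) (auto simp: add.commute)
  also have "\<dots> \<le> Hardy_norm q F * circle_Lq_norm p (dyadic_kernel 1 ?g)"
    by (intro mult_right_mono circle_Lq_norm_le_Hardy_norm F \<rho>) auto
  finally show ?thesis .
qed

text \<open>The weighted sum of \<open>\<bar>F\<bar>\<close> over the points \<open>a_j a_J\<close>
  is estimated twice: from below by the pairing of \<open>x\<close> with \<open>dyadic_seq\<close>,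
  from above by the Hardy norm times the power sum of \<open>x\<close>. Duality removes
  \<open>x\<close>.\<close>

lemma seq_lq_norm_le_Hardy_norm_F_fun:
  assumes p: "p > 1" "1 / p + 1 / q = (1::real)" and \<alpha>: "\<alpha> > 0" and s: "s = \<alpha> - 1 / q"
  shows "\<exists>C>0. \<forall>\<mu>. finite_borel_measure_01 \<mu> \<longrightarrow>
    seq_lq_norm q (dyadic_seq \<mu> s) \<le> ennreal C * Hardy_norm q (F_fun \<mu> \<alpha>)"
proof -
  obtain C where C: "C > 0" "\<And>x J. (\<And>j. x j \<ge> 0) \<Longrightarrow> circle_Lq_norm p (dyadic_kernel 1 (test_weight q J x)) \<le>
    ennreal C * ennreal ((\<Sum>j\<le>J. x j powr p) powr (1 / p))"
    using circle_norm_test_weight_le[OF p] by blast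
  have "seq_lq_norm q (dyadic_seq \<mu> s) \<le> ennreal (3 powr \<alpha> * C) * Hardy_norm q (F_fun \<mu> \<alpha>)"
    if \<mu>: "finite_borel_measure_01 \<mu>" for \<mu>
  proof (rule seq_lq_norm_le_dual[OF p dyadic_seq_nonneg])
    fix J :: nat and x :: "nat \<Rightarrow> real" assume x: "\<And>j. x j \<ge> 0"
    let ?g = "test_weight q J x"
    let ?z = "complex_of_real (dyadic_pt J)"
    note g = test_weight_nonneg[of x q J, OF x]
    have z: "?z \<in> ball 0 1" using dyadic_pt_nonneg[of J] dyadic_pt_less_1[of J] by simp
    have "ennreal (\<Sum>j\<le>J. x j * dyadic_seq \<mu> s j) =
        (\<Sum>j\<le>J. ennreal (?g j) * ennreal (2 powr (real j * \<alpha>) * measure \<mu> {dyadic_pt j..<1}))"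
      unfolding sum_test_weight[OF s] using g by (simp add: mult.assoc flip: sum_ennreal ennreal_mult)
    also have "\<dots> \<le> (\<Sum>j\<le>J. ennreal (?g j) * (ennreal (3 powr \<alpha>) * ennreal (norm (F_fun \<mu> \<alpha> (of_real (dyadic_pt j) * ?z)))))"
      by (intro sum_mono mult_left_mono F_fun_dyadic_ge \<mu> \<alpha>) auto
    also have "\<dots> = ennreal (3 powr \<alpha>) * (\<Sum>j\<le>J. ennreal (?g j) * ennreal (norm (F_fun \<mu> \<alpha> (of_real (dyadic_pt j) * ?z))))"
      by (simp add: sum_distrib_left mult.left_commute)
    also have "\<dots> \<le> ennreal (3 powr \<alpha>) * (Hardy_norm q (F_fun \<mu> \<alpha>) * circle_Lq_norm p (dyadic_kernel 1 ?g))"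
      by (intro mult_left_mono sum_test_weight_norm_le p F_fun_holomorphic \<mu> \<alpha> z x) auto
    also have "\<dots> \<le> ennreal (3 powr \<alpha>) * (Hardy_norm q (F_fun \<mu> \<alpha>) * (ennreal C * ennreal ((\<Sum>j\<le>J. x j powr p) powr (1 / p))))"
      by (intro mult_left_mono C(2) x) auto
    finally show "ennreal (\<Sum>j\<le>J. x j * dyadic_seq \<mu> s j) \<le>
      ennreal (3 powr \<alpha> * C) * Hardy_norm q (F_fun \<mu> \<alpha>) * ennreal ((\<Sum>j\<le>J. x j powr p) powr (1 / p))"
      using C(1) by (simp add: ennreal_mult mult_ac)
  qed
  thus ?thesis using C(1) by (intro exI[of _ "3 powr \<alpha> * C"]) auto
qed

text \<open>A holomorphic companion of \<open>dyadic_kernel\<close> with exponent 1: on the circle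
  the latter sums the moduli of its terms, and on \<open>[0,1)\<close> the terms are positive when
  \<open>x\<close> is.\<close>

definition test_fun :: "real \<Rightarrow> nat \<Rightarrow> (nat \<Rightarrow> real) \<Rightarrow> complex \<Rightarrow> complex" where
  "test_fun q J x z = (\<Sum>j\<le>J. of_real (test_weight q J x j) / (1 - of_real (dyadic_pt j) * z))"

lemma test_fun_holomorphic: "test_fun q J x holomorphic_on ball 0 1"
  unfolding test_fun_def
proof (intro holomorphic_intros)
  fix j :: nat and z :: complex assume "z \<in> ball 0 1"
  thus "1 - of_real (dyadic_pt j) * z \<noteq> 0"
    using norm_one_minus_le(1)[of "dyadic_pt j" z] dyadic_pt_nonneg[of j] dyadic_pt_less_1[of j] by auto
qed

text \<open>The triangle inequality is affordable because the available bound already concerns the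
  sum of the moduli. Passing from radius \<open>\<rho>\<close> to radius 1 costs the factor
  2.\<close>

lemma Hardy_norm_test_fun_le:
  assumes p: "p > 0" and x: "\<And>j. x j \<ge> 0"
  shows "Hardy_norm p (test_fun q J x) \<le> ennreal 2 * circle_Lq_norm p (dyadic_kernel 1 (test_weight q J x))"
  unfolding Hardy_norm_def
proof (rule SUP_least, rule circle_Lq_norm_le_cmult[OF p _ measurable_dyadic_kernel])
  fix \<rho> :: real and \<zeta> :: complex assume \<rho>: "\<rho> \<in> {0..<1}" and \<zeta>: "norm \<zeta> = 1"
  note g = test_weight_nonneg[of x q J, OF x]
  have "norm (test_fun q J x (of_real \<rho> * \<zeta>)) \<le>
      (\<Sum>j\<le>J. norm (of_real (test_weight q J x j) / (1 - of_real (dyadic_pt j) * (of_real \<rho> * \<zeta>))))"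
    unfolding test_fun_def by (rule norm_sum)
  also have "\<dots> \<le> (\<Sum>j\<le>J. 2 * (test_weight q J x j / norm (1 - of_real (dyadic_pt j) * \<zeta>) powr 1))"
  proof (rule sum_mono)
    fix j
    have d: "0 \<le> dyadic_pt j" "dyadic_pt j < 1" by (rule dyadic_pt_nonneg, rule dyadic_pt_less_1)
    have 1: "0 < norm (1 - of_real (dyadic_pt j) * \<zeta>)"
      using norm_one_minus_le(1)[of "dyadic_pt j" \<zeta>] d \<zeta> by linarith
    have "norm (1 - of_real (dyadic_pt j) * \<zeta>) \<le> 2 * norm (1 - of_real (dyadic_pt j) * (of_real \<rho> * \<zeta>))"
      using norm_one_minus_le(2)[of \<rho> "of_real (dyadic_pt j) * \<zeta>"] \<rho> \<zeta> d by (simp add: norm_mult mult_ac)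
    moreover have "1 / b \<le> 2 / a" if "0 < a" "a \<le> 2 * b" for a b :: real
      using that by (simp add: field_simps)
    ultimately have "1 / norm (1 - of_real (dyadic_pt j) * (of_real \<rho> * \<zeta>)) \<le> 2 / norm (1 - of_real (dyadic_pt j) * \<zeta>)"
      using 1 by blast
    hence "test_weight q J x j * (1 / norm (1 - of_real (dyadic_pt j) * (of_real \<rho> * \<zeta>))) \<le>
        test_weight q J x j * (2 / norm (1 - of_real (dyadic_pt j) * \<zeta>))"
      by (intro mult_left_mono g)
    thus "norm (of_real (test_weight q J x j) / (1 - of_real (dyadic_pt j) * (of_real \<rho> * \<zeta>))) \<le>
      2 * (test_weight q J x j / norm (1 - of_real (dyadic_pt j) * \<zeta>) powr 1)"
      using g[of j] by (simp add: norm_divide mult_ac)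
  qed
  finally have "ennreal (norm (test_fun q J x (of_real \<rho> * \<zeta>))) \<le>
     ennreal (\<Sum>j\<le>J. 2 * (test_weight q J x j / norm (1 - of_real (dyadic_pt j) * \<zeta>) powr 1))" by (rule ennreal_leI)
  also have "\<dots> = ennreal 2 * dyadic_kernel 1 (test_weight q J x) \<zeta>"
  proof -
    let ?a = "\<lambda>j. test_weight q J x j / norm (1 - of_real (dyadic_pt j) * \<zeta>) powr 1"
    have "(\<Sum>j\<le>J. ennreal (?a j)) = ennreal (\<Sum>j\<le>J. ?a j)" using g by (intro sum_ennreal) auto
    moreover have "ennreal (2 * (\<Sum>j\<le>J. ?a j)) = ennreal 2 * ennreal (\<Sum>j\<le>J. ?a j)" by (rule ennreal_mult') simp
    ultimately show ?thesis unfolding dyadic_kernel_test_weight[OF x] by (simp only: sum_distrib_left)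
  qed
  finally show "ennreal (norm (test_fun q J x (of_real \<rho> * \<zeta>))) \<le> ennreal 2 * dyadic_kernel 1 (test_weight q J x) \<zeta>" .
qed simp

text \<open>The image is evaluated at \<open>\<rho> = a_J\<close>, where the integrand is positive.
  For \<open>t \<ge> a_j\<close> the \<open>j\<close>-th summand gains at least
  \<open>2^j / 3\<close> from the test function and \<open>2^(j \<gamma>) / 3^\<gamma>\<close> from
  the weight of the operator; discarding smaller \<open>t\<close> leaves the tail masses.\<close>

lemma Cesaro_op_test_fun_ge:
  assumes \<mu>: "finite_borel_measure_01 \<mu>" and \<gamma>: "\<gamma> > 0" and x: "\<And>j. x j \<ge> 0" and s: "s = \<gamma> + 1 - 1 / q"
  shows "ennreal (\<Sum>j\<le>J. x j * dyadic_seq \<mu> s j) \<le>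
    ennreal (3 powr (\<gamma> + 1)) * Hinf_norm (Cesaro_op \<mu> \<gamma> (test_fun q J x))"
proof -
  interpret finite_measure \<mu> by (rule finite_borel_measure_01D(1)[OF \<mu>])
  note sp = finite_borel_measure_01D(3)[OF \<mu>]
  note finite_borel_measure_01D(4)[OF \<mu>, measurable]
  define \<rho> where "\<rho> = dyadic_pt J"
  let ?g = "test_weight q J x"
  note g = test_weight_nonneg[of x q J, OF x]
  have \<rho>: "0 \<le> \<rho>" "\<rho> < 1" unfolding \<rho>_def by (rule dyadic_pt_nonneg, rule dyadic_pt_less_1)
  have d: "0 \<le> dyadic_pt j" "dyadic_pt j < 1" for j by (rule dyadic_pt_nonneg, rule dyadic_pt_less_1)
  define h where "h t = (\<Sum>j\<le>J. ?g j / (1 - t * (\<rho> * dyadic_pt j))) / (1 - t * \<rho>) powr \<gamma>" for t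
  have tr: "1 - \<rho> \<le> 1 - t * \<rho>" "0 < 1 - t * \<rho>" if "0 \<le> t" "t < 1" for t
    using \<rho> that mult_left_le_one_le[of \<rho> t] by auto
  have trj: "1 - \<rho> \<le> 1 - t * (\<rho> * dyadic_pt j)" "0 < 1 - t * (\<rho> * dyadic_pt j)" if "0 \<le> t" "t < 1" for t j
  proof -
    have "t * (\<rho> * dyadic_pt j) \<le> \<rho> * dyadic_pt j" using \<rho> d[of j] that by (intro mult_left_le_one_le) auto
    also have "\<dots> \<le> \<rho>" using \<rho> d[of j] by (intro mult_left_le) auto
    finally show "1 - \<rho> \<le> 1 - t * (\<rho> * dyadic_pt j)" "0 < 1 - t * (\<rho> * dyadic_pt j)" using \<rho> by auto
  qed
  have "Cesaro_op \<mu> \<gamma> (test_fun q J x) (of_real \<rho>) =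
      (\<integral>t. test_fun q J x (of_real t * of_real \<rho>) / (1 - complex_of_real t * of_real \<rho>) powr complex_of_real \<gamma> \<partial>\<mu>)"
    using \<rho> by (intro Cesaro_op_eq_integral \<mu> \<gamma> test_fun_holomorphic) auto
  also have "\<dots> = (\<integral>t. complex_of_real (h t) \<partial>\<mu>)"
  proof (intro Bochner_Integration.integral_cong refl)
    fix t assume "t \<in> space \<mu>"
    hence t: "0 \<le> t" "t < 1" by (auto simp: sp)
    have "(1 - complex_of_real t * of_real \<rho>) powr complex_of_real \<gamma> = of_real ((1 - t * \<rho>) powr \<gamma>)"
      using tr[OF t] by (simp flip: powr_of_real)
    moreover have "test_fun q J x (of_real t * of_real \<rho>) = of_real (\<Sum>j\<le>J. ?g j / (1 - t * (\<rho> * dyadic_pt j)))"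
      by (simp add: test_fun_def mult_ac)
    ultimately show "test_fun q J x (of_real t * of_real \<rho>) / (1 - complex_of_real t * of_real \<rho>) powr complex_of_real \<gamma> = of_real (h t)"
      by (simp add: h_def)
  qed
  finally have *: "Cesaro_op \<mu> \<gamma> (test_fun q J x) (of_real \<rho>) = (\<integral>t. complex_of_real (h t) \<partial>\<mu>)" .
  have "ennreal (norm (Cesaro_op \<mu> \<gamma> (test_fun q J x) (of_real \<rho>))) = (\<integral>\<^sup>+t. ennreal (h t) \<partial>\<mu>)"
    unfolding *
  proof (rule ennreal_norm_integral_of_real[OF \<mu>, where B = "(\<Sum>j\<le>J. ?g j / (1 - \<rho>)) / (1 - \<rho>) powr \<gamma>"])
    show "h \<in> borel_measurable \<mu>" unfolding h_def by measurable
    fix t :: real assume t: "0 \<le> t" "t < 1"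
    have "h t \<le> (\<Sum>j\<le>J. ?g j / (1 - \<rho>)) / (1 - \<rho>) powr \<gamma>"
      unfolding h_def using \<rho> tr[OF t] trj[OF t] \<gamma> g
      by (intro frac_le sum_nonneg sum_mono powr_mono2 divide_nonneg_nonneg) (auto simp: less_imp_le)
    moreover have "0 \<le> h t" unfolding h_def using g trj[OF t]
      by (intro divide_nonneg_nonneg sum_nonneg) (auto simp: less_imp_le)
    ultimately show "0 \<le> h t \<and> h t \<le> (\<Sum>j\<le>J. ?g j / (1 - \<rho>)) / (1 - \<rho>) powr \<gamma>" by blast
  qed
  moreover have "ennreal (\<Sum>j\<le>J. (?g j * 2 powr (real j * (\<gamma> + 1)) / 3 powr (\<gamma> + 1)) * measure \<mu> {dyadic_pt j..<1}) \<le>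
      (\<integral>\<^sup>+t. ennreal (h t) \<partial>\<mu>)"
  proof (rule nn_integral_ge_tails[OF \<mu>])
    fix t :: real assume t: "0 \<le> t" "t < 1"
    show "(\<Sum>j\<le>J. ?g j * 2 powr (real j * (\<gamma> + 1)) / 3 powr (\<gamma> + 1) * indicator {dyadic_pt j..<1} t) \<le> h t"
      unfolding h_def sum_divide_distrib
    proof (rule sum_mono)
      fix j assume j: "j \<in> {..J}"
      show "?g j * 2 powr (real j * (\<gamma> + 1)) / 3 powr (\<gamma> + 1) * indicator {dyadic_pt j..<1} t \<le>
        ?g j / (1 - t * (\<rho> * dyadic_pt j)) / (1 - t * \<rho>) powr \<gamma>"
      proof (cases "dyadic_pt j \<le> t")
        case True
        note le = one_minus_prod_le[OF _ True t(2,1), of J, folded \<rho>_def]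
        have "2 powr (real j * 1) / 3 powr 1 * (2 powr (real j * \<gamma>) / 3 powr \<gamma>) \<le>
          1 / (1 - t * (\<rho> * dyadic_pt j)) powr 1 * (1 / (1 - t * \<rho>) powr \<gamma>)"
          using le j \<gamma> by (intro mult_mono powr_reciprocal_ge) auto
        hence "?g j * (2 powr (real j * 1) / 3 powr 1 * (2 powr (real j * \<gamma>) / 3 powr \<gamma>)) \<le>
          ?g j * (1 / (1 - t * (\<rho> * dyadic_pt j)) powr 1 * (1 / (1 - t * \<rho>) powr \<gamma>))" by (intro mult_left_mono g)
        thus ?thesis using True t trj[OF t, of j] by (simp add: powr_add distrib_left mult_ac)
      next
        case False
        thus ?thesis using g[of j] trj[OF t, of j] by simp
      qed
    qed
  qed (use g in auto)
  moreover have "ennreal (norm (Cesaro_op \<mu> \<gamma> (test_fun q J x) (of_real \<rho>))) \<le> Hinf_norm (Cesaro_op \<mu> \<gamma> (test_fun q J x))"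
    unfolding Hinf_norm_def using \<rho> by (intro SUP_upper) auto
  moreover have "(\<Sum>j\<le>J. (?g j * 2 powr (real j * (\<gamma> + 1)) / 3 powr (\<gamma> + 1)) * measure \<mu> {dyadic_pt j..<1}) =
      (\<Sum>j\<le>J. x j * dyadic_seq \<mu> s j) / 3 powr (\<gamma> + 1)"
    unfolding sum_test_weight[OF s] by (simp add: sum_divide_distrib)
  ultimately have "ennreal ((\<Sum>j\<le>J. x j * dyadic_seq \<mu> s j) / 3 powr (\<gamma> + 1)) \<le> Hinf_norm (Cesaro_op \<mu> \<gamma> (test_fun q J x))"
    by simp
  hence "ennreal (3 powr (\<gamma> + 1)) * ennreal ((\<Sum>j\<le>J. x j * dyadic_seq \<mu> s j) / 3 powr (\<gamma> + 1)) \<le>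
      ennreal (3 powr (\<gamma> + 1)) * Hinf_norm (Cesaro_op \<mu> \<gamma> (test_fun q J x))" by (rule mult_left_mono) auto
  thus ?thesis by (simp add: sum_nonneg x dyadic_seq_nonneg flip: ennreal_mult)
qed

lemma seq_lq_norm_le_opnorm:
  assumes p: "p > 1" "1 / p + 1 / q = (1::real)" and \<gamma>: "\<gamma> > 0" and s: "s = \<gamma> + 1 - 1 / q"
  shows "\<exists>C>0. \<forall>\<mu>. finite_borel_measure_01 \<mu> \<longrightarrow>
    seq_lq_norm q (dyadic_seq \<mu> s) \<le> ennreal C * Hardy_Hinf_opnorm p (Cesaro_op \<mu> \<gamma>)"
proof -
  obtain C where C: "C > 0" "\<And>x J. (\<And>j. x j \<ge> 0) \<Longrightarrow> circle_Lq_norm p (dyadic_kernel 1 (test_weight q J x)) \<le>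
    ennreal C * ennreal ((\<Sum>j\<le>J. x j powr p) powr (1 / p))"
    using circle_norm_test_weight_le[OF p] by blast
  define K where "K = 3 powr (\<gamma> + 1) * (2 * C)"
  have K: "K > 0" using C by (simp add: K_def)
  have "seq_lq_norm q (dyadic_seq \<mu> s) \<le> ennreal K * Hardy_Hinf_opnorm p (Cesaro_op \<mu> \<gamma>)"
    if \<mu>: "finite_borel_measure_01 \<mu>" for \<mu>
  proof -
    \<comment> \<open>The estimate is shown for each admissible constant \<open>c\<close>, infinite
      ones included; after division by \<open>K\<close> the left side is a lower bound of the set
      whose infimum is the operator norm.\<close>
    have le: "seq_lq_norm q (dyadic_seq \<mu> s) \<le> ennreal K * c"
      if c: "\<And>f. f \<in> Hardy p \<Longrightarrow> Hinf_norm (Cesaro_op \<mu> \<gamma> f) \<le> c * Hardy_norm p f" for c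
    proof (rule seq_lq_norm_le_dual[OF p dyadic_seq_nonneg])
      fix J :: nat and x :: "nat \<Rightarrow> real" assume x: "\<And>j. x j \<ge> 0"
      let ?X = "ennreal ((\<Sum>j\<le>J. x j powr p) powr (1 / p))"
      let ?f = "test_fun q J x"
      have "Hardy_norm p ?f \<le> ennreal 2 * circle_Lq_norm p (dyadic_kernel 1 (test_weight q J x))"
        using p x by (intro Hardy_norm_test_fun_le) auto
      also have "\<dots> \<le> ennreal 2 * (ennreal C * ?X)" by (intro mult_left_mono C x) auto
      finally have f: "Hardy_norm p ?f \<le> ennreal 2 * (ennreal C * ?X)" .
      also have "\<dots> < \<infinity>" by (simp add: ennreal_mult_less_top)
      finally have "?f \<in> Hardy p" by (simp add: Hardy_def test_fun_holomorphic)
      note c[OF this]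
      also have "c * Hardy_norm p ?f \<le> c * (ennreal 2 * (ennreal C * ?X))" by (intro mult_left_mono f) auto
      finally have "ennreal (3 powr (\<gamma> + 1)) * Hinf_norm (Cesaro_op \<mu> \<gamma> ?f) \<le>
        ennreal (3 powr (\<gamma> + 1)) * (c * (ennreal 2 * (ennreal C * ?X)))" by (rule mult_left_mono) auto
      also have "\<dots> = ennreal K * c * ?X"
      proof -
        have "ennreal K = ennreal (3 powr (\<gamma> + 1)) * (ennreal 2 * ennreal C)"
          using C(1) unfolding K_def by (subst ennreal_mult, simp, simp, subst ennreal_mult) auto
        thus ?thesis by (simp only: mult_ac)
      qed
      finally show "ennreal (\<Sum>j\<le>J. x j * dyadic_seq \<mu> s j) \<le> ennreal K * c * ?X"
        by (rule order.trans[OF Cesaro_op_test_fun_ge[OF \<mu> \<gamma> x s]])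
    qed
    have "ennreal (1 / K) * seq_lq_norm q (dyadic_seq \<mu> s) \<le> c"
      if "\<And>f. f \<in> Hardy p \<Longrightarrow> Hinf_norm (Cesaro_op \<mu> \<gamma> f) \<le> c * Hardy_norm p f" for c
    proof -
      have "ennreal (1 / K) * seq_lq_norm q (dyadic_seq \<mu> s) \<le> ennreal (1 / K) * (ennreal K * c)"
        by (intro mult_left_mono le that) auto
      thus ?thesis using K by (simp flip: mult.assoc ennreal_mult)
    qed
    hence "ennreal (1 / K) * seq_lq_norm q (dyadic_seq \<mu> s) \<le> Hardy_Hinf_opnorm p (Cesaro_op \<mu> \<gamma>)"
      unfolding Hardy_Hinf_opnorm_def by (intro Inf_greatest) blast
    hence "ennreal K * (ennreal (1 / K) * seq_lq_norm q (dyadic_seq \<mu> s)) \<le> ennreal K * Hardy_Hinf_opnorm p (Cesaro_op \<mu> \<gamma>)"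
      by (rule mult_left_mono) auto
    thus ?thesis using K by (simp flip: mult.assoc ennreal_mult)
  qed
  thus ?thesis using K by blast
qed

section \<open>Boundedness and compactness\<close>

text \<open>The operator is defined by a \<open>suminf\<close>, which is additive only for
  convergent series; \<open>Cesaro_op_sums_integral\<close> supplies the convergence.\<close>

lemma Cesaro_op_diff:
  assumes \<mu>: "finite_borel_measure_01 \<mu>" and \<gamma>: "\<gamma> > 0"
    and f: "f holomorphic_on ball 0 1" and g: "g holomorphic_on ball 0 1" and z: "z \<in> ball 0 1"
  shows "Cesaro_op \<mu> \<gamma> (\<lambda>w. f w - g w) z = Cesaro_op \<mu> \<gamma> f z - Cesaro_op \<mu> \<gamma> g z"
proof -
  have tc: "taylor_coeff (\<lambda>w. f w - g w) k = taylor_coeff f k - taylor_coeff g k" for k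
    using higher_deriv_diff[OF f g, of 0 k] by (simp add: taylor_coeff_def diff_divide_distrib)
  from sums_diff[OF Cesaro_op_sums_integral[OF \<mu> \<gamma> f z] Cesaro_op_sums_integral[OF \<mu> \<gamma> g z]]
  show ?thesis
    unfolding Cesaro_op_eq_integral[OF \<mu> \<gamma> f z, symmetric] Cesaro_op_eq_integral[OF \<mu> \<gamma> g z, symmetric]
      Cesaro_op_def[of _ _ "\<lambda>w. f w - g w"] tc right_diff_distrib sum_subtractf left_diff_distrib
    by (rule sums_unique[symmetric])
qed

lemma Cesaro_op_cmult:
  assumes \<mu>: "finite_borel_measure_01 \<mu>" and \<gamma>: "\<gamma> > 0"
    and f: "f holomorphic_on ball 0 1" and z: "z \<in> ball 0 1"
  shows "Cesaro_op \<mu> \<gamma> (\<lambda>w. c * f w) z = c * Cesaro_op \<mu> \<gamma> f z"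
proof -
  have tc: "taylor_coeff (\<lambda>w. c * f w) k = c * taylor_coeff f k" for k
    using higher_deriv_cmult[OF f, of 0 k c] by (simp add: taylor_coeff_def)
  from sums_mult[OF Cesaro_op_sums_integral[OF \<mu> \<gamma> f z], of c]
  show ?thesis
    unfolding Cesaro_op_eq_integral[OF \<mu> \<gamma> f z, symmetric]
    by (simp add: Cesaro_op_def[of _ _ "\<lambda>w. c * f w"] tc sums_iff sum_distrib_left mult_ac)
qed

section \<open>Scaling of the norms and finiteness of the operator norm\<close>

lemma Hardy_norm_cmult_le:
  assumes "p > 0" "f holomorphic_on ball 0 1"
  shows "Hardy_norm p (\<lambda>z. c * f z) \<le> ennreal (norm c) * Hardy_norm p f"
  unfolding Hardy_norm_def
proof (rule SUP_least)
  fix \<rho> :: real assume \<rho>: "\<rho> \<in> {0..<1}"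
  have "circle_Lq_norm p (\<lambda>\<zeta>. ennreal (norm (c * f (of_real \<rho> * \<zeta>)))) \<le>
      ennreal (norm c) * circle_Lq_norm p (\<lambda>\<zeta>. ennreal (norm (f (of_real \<rho> * \<zeta>))))"
    using \<rho> by (intro circle_Lq_norm_le_cmult measurable_circle_norm assms) (auto simp: norm_mult ennreal_mult)
  also have "\<dots> \<le> ennreal (norm c) * (SUP \<rho>\<in>{0..<1}. circle_Lq_norm p (\<lambda>\<zeta>. ennreal (norm (f (of_real \<rho> * \<zeta>)))))"
    by (intro mult_left_mono SUP_upper \<rho>) auto
  finally show "circle_Lq_norm p (\<lambda>\<zeta>. ennreal (norm (c * f (of_real \<rho> * \<zeta>)))) \<le>
     ennreal (norm c) * (SUP \<rho>\<in>{0..<1}. circle_Lq_norm p (\<lambda>\<zeta>. ennreal (norm (f (of_real \<rho> * \<zeta>)))))" .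
qed

lemma Hinf_norm_cmult_le:
  assumes "\<And>z. z \<in> ball 0 1 \<Longrightarrow> f z = c * g z"
  shows "Hinf_norm f \<le> ennreal (norm c) * Hinf_norm g"
  unfolding Hinf_norm_def
proof (rule SUP_least)
  fix z :: complex assume z: "z \<in> ball 0 1"
  have "ennreal (norm (f z)) = ennreal (norm c) * ennreal (norm (g z))"
    by (simp add: assms[OF z] norm_mult ennreal_mult)
  also have "\<dots> \<le> ennreal (norm c) * (SUP z\<in>ball 0 1. ennreal (norm (g z)))"
    by (intro mult_left_mono SUP_upper z) auto
  finally show "ennreal (norm (f z)) \<le> ennreal (norm c) * (SUP z\<in>ball 0 1. ennreal (norm (g z)))" .
qed

lemma bounded_Cesaro_iff:
  assumes \<mu>: "finite_borel_measure_01 \<mu>" and \<gamma>: "\<gamma> > 0"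
  shows "bounded_Hardy_Hinf p (Cesaro_op \<mu> \<gamma>) \<longleftrightarrow> Hardy_Hinf_opnorm p (Cesaro_op \<mu> \<gamma>) < \<infinity>"
proof
  assume "bounded_Hardy_Hinf p (Cesaro_op \<mu> \<gamma>)"
  then obtain C :: real where "\<forall>f\<in>Hardy p. Hinf_norm (Cesaro_op \<mu> \<gamma> f) \<le> ennreal C * Hardy_norm p f"
    unfolding bounded_Hardy_Hinf_def by blast
  hence "Hardy_Hinf_opnorm p (Cesaro_op \<mu> \<gamma>) \<le> ennreal C"
    unfolding Hardy_Hinf_opnorm_def by (intro Inf_lower) auto
  thus "Hardy_Hinf_opnorm p (Cesaro_op \<mu> \<gamma>) < \<infinity>" by (simp add: le_less_trans)
next
  assume "Hardy_Hinf_opnorm p (Cesaro_op \<mu> \<gamma>) < \<infinity>"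
  then obtain C where C: "\<And>f. f \<in> Hardy p \<Longrightarrow> Hinf_norm (Cesaro_op \<mu> \<gamma> f) \<le> C * Hardy_norm p f" "C < \<infinity>"
    unfolding Hardy_Hinf_opnorm_def Inf_less_iff by blast
  obtain c where c: "C = ennreal c" "c \<ge> 0" using C(2) by (cases C) auto
  have "Cesaro_op \<mu> \<gamma> f \<in> Hinf" if f: "f \<in> Hardy p" for f
  proof -
    have "C * Hardy_norm p f < \<infinity>" using C(2) f by (auto simp: Hardy_def ennreal_mult_less_top)
    thus ?thesis using C(1)[OF f] f Cesaro_op_holomorphic[OF \<mu> \<gamma>] by (auto simp: Hinf_def Hardy_def)
  qed
  thus "bounded_Hardy_Hinf p (Cesaro_op \<mu> \<gamma>)" using C(1) c by (auto simp: bounded_Hardy_Hinf_def)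
qed

text \<open>If no finite constant is admissible, the unit ball contains functions whose images have
  norm at least \<open>n\<close> for each \<open>n\<close>. Along a convergent subsequence the
  images would be eventually bounded, contradicting \<open>r n \<ge> n\<close>.\<close>

lemma compact_imp_opnorm_finite:
  assumes \<mu>: "finite_borel_measure_01 \<mu>" and \<gamma>: "\<gamma> > 0" and p: "p > 0"
    and comp: "compact_Hardy_Hinf p (Cesaro_op \<mu> \<gamma>)"
  shows "Hardy_Hinf_opnorm p (Cesaro_op \<mu> \<gamma>) < \<infinity>"
proof (rule ccontr)
  let ?T = "Cesaro_op \<mu> \<gamma>"
  assume "\<not> Hardy_Hinf_opnorm p ?T < \<infinity>"
  hence inf: "Hardy_Hinf_opnorm p ?T = top" by (simp add: less_top[symmetric])
  have "\<exists>G\<in>Hardy p. Hardy_norm p G \<le> ennreal 1 \<and> ennreal (real n) \<le> Hinf_norm (?T G)" for n :: nat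
  proof -
    have "\<exists>f\<in>Hardy p. \<not> Hinf_norm (?T f) \<le> ennreal (real n) * Hardy_norm p f"
    proof (rule ccontr)
      assume "\<not> ?thesis"
      hence "Hardy_Hinf_opnorm p ?T \<le> ennreal (real n)" unfolding Hardy_Hinf_opnorm_def by (intro Inf_lower) auto
      thus False by (simp add: inf top_unique)
    qed
    then obtain f where f: "f \<in> Hardy p" "ennreal (real n) * Hardy_norm p f < Hinf_norm (?T f)" by (auto simp: not_le)
    have hol: "f holomorphic_on ball 0 1" using f(1) by (simp add: Hardy_def)
    obtain h where h: "Hardy_norm p f = ennreal h" "h \<ge> 0" using f(1) by (cases "Hardy_norm p f") (auto simp: Hardy_def)
    have "?T f \<in> Hinf" using comp f(1) by (simp add: compact_Hardy_Hinf_def)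
    then obtain H where H: "Hinf_norm (?T f) = ennreal H" "H \<ge> 0" by (cases "Hinf_norm (?T f)") (auto simp: Hinf_def)
    have nH: "real n * h < H" using f(2) h H by (simp add: ennreal_less_iff flip: ennreal_mult)
    hence H0: "H > 0" using h(2) by (smt (verit) mult_nonneg_nonneg of_nat_0_le_iff)
    show ?thesis
    proof (cases "n = 0")
      case True
      have "Hardy_norm p (\<lambda>z. 0 * f z) \<le> ennreal (norm (0::complex)) * Hardy_norm p f"
        by (rule Hardy_norm_cmult_le[OF p hol])
      hence "Hardy_norm p (\<lambda>z. 0) = 0" by simp
      thus ?thesis using True by (intro bexI[of _ "\<lambda>z. 0"]) (auto simp: Hardy_def)
    next
      case False
      \<comment> \<open>Scaling uses the norm \<open>H\<close> of the image, known to be positive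
        even if \<open>h\<close> were 0. The image of \<open>G\<close> then has norm at least
        \<open>n\<close>, while \<open>G\<close> has norm at most \<open>n h / H < 1\<close>. This
        factor is invertible only for \<open>n > 0\<close>, hence the separate case above.\<close>
      define c where "c = real n / H"
      have c: "c > 0" using False H0 by (simp add: c_def)
      define G where "G = (\<lambda>z. of_real c * f z)"
      have "Hardy_norm p G \<le> ennreal (norm (complex_of_real c)) * Hardy_norm p f"
        unfolding G_def by (rule Hardy_norm_cmult_le[OF p hol])
      also have "\<dots> = ennreal (c * h)" using c h by (simp add: ennreal_mult)
      also have "\<dots> \<le> ennreal 1" using nH H0 by (intro ennreal_leI) (simp add: c_def field_simps)
      finally have 1: "Hardy_norm p G \<le> ennreal 1" .
      have Ghol: "G holomorphic_on ball 0 1" unfolding G_def by (intro holomorphic_intros hol)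
      have "G \<in> Hardy p" using Ghol 1 by (simp add: Hardy_def le_less_trans)
      moreover have "ennreal (real n) \<le> Hinf_norm (?T G)"
      proof -
        have "Hinf_norm (?T f) \<le> ennreal (norm (complex_of_real (1 / c))) * Hinf_norm (?T G)"
        proof (rule Hinf_norm_cmult_le)
          fix z :: complex assume "z \<in> ball 0 1"
          from Cesaro_op_cmult[OF \<mu> \<gamma> hol this, of "of_real c"]
          show "?T f z = complex_of_real (1 / c) * ?T G z" using c by (simp add: G_def)
        qed
        hence "ennreal c * Hinf_norm (?T f) \<le> ennreal c * (ennreal (1 / c) * Hinf_norm (?T G))"
          using c by (intro mult_left_mono) (auto simp: norm_divide)
        also have "\<dots> = Hinf_norm (?T G)" using c by (simp flip: mult.assoc ennreal_mult)
        also have "ennreal c * Hinf_norm (?T f) = ennreal (real n)" using H H0 c by (simp add: c_def flip: ennreal_mult)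
        finally show ?thesis .
      qed
      ultimately show ?thesis using 1 by blast
    qed
  qed
  then obtain G where G: "\<And>n. G n \<in> Hardy p" "\<And>n. Hardy_norm p (G n) \<le> ennreal 1" "\<And>n. ennreal (real n) \<le> Hinf_norm (?T (G n))"
    by metis
  have "(\<forall>n. G n \<in> Hardy p) \<and> (\<exists>M::real. \<forall>n. Hardy_norm p (G n) \<le> ennreal M)" using G(1,2) by blast
  from mp[OF spec[OF conjunct2[OF comp[unfolded compact_Hardy_Hinf_def]]] this]
  obtain r g where r: "strict_mono (r :: nat \<Rightarrow> nat)" "g \<in> Hinf" "(\<lambda>n. Hinf_norm (\<lambda>z. ?T (G (r n)) z - g z)) \<longlonglongrightarrow> 0"
    by blast
  obtain B where B: "Hinf_norm g = ennreal B" "B \<ge> 0" using r(2) by (cases "Hinf_norm g") (auto simp: Hinf_def)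
  have "eventually (\<lambda>n. Hinf_norm (\<lambda>z. ?T (G (r n)) z - g z) < 1) sequentially"
    using r(3) by (rule order_tendstoD) simp
  moreover have "eventually (\<lambda>n. real n > 1 + B) sequentially"
    using eventually_gt_at_top[of "nat \<lceil>1 + B\<rceil>"] by eventually_elim linarith
  ultimately have "eventually (\<lambda>n. Hinf_norm (\<lambda>z. ?T (G (r n)) z - g z) < 1 \<and> real n > 1 + B) sequentially"
    by (rule eventually_conj)
  then obtain n where n: "Hinf_norm (\<lambda>z. ?T (G (r n)) z - g z) < 1" "real n > 1 + B"
    using eventually_happens'[OF sequentially_bot] by blast
  have "Hinf_norm (?T (G (r n))) \<le> ennreal (1 + B)"
    unfolding Hinf_norm_def[of "?T (G (r n))"]
  proof (rule SUP_least)
    fix z :: complex assume z: "z \<in> ball 0 1"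
    have "norm (?T (G (r n)) z) \<le> norm (?T (G (r n)) z - g z) + norm (g z)"
      using norm_triangle_ineq[of "?T (G (r n)) z - g z" "g z"] by simp
    hence "ennreal (norm (?T (G (r n)) z)) \<le> ennreal (norm (?T (G (r n)) z - g z) + norm (g z))"
      by (rule ennreal_leI)
    also have "\<dots> = ennreal (norm (?T (G (r n)) z - g z)) + ennreal (norm (g z))"
      by (rule ennreal_plus) auto
    also have "\<dots> \<le> Hinf_norm (\<lambda>z. ?T (G (r n)) z - g z) + Hinf_norm g"
      unfolding Hinf_norm_def by (intro add_mono SUP_upper2[OF z] order_refl)
    also have "\<dots> \<le> 1 + ennreal B" using n(1) B by (intro add_mono) auto
    also have "\<dots> = ennreal (1 + B)" using B(2) by (subst ennreal_plus) auto
    finally show "ennreal (norm (?T (G (r n)) z)) \<le> ennreal (1 + B)" .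
  qed
  with G(3)[of "r n"] have "ennreal (real (r n)) \<le> ennreal (1 + B)" by (rule order.trans)
  hence "real (r n) \<le> 1 + B" using B by (subst (asm) ennreal_le_iff) auto
  moreover have "n \<le> r n" using r(1) by (rule seq_suble)
  ultimately show False using n(2) by linarith
qed

text \<open>This is the inequality for weighted sums of values with a single weight, at index
  \<open>J\<close>, and with the exponents exchanged. Writing \<open>w = a_J z\<close> makes the
  constant depend on \<open>J\<close> but not on \<open>f\<close> or \<open>w\<close>.\<close>

lemma Hardy_point_bound:
  assumes p: "p > 1" "1 / p + 1 / q = (1::real)"
  shows "\<exists>B\<ge>0. \<forall>f w. f holomorphic_on ball 0 1 \<longrightarrow> norm w < dyadic_pt J \<longrightarrow> ennreal (norm (f w)) \<le> ennreal B * Hardy_norm p f"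
proof -
  have p': "q > 1" "1 / q + 1 / p = 1" using conjugate_exponent_gt_1[OF p] p by auto
  obtain C where C: "C > 0" "\<And>x J. (\<And>j. x j \<ge> 0) \<Longrightarrow> circle_Lq_norm q (dyadic_kernel 1 (test_weight p J x)) \<le>
    ennreal C * ennreal ((\<Sum>j\<le>J. x j powr q) powr (1 / q))"
    using circle_norm_test_weight_le[OF p'] by blast
  define x where "x j = (if j = J then 1 else 0 :: real)" for j
  define a where "a = 2 powr (- real J / p)"
  have a: "a > 0" by (simp add: a_def)
  have x: "x j \<ge> 0" for j by (simp add: x_def)
  have sx: "(\<Sum>j\<le>J. x j powr q) = 1" by (simp add: x_def if_distrib[of "\<lambda>y. y powr q"] cong: if_cong)
  have "ennreal (norm (f w)) \<le> ennreal (C / a) * Hardy_norm p f"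
    if f: "f holomorphic_on ball 0 1" and w: "norm w < dyadic_pt J" for f w
  proof -
    define z where "z = w / of_real (dyadic_pt J)"
    have d: "dyadic_pt J > 0" using w norm_ge_zero[of w] by linarith
    have z: "z \<in> ball 0 1" using w d by (simp add: z_def norm_divide)
    have wz: "of_real (dyadic_pt J) * z = w" using d by (simp add: z_def)
    have "ennreal a * ennreal (norm (f w)) = (\<Sum>j\<in>{J}. ennreal (test_weight p J x j) * ennreal (norm (f (of_real (dyadic_pt j) * z))))"
      by (simp add: test_weight_def x_def a_def wz)
    also have "\<dots> \<le> (\<Sum>j\<le>J. ennreal (test_weight p J x j) * ennreal (norm (f (of_real (dyadic_pt j) * z))))"
      by (intro sum_mono2) auto
    also have "\<dots> \<le> Hardy_norm p f * circle_Lq_norm q (dyadic_kernel 1 (test_weight p J x))"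
      by (intro sum_test_weight_norm_le p' f z x)
    also have "\<dots> \<le> Hardy_norm p f * (ennreal C * ennreal ((\<Sum>j\<le>J. x j powr q) powr (1 / q)))"
      by (intro mult_left_mono C(2) x) auto
    finally have "ennreal a * ennreal (norm (f w)) \<le> ennreal C * Hardy_norm p f" by (simp add: sx mult.commute)
    hence "ennreal (1 / a) * (ennreal a * ennreal (norm (f w))) \<le> ennreal (1 / a) * (ennreal C * Hardy_norm p f)"
      by (rule mult_left_mono) auto
    thus ?thesis using a C(1) by (simp flip: mult.assoc ennreal_mult)
  qed
  thus ?thesis using a C(1) by (intro exI[of _ "C / a"]) auto
qed

text \<open>Fatou's lemma on each circle. The measurability of the limit function on the circle
  comes from its being a pointwise limit.\<close>

lemma Hardy_norm_limit_le:
  assumes p: "p > 0" and F: "\<And>n. F n holomorphic_on ball 0 1" "\<And>n. Hardy_norm p (F n) \<le> M"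
    and lim: "\<And>z. z \<in> ball 0 1 \<Longrightarrow> (\<lambda>n. F n z) \<longlonglongrightarrow> f z"
  shows "Hardy_norm p f \<le> M"
  unfolding Hardy_norm_def
proof (rule SUP_least)
  fix \<rho> :: real assume \<rho>: "\<rho> \<in> {0..<1}"
  let ?z = "complex_of_real \<rho>"
  have z: "?z \<in> ball 0 1" using \<rho> by simp
  let ?c = "ennreal (1 / (2 * pi))"
  let ?u = "\<lambda>n \<theta>. ?c * (enn_powr (ennreal (norm (F n (?z * cis \<theta>)))) p * indicator {0..2*pi} \<theta>)"
  let ?v = "\<lambda>\<theta>. ?c * (enn_powr (ennreal (norm (f (?z * cis \<theta>)))) p * indicator {0..2*pi} \<theta>)"
  note measurable_circle_norm[OF F(1) z, measurable]
  have "?v \<theta> = liminf (\<lambda>n. ?u n \<theta>)" for \<theta>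
  proof (rule lim_imp_Liminf[symmetric])
    have "(\<lambda>n. F n (?z * cis \<theta>)) \<longlonglongrightarrow> f (?z * cis \<theta>)" by (rule lim) (use z in \<open>simp add: norm_mult\<close>)
    hence "(\<lambda>n. norm (F n (?z * cis \<theta>)) powr p) \<longlonglongrightarrow> norm (f (?z * cis \<theta>)) powr p"
      using p by (intro tendsto_powr' tendsto_norm tendsto_const) auto
    hence "(\<lambda>n. ennreal (norm (F n (?z * cis \<theta>)) powr p)) \<longlonglongrightarrow> ennreal (norm (f (?z * cis \<theta>)) powr p)"
      by (rule tendsto_ennrealI)
    hence "(\<lambda>n. (?c * indicator {0..2*pi} \<theta>) * ennreal (norm (F n (?z * cis \<theta>)) powr p)) \<longlonglongrightarrow>
      (?c * indicator {0..2*pi} \<theta>) * ennreal (norm (f (?z * cis \<theta>)) powr p)"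
      by (intro tendsto_mult_ennreal tendsto_const) (auto simp: indicator_def)
    thus "(\<lambda>n. ?u n \<theta>) \<longlonglongrightarrow> ?v \<theta>" by (simp add: enn_powr_ennreal mult_ac)
  qed simp
  hence "(\<integral>\<^sup>+\<theta>. ?v \<theta> \<partial>lborel) = (\<integral>\<^sup>+\<theta>. liminf (\<lambda>n. ?u n \<theta>) \<partial>lborel)" by simp
  also have "\<dots> \<le> liminf (\<lambda>n. \<integral>\<^sup>+\<theta>. ?u n \<theta> \<partial>lborel)" by (rule nn_integral_liminf) measurable
  also have "\<dots> \<le> enn_powr M p"
  proof (rule Liminf_le)
    have "(\<integral>\<^sup>+\<theta>. ?u n \<theta> \<partial>lborel) \<le> enn_powr M p" for n
    proof -
      have "circle_Lq_norm p (\<lambda>\<zeta>. ennreal (norm (F n (?z * \<zeta>)))) \<le> M"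
        using circle_Lq_norm_le_Hardy_norm[OF F(1) z] F(2) by (rule order.trans)
      hence "?c * (\<integral>\<^sup>+\<theta>\<in>{0..2*pi}. enn_powr (ennreal (norm (F n (?z * cis \<theta>)))) p \<partial>lborel) \<le> enn_powr M p"
        using p enn_powr_le_iff[of "1 / p"] by (simp add: circle_Lq_norm_def)
      thus ?thesis by (subst nn_integral_cmult) auto
    qed
    thus "eventually (\<lambda>n. (\<integral>\<^sup>+\<theta>. ?u n \<theta> \<partial>lborel) \<le> enn_powr M p) sequentially" by simp
  qed simp
  finally have *: "(\<integral>\<^sup>+\<theta>. ?v \<theta> \<partial>lborel) \<le> enn_powr M p" .
  have "(\<lambda>\<theta>. ennreal (norm (f (?z * cis \<theta>)))) \<in> borel_measurable borel"
  proof (rule measurable_compose[OF _ measurable_ennreal], rule borel_measurable_LIMSEQ_metric)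
    show "(\<lambda>n. norm (F n (?z * cis \<theta>))) \<longlonglongrightarrow> norm (f (?z * cis \<theta>))" for \<theta>
      by (intro tendsto_norm lim) (use z in \<open>simp add: norm_mult\<close>)
    show "(\<lambda>\<theta>. norm (F n (?z * cis \<theta>))) \<in> borel_measurable borel" for n
    proof -
      have "(\<lambda>\<theta>. enn2real (ennreal (norm (F n (?z * cis \<theta>))))) \<in> borel_measurable borel" by measurable
      thus ?thesis by simp
    qed
  qed
  hence "?c * (\<integral>\<^sup>+\<theta>\<in>{0..2*pi}. enn_powr (ennreal (norm (f (?z * cis \<theta>)))) p \<partial>lborel) \<le> enn_powr M p"
    using * by (subst (asm) nn_integral_cmult) auto
  thus "circle_Lq_norm p (\<lambda>\<zeta>. ennreal (norm (f (?z * \<zeta>)))) \<le> M"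
    using p enn_powr_le_iff[of "1 / p"] by (simp add: circle_Lq_norm_def)
qed

section \<open>Splitting the measure near the point 1\<close>

lemma tendsto_zero_ennrealI:
  fixes x :: "nat \<Rightarrow> ennreal"
  assumes "\<And>e::real. e > 0 \<Longrightarrow> eventually (\<lambda>n. x n \<le> ennreal e) sequentially"
  shows "x \<longlonglongrightarrow> 0"
proof (rule order_tendstoI)
  fix a :: ennreal assume "0 < a"
  then obtain b where b: "0 < b" "b < a" using dense by blast
  then obtain e where e: "b = ennreal e" "e > 0" by (cases b) (auto simp: top_unique)
  show "eventually (\<lambda>n. x n < a) sequentially"
    using assms[OF e(2)] by eventually_elim (use b e in auto)
qed simp

text \<open>Encoded as a density, so that the underlying space stays \<open>[0,1)\<close> and all
  estimates for \<open>finite_borel_measure_01\<close> apply to it.\<close>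

definition tail_measure :: "real measure \<Rightarrow> nat \<Rightarrow> real measure" where
  "tail_measure \<mu> J = density \<mu> (indicator {dyadic_pt J..<1})"

lemma
  assumes \<mu>: "finite_borel_measure_01 \<mu>"
  shows finite_borel_measure_01_tail_measure: "finite_borel_measure_01 (tail_measure \<mu> J)"
    and dyadic_mass_tail_measure: "dyadic_mass (tail_measure \<mu> J) j = (if J \<le> j then dyadic_mass \<mu> j else 0)"
    and nn_integral_tail_measure: "f \<in> borel_measurable \<mu> \<Longrightarrow>
      (\<integral>\<^sup>+t. f t \<partial>tail_measure \<mu> J) = (\<integral>\<^sup>+t. indicator {dyadic_pt J..<1} t * f t \<partial>\<mu>)"
proof -
  interpret finite_measure \<mu> by (rule finite_borel_measure_01D(1)[OF \<mu>])
  have B [measurable]: "{dyadic_pt J..<1} \<in> sets \<mu>" by (intro interval_in_sets \<mu> dyadic_pt_nonneg) simp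
  have em: "emeasure (tail_measure \<mu> J) A = emeasure \<mu> ({dyadic_pt J..<1} \<inter> A)" if "A \<in> sets \<mu>" for A
    unfolding tail_measure_def by (rule emeasure_restricted[OF B that])
  have sp: "space (tail_measure \<mu> J) = space \<mu>" by (simp add: tail_measure_def)
  have "finite_measure (tail_measure \<mu> J)"
    by (rule finite_measureI) (simp add: sp em emeasure_eq_measure)
  thus "finite_borel_measure_01 (tail_measure \<mu> J)"
    using \<mu> by (simp add: finite_borel_measure_01_def tail_measure_def)
  have A: "{dyadic_pt j..<dyadic_pt (Suc j)} \<in> sets \<mu>"
    by (intro interval_in_sets \<mu> dyadic_pt_nonneg less_imp_le[OF dyadic_pt_less_1])
  show "dyadic_mass (tail_measure \<mu> J) j = (if J \<le> j then dyadic_mass \<mu> j else 0)"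
  proof (cases "J \<le> j")
    case True
    have "{dyadic_pt J..<1} \<inter> {dyadic_pt j..<dyadic_pt (Suc j)} = {dyadic_pt j..<dyadic_pt (Suc j)}"
      using dyadic_pt_mono[OF True] dyadic_pt_less_1[of "Suc j"] by auto
    thus ?thesis using True by (simp add: dyadic_mass_def measure_def em[OF A])
  next
    case False
    have "dyadic_pt (Suc j) \<le> dyadic_pt J" using False by (intro dyadic_pt_mono) simp
    hence "{dyadic_pt J..<1} \<inter> {dyadic_pt j..<dyadic_pt (Suc j)} = {}" by auto
    thus ?thesis using False unfolding dyadic_mass_def measure_def em[OF A] by (simp only: emeasure_empty) simp
  qed
  show "(\<integral>\<^sup>+t. f t \<partial>tail_measure \<mu> J) = (\<integral>\<^sup>+t. indicator {dyadic_pt J..<1} t * f t \<partial>\<mu>)"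
    if "f \<in> borel_measurable \<mu>"
    unfolding tail_measure_def by (rule nn_integral_density[OF _ that]) measurable
qed

text \<open>The bound by block masses is essential: for the restricted measure it becomes the
  remainder of a convergent series. The sequence of tail masses would keep its terms of index below
  \<open>J\<close>.\<close>

lemma circle_Lq_norm_P_fun_tail_small:
  assumes p: "p > 1" "1 / p + 1 / q = (1::real)" and \<alpha>: "\<alpha> > 1 / q" and \<mu>: "finite_borel_measure_01 \<mu>"
    and fin: "seq_lq_norm q (dyadic_seq \<mu> (\<alpha> - 1 / q)) < \<infinity>" and e: "e > 0"
  shows "\<exists>J. circle_Lq_norm q (P_fun (tail_measure \<mu> J) \<alpha>) \<le> ennreal e"
proof -
  have q: "q > 1" by (rule conjugate_exponent_gt_1[OF p])
  obtain C where C: "C > 0" "\<And>\<mu>. finite_borel_measure_01 \<mu> \<Longrightarrow> circle_Lq_norm q (P_fun \<mu> \<alpha>) \<le>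
    ennreal C * seq_lq_norm q (\<lambda>j. 2 powr (real j * (\<alpha> - 1 / q)) * dyadic_mass \<mu> j)"
    using circle_Lq_norm_P_fun_le[OF p \<alpha>] by blast
  define y where "y j = \<bar>2 powr (real j * (\<alpha> - 1 / q)) * dyadic_mass \<mu> j\<bar> powr q" for j
  have y: "y j \<ge> 0" for j by (simp add: y_def)
  have "seq_lq_norm q (\<lambda>j. 2 powr (real j * (\<alpha> - 1 / q)) * dyadic_mass \<mu> j) < \<infinity>"
    using seq_lq_norm_dyadic_mass_le[OF \<mu>, of q "\<alpha> - 1 / q"] q fin by (auto intro: le_less_trans)
  hence "(\<Sum>j. ennreal (y j)) < \<infinity>"
    unfolding seq_lq_norm_def y_def enn_powr_less_top_iff .
  hence sy: "summable y" by (intro summable_suminf_not_top y) auto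
  have "(e / C) powr q > 0" using e C(1) by simp
  from suminf_exist_split[OF this sy] obtain J where J: "norm (\<Sum>i. y (i + J)) < (e / C) powr q" by blast
  have "(\<Sum>j. ennreal (\<bar>2 powr (real j * (\<alpha> - 1 / q)) * dyadic_mass (tail_measure \<mu> J) j\<bar> powr q)) =
      (\<Sum>j. ennreal (if J \<le> j then y j else 0))"
    using q by (intro suminf_cong arg_cong[where f = ennreal]) (simp add: dyadic_mass_tail_measure[OF \<mu>] y_def)
  also have "\<dots> = (\<Sum>i. ennreal (y (i + J)))"
    by (subst suminf_offset[where i = J]) (auto intro!: sum.neutral)
  also have "\<dots> = ennreal (\<Sum>i. y (i + J))"
    using sy y by (intro suminf_ennreal2) (auto simp: summable_iff_shift)
  also have "\<dots> \<le> ennreal ((e / C) powr q)" using J by (intro ennreal_leI) simp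
  finally have "seq_lq_norm q (\<lambda>j. 2 powr (real j * (\<alpha> - 1 / q)) * dyadic_mass (tail_measure \<mu> J) j) \<le>
      enn_powr (ennreal ((e / C) powr q)) (1 / q)"
    unfolding seq_lq_norm_def using q by (intro enn_powr_mono) auto
  also have "\<dots> = ennreal (e / C)" using q e C(1) by (simp add: enn_powr_ennreal powr_powr)
  finally have "ennreal C * seq_lq_norm q (\<lambda>j. 2 powr (real j * (\<alpha> - 1 / q)) * dyadic_mass (tail_measure \<mu> J) j) \<le> ennreal C * ennreal (e / C)"
    by (rule mult_left_mono) simp
  also have "\<dots> = ennreal e" using C(1) e by (simp flip: ennreal_mult)
  finally show ?thesis
    using C(2)[OF finite_borel_measure_01_tail_measure[OF \<mu>, of J]] by (intro exI[of _ J]) (rule order.trans)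
qed

lemma measurable_radial:
  assumes \<mu>: "finite_borel_measure_01 \<mu>" and f: "f holomorphic_on ball 0 1" and z: "z \<in> ball 0 1"
  shows "(\<lambda>t. ennreal (norm (f (of_real t * z)) / (1 - t) powr \<gamma>)) \<in> borel_measurable \<mu>"
proof -
  note finite_borel_measure_01D(4)[OF \<mu>, measurable]
  have "continuous_on {0..<1} (\<lambda>t. norm (f (of_real t * z)))"
  proof (intro continuous_on_norm continuous_on_compose2[OF holomorphic_on_imp_continuous_on[OF f]] continuous_intros)
    show "(\<lambda>t. of_real t * z) ` {0..<1} \<subseteq> ball 0 1"
      using z by (auto simp: norm_mult intro!: order.strict_trans1[OF mult_left_le_one_le])
  qed
  hence "(\<lambda>t. norm (f (of_real t * z))) \<in> borel_measurable (restrict_space borel {0..<1})"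
    by (rule borel_measurable_continuous_on_restrict)
  hence [measurable]: "(\<lambda>t. norm (f (of_real t * z))) \<in> borel_measurable \<mu>"
    using measurable_cong_sets[OF finite_borel_measure_01D(2)[OF \<mu>] refl] by blast
  show ?thesis by measurable
qed

text \<open>For \<open>t < a_J\<close> the argument \<open>t z\<close> stays in the disc where
  \<open>f\<close> is small, and the weight \<open>(1 - t)^(-\<gamma>)\<close> is at most
  \<open>2^(J \<gamma>)\<close>.\<close>

lemma nn_integral_head_le:
  assumes \<mu>: "finite_borel_measure_01 \<mu>" and f: "f holomorphic_on ball 0 1" and z: "z \<in> ball 0 1"
    and \<gamma>: "\<gamma> \<ge> 0" and \<delta>: "\<delta> \<ge> 0" and le: "\<And>w. norm w \<le> dyadic_pt J \<Longrightarrow> norm (f w) \<le> \<delta>"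
  shows "(\<integral>\<^sup>+t. ennreal (norm (f (of_real t * z)) / (1 - t) powr \<gamma>) \<partial>\<mu>) \<le>
    ennreal (\<delta> * 2 powr (real J * \<gamma>) * measure \<mu> {0..<1}) +
    (\<integral>\<^sup>+t. ennreal (norm (f (of_real t * z)) / (1 - t) powr \<gamma>) \<partial>tail_measure \<mu> J)"
proof -
  interpret finite_measure \<mu> by (rule finite_borel_measure_01D(1)[OF \<mu>])
  let ?h = "\<lambda>t. ennreal (norm (f (of_real t * z)) / (1 - t) powr \<gamma>)"
  note measurable_radial[OF \<mu> f z, measurable]
  have B [measurable]: "{dyadic_pt J..<1} \<in> sets \<mu>" by (intro interval_in_sets \<mu> dyadic_pt_nonneg) simp
  have "(\<integral>\<^sup>+t. ?h t \<partial>\<mu>) \<le> (\<integral>\<^sup>+t. ennreal (\<delta> * 2 powr (real J * \<gamma>)) + indicator {dyadic_pt J..<1} t * ?h t \<partial>\<mu>)"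
  proof (rule nn_integral_mono)
    fix t assume "t \<in> space \<mu>"
    hence t: "0 \<le> t" "t < 1" by (auto simp: finite_borel_measure_01D(3)[OF \<mu>])
    show "?h t \<le> ennreal (\<delta> * 2 powr (real J * \<gamma>)) + indicator {dyadic_pt J..<1} t * ?h t"
    proof (cases "dyadic_pt J \<le> t")
      case True
      thus ?thesis using t by simp
    next
      case False
      have "norm (complex_of_real t * z) \<le> t" using t z mult_left_le[of "norm z" t] by (simp add: norm_mult)
      hence 1: "norm (f (of_real t * z)) \<le> \<delta>" using False by (intro le) simp
      have "2 powr (- real J) \<le> 1 - t" using False by (simp add: dyadic_pt_def)
      hence "(2 powr (- real J)) powr \<gamma> \<le> (1 - t) powr \<gamma>" using \<gamma> by (intro powr_mono2) auto
      hence "norm (f (of_real t * z)) / (1 - t) powr \<gamma> \<le> \<delta> / (2 powr (- real J)) powr \<gamma>"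
        using 1 \<delta> by (intro frac_le) auto
      also have "\<dots> = \<delta> * 2 powr (real J * \<gamma>)" by (simp only: powr_powr divide_powr_uminus) simp
      finally show ?thesis using False by (simp add: ennreal_leI)
    qed
  qed
  also have "\<dots> = (\<integral>\<^sup>+t. ennreal (\<delta> * 2 powr (real J * \<gamma>)) \<partial>\<mu>) + (\<integral>\<^sup>+t. indicator {dyadic_pt J..<1} t * ?h t \<partial>\<mu>)"
    by (rule nn_integral_add) measurable
  also have "(\<integral>\<^sup>+t. ennreal (\<delta> * 2 powr (real J * \<gamma>)) \<partial>\<mu>) = ennreal (\<delta> * 2 powr (real J * \<gamma>) * measure \<mu> {0..<1})"
    using \<delta> by (simp add: emeasure_eq_measure finite_borel_measure_01D(3)[OF \<mu>] ennreal_mult)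
  also have "(\<integral>\<^sup>+t. indicator {dyadic_pt J..<1} t * ?h t \<partial>\<mu>) = (\<integral>\<^sup>+t. ?h t \<partial>tail_measure \<mu> J)"
    by (rule nn_integral_tail_measure[OF \<mu> measurable_radial[OF \<mu> f z], symmetric])
  finally show ?thesis .
qed

text \<open>By Montel's theorem a subsequence converges locally uniformly; the part of \<open>\<mu>\<close> near \<open>1\<close>
  contributes uniformly little, because its kernel \<^const>\<open>P_fun\<close> is small in \<open>L\<^sup>q\<close>.\<close>

lemma compact_Cesaro:
  assumes p: "p > 1" "1 / p + 1 / q = (1::real)" and \<mu>: "finite_borel_measure_01 \<mu>" and \<gamma>: "\<gamma> > 0"
    and s: "s = \<gamma> + 1 - 1 / q" and fin: "seq_lq_norm q (dyadic_seq \<mu> s) < \<infinity>"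
    and T: "\<And>f. f \<in> Hardy p \<Longrightarrow> Cesaro_op \<mu> \<gamma> f \<in> Hinf"
  shows "compact_Hardy_Hinf p (Cesaro_op \<mu> \<gamma>)"
proof -
  have q: "q > 1" by (rule conjugate_exponent_gt_1[OF p])
  have \<alpha>: "\<gamma> + 1 > 1 / q" using \<gamma> q by (smt (verit) divide_less_eq_1)
  let ?T = "Cesaro_op \<mu> \<gamma>"
  have "\<exists>r g. strict_mono (r :: nat \<Rightarrow> nat) \<and> g \<in> Hinf \<and> (\<lambda>n. Hinf_norm (\<lambda>z. ?T (F (r n)) z - g z)) \<longlonglongrightarrow> 0"
    if F: "\<And>n. F n \<in> Hardy p" and bd: "\<And>n. Hardy_norm p (F n) \<le> ennreal M0" for F M0
  proof -
    \<comment> \<open>The given bound may be negative, in which case \<open>ennreal M0 = 0\<close>;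
      the maximum makes real arithmetic with \<open>M\<close> safe.\<close>
    define M where "M = max M0 0"
    have M: "M \<ge> 0" "\<And>n. Hardy_norm p (F n) \<le> ennreal M"
      using bd by (auto simp: M_def max_def ennreal_neg split: if_splits)
    have Fhol: "F n holomorphic_on ball 0 1" for n using F by (simp add: Hardy_def)
    define \<H> where "\<H> = {h. h holomorphic_on ball 0 1 \<and> Hardy_norm p h \<le> ennreal M}"
    have Hb: "\<exists>B. \<forall>h\<in>\<H>. \<forall>z\<in>K. norm (h z) \<le> B" if K: "compact K" "K \<subseteq> ball 0 1" for K
    proof -
      obtain r where r: "0 \<le> r" "r < 1" "\<And>w. w \<in> K \<Longrightarrow> norm w \<le> r"
      proof (cases "K = {}")
        case False
        have "continuous_on K (norm :: complex \<Rightarrow> real)" by (intro continuous_intros)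
        from continuous_attains_sup[OF K(1) False this] obtain w where "w \<in> K" "\<forall>v\<in>K. norm v \<le> norm w" by blast
        thus ?thesis using K(2) that[of "norm w"] by auto
      qed (use that[of 0] in auto)
      obtain J where J: "r < dyadic_pt (Suc J)" using ex_dyadic_interval[OF r(1,2)] by blast
      obtain B where B: "B \<ge> 0" "\<And>f w. f holomorphic_on ball 0 1 \<Longrightarrow> norm w < dyadic_pt (Suc J) \<Longrightarrow>
          ennreal (norm (f w)) \<le> ennreal B * Hardy_norm p f"
        using Hardy_point_bound[OF p, of "Suc J"] by blast
      have "norm (h z) \<le> B * M" if h: "h \<in> \<H>" "z \<in> K" for h z
      proof -
        have "ennreal (norm (h z)) \<le> ennreal B * Hardy_norm p h"
          using h r(3)[of z] J by (intro B) (auto simp: \<H>_def)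
        also have "\<dots> \<le> ennreal B * ennreal M" using h by (intro mult_left_mono) (auto simp: \<H>_def)
        finally show ?thesis using B(1) M(1) by (simp flip: ennreal_mult)
      qed
      thus ?thesis by blast
    qed
    obtain f r where f: "f holomorphic_on ball 0 1" "strict_mono (r :: nat \<Rightarrow> nat)"
      "\<And>x. x \<in> ball 0 1 \<Longrightarrow> (\<lambda>n. F (r n) x) \<longlonglongrightarrow> f x"
      "\<And>K. compact K \<Longrightarrow> K \<subseteq> ball 0 1 \<Longrightarrow> uniform_limit K (F \<circ> r) f sequentially"
    proof (rule Montel[of "ball 0 1" \<H> F])
      show "range F \<subseteq> \<H>" using Fhol M(2) by (auto simp: \<H>_def)
      show "h holomorphic_on ball 0 1" if "h \<in> \<H>" for h using that by (simp add: \<H>_def)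
    qed (use Hb that in auto)
    have fM: "Hardy_norm p f \<le> ennreal M"
      by (rule Hardy_norm_limit_le[where F = "\<lambda>n. F (r n)", OF _ Fhol M(2) f(3)]) (use p in auto)
    have fH: "f \<in> Hardy p" using f(1) le_less_trans[OF fM ennreal_less_top] by (simp add: Hardy_def)
    have "(\<lambda>n. Hinf_norm (\<lambda>z. ?T (F (r n)) z - ?T f z)) \<longlonglongrightarrow> 0"
    proof (rule tendsto_zero_ennrealI)
      fix e :: real assume e: "e > 0"
      \<comment> \<open>Two tail contributions of size \<open>2^\<gamma> M e1\<close> must together
        stay below \<open>e/2\<close>; the \<open>+ 1\<close> avoids division by zero when
        \<open>M = 0\<close>.\<close>
      define e1 where "e1 = e / (2 * (2 powr \<gamma> * (2 * M + 1)))"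
      have e1: "e1 > 0" using e M(1) by (simp add: e1_def)
      obtain J where J: "circle_Lq_norm q (P_fun (tail_measure \<mu> J) (\<gamma> + 1)) \<le> ennreal e1"
        using circle_Lq_norm_P_fun_tail_small[OF p \<alpha> \<mu> _ e1] fin s by auto
      \<comment> \<open>\<open>J\<close> is fixed before any index \<open>n\<close>, so the head
        tolerance \<open>\<delta>\<close> may depend on it. The \<open>+ 1\<close> keeps
        \<open>D\<close> positive for the zero measure, and \<open>\<delta> D = e/2\<close>.\<close>
      define D where "D = 2 powr (real J * \<gamma>) * measure \<mu> {0..<1} + 1"
      have D: "D > 0" unfolding D_def by (intro add_nonneg_pos) auto
      define \<delta> where "\<delta> = e / (2 * D)"
      have \<delta>: "\<delta> > 0" using e D by (simp add: \<delta>_def)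
      have dJ: "dyadic_pt J < 1" by (rule dyadic_pt_less_1)
      have "uniform_limit (cball 0 (dyadic_pt J)) (F \<circ> r) f sequentially"
        by (rule f(4)) (use dJ in auto)
      from uniform_limitD[OF this \<delta>]
      show "eventually (\<lambda>n. Hinf_norm (\<lambda>z. ?T (F (r n)) z - ?T f z) \<le> ennreal e) sequentially"
      proof eventually_elim
        case (elim n)
        let ?h = "\<lambda>w. F (r n) w - f w"
        have hhol: "?h holomorphic_on ball 0 1" by (intro holomorphic_intros Fhol f(1))
        show ?case unfolding Hinf_norm_def
        proof (rule SUP_least)
          fix z :: complex assume z: "z \<in> ball 0 1"
          note \<nu> = finite_borel_measure_01_tail_measure[OF \<mu>, of J]
          let ?k = "\<lambda>f t. ennreal (norm (f (complex_of_real t * z)) / (1 - t) powr \<gamma>)"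
          \<comment> \<open>This is applied to \<open>F (r n)\<close> and to \<open>f\<close>
            separately: each has Hardy norm at most \<open>M\<close>, and the difference is split
            pointwise under the integral.\<close>
          have tail: "(\<integral>\<^sup>+t. ?k g t \<partial>tail_measure \<mu> J) \<le> ennreal (2 powr \<gamma> * (M * e1))"
            if g: "g holomorphic_on ball 0 1" "Hardy_norm p g \<le> ennreal M" for g
          proof -
            have "(\<integral>\<^sup>+t. ?k g t \<partial>tail_measure \<mu> J) \<le> ennreal (2 powr \<gamma>) *
              (Hardy_norm p g * circle_Lq_norm q (P_fun (tail_measure \<mu> J) (\<gamma> + 1)))"
              using \<gamma> by (intro nn_integral_weighted_le p \<nu> g z) auto
            also have "\<dots> \<le> ennreal (2 powr \<gamma>) * (ennreal M * ennreal e1)"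
              by (intro mult_left_mono mult_mono g J) auto
            finally show ?thesis using M(1) e1 by (simp add: ennreal_mult)
          qed
          have "?T (F (r n)) z - ?T f z = ?T ?h z"
            by (rule Cesaro_op_diff[OF \<mu> \<gamma> Fhol f(1) z, symmetric])
          also have "ennreal (norm (?T ?h z)) \<le> (\<integral>\<^sup>+t. ?k ?h t \<partial>\<mu>)"
            unfolding Cesaro_op_eq_integral[OF \<mu> \<gamma> hhol z] using \<gamma> by (intro norm_integral_Cesaro_le \<mu> z) auto
          also have "\<dots> \<le> ennreal (\<delta> * 2 powr (real J * \<gamma>) * measure \<mu> {0..<1}) + (\<integral>\<^sup>+t. ?k ?h t \<partial>tail_measure \<mu> J)"
          proof (rule nn_integral_head_le[OF \<mu> hhol z])
            fix w :: complex assume "norm w \<le> dyadic_pt J"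
            thus "norm (?h w) \<le> \<delta>" using elim by (auto simp: dist_norm less_imp_le)
          qed (use \<gamma> \<delta> in auto)
          also have "(\<integral>\<^sup>+t. ?k ?h t \<partial>tail_measure \<mu> J) \<le> (\<integral>\<^sup>+t. ?k (F (r n)) t + ?k f t \<partial>tail_measure \<mu> J)"
          proof (rule nn_integral_mono)
            fix t
            have "norm (?h (of_real t * z)) / (1 - t) powr \<gamma> \<le>
                norm (F (r n) (of_real t * z)) / (1 - t) powr \<gamma> + norm (f (of_real t * z)) / (1 - t) powr \<gamma>"
              unfolding add_divide_distrib[symmetric] by (intro divide_right_mono norm_triangle_ineq4) auto
            hence "?k ?h t \<le> ennreal (norm (F (r n) (of_real t * z)) / (1 - t) powr \<gamma> + norm (f (of_real t * z)) / (1 - t) powr \<gamma>)"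
              by (rule ennreal_leI)
            also have "\<dots> = ?k (F (r n)) t + ?k f t" by (rule ennreal_plus) auto
            finally show "?k ?h t \<le> ?k (F (r n)) t + ?k f t" .
          qed
          also have "\<dots> = (\<integral>\<^sup>+t. ?k (F (r n)) t \<partial>tail_measure \<mu> J) + (\<integral>\<^sup>+t. ?k f t \<partial>tail_measure \<mu> J)"
            by (intro nn_integral_add measurable_radial \<nu> Fhol f(1) z)
          also have "\<dots> \<le> ennreal (2 powr \<gamma> * (M * e1)) + ennreal (2 powr \<gamma> * (M * e1))"
            by (intro add_mono tail Fhol M(2) f(1) fM)
          also have "ennreal (\<delta> * 2 powr (real J * \<gamma>) * measure \<mu> {0..<1}) + (ennreal (2 powr \<gamma> * (M * e1)) + ennreal (2 powr \<gamma> * (M * e1))) =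
              ennreal (\<delta> * 2 powr (real J * \<gamma>) * measure \<mu> {0..<1} + (2 powr \<gamma> * (M * e1) + 2 powr \<gamma> * (M * e1)))"
          proof -
            have "ennreal a + (ennreal b + ennreal b) = ennreal (a + (b + b))" if "a \<ge> 0" "b \<ge> 0" for a b
              using that by (subst ennreal_plus, simp, simp, subst ennreal_plus) auto
            thus ?thesis using \<delta> M(1) e1 by (meson less_imp_le measure_nonneg mult_nonneg_nonneg powr_ge_zero)
          qed
          also have "\<dots> \<le> ennreal e"
          proof (rule ennreal_leI)
            have "\<delta> * 2 powr (real J * \<gamma>) * measure \<mu> {0..<1} \<le> \<delta> * D"
              using \<delta> by (simp add: D_def algebra_simps)
            also have "\<dots> = e / 2" using D by (simp add: \<delta>_def)
            finally have 1: "\<delta> * 2 powr (real J * \<gamma>) * measure \<mu> {0..<1} \<le> e / 2" .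
            have "2 powr \<gamma> * (M * e1) + 2 powr \<gamma> * (M * e1) \<le> e1 * (2 powr \<gamma> * (2 * M + 1))"
              using e1 by (simp add: algebra_simps)
            also have "\<dots> = e / 2" using M(1) by (simp add: e1_def)
            finally show "\<delta> * 2 powr (real J * \<gamma>) * measure \<mu> {0..<1} + (2 powr \<gamma> * (M * e1) + 2 powr \<gamma> * (M * e1)) \<le> e"
              using 1 by linarith
          qed
          finally show "ennreal (norm (?T (F (r n)) z - ?T f z)) \<le> ennreal e"
            by - (auto intro: add_left_mono)
        qed
      qed
    qed
    thus ?thesis using f(2) T[OF fH] by blast
  qed
  thus ?thesis unfolding compact_Hardy_Hinf_def using T by blast
qed

section \<open>Assembling the estimates\<close>

text \<open>The constant is chosen before the measure, so uniformity survives composition. Infinite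
  values are allowed, and domination therefore also transports finiteness.\<close>

definition dominated :: "(real measure \<Rightarrow> ennreal) \<Rightarrow> (real measure \<Rightarrow> ennreal) \<Rightarrow> bool" where
  "dominated X Y \<longleftrightarrow> (\<exists>C>0. \<forall>\<mu>. finite_borel_measure_01 \<mu> \<longrightarrow> X \<mu> \<le> ennreal C * Y \<mu>)"

lemma dominated_trans:
  assumes "dominated X Y" "dominated Y Z"
  shows "dominated X Z"
proof -
  obtain C D where C: "C > 0" "\<And>\<mu>. finite_borel_measure_01 \<mu> \<Longrightarrow> X \<mu> \<le> ennreal C * Y \<mu>"
    and D: "D > 0" "\<And>\<mu>. finite_borel_measure_01 \<mu> \<Longrightarrow> Y \<mu> \<le> ennreal D * Z \<mu>"
    using assms unfolding dominated_def by blast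
  have "X \<mu> \<le> ennreal (C * D) * Z \<mu>" if "finite_borel_measure_01 \<mu>" for \<mu>
  proof -
    have "X \<mu> \<le> ennreal C * Y \<mu>" by (rule C(2)[OF that])
    also have "\<dots> \<le> ennreal C * (ennreal D * Z \<mu>)" by (intro mult_left_mono D(2) that) simp
    finally show ?thesis using C(1) D(1) by (simp add: ennreal_mult mult.assoc)
  qed
  thus ?thesis using C(1) D(1) unfolding dominated_def by (intro exI[of _ "C * D"]) auto
qed

lemma dominated_finite:
  assumes "dominated X Y" "finite_borel_measure_01 \<mu>" "Y \<mu> < \<infinity>"
  shows "X \<mu> < \<infinity>"
proof -
  obtain C where C: "\<And>\<mu>. finite_borel_measure_01 \<mu> \<Longrightarrow> X \<mu> \<le> ennreal C * Y \<mu>"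
    using assms(1) unfolding dominated_def by blast
  have "ennreal C * Y \<mu> < \<infinity>" using assms(3) by (auto simp: ennreal_mult_less_top)
  thus ?thesis using C[OF assms(2)] by (rule le_less_trans[rotated])
qed

lemma dominated_imp_comparable:
  assumes "dominated X Y" "dominated Y X"
  shows "\<exists>K0>0. \<forall>K\<ge>K0. \<forall>\<mu>. finite_borel_measure_01 \<mu> \<longrightarrow> comparable K (X \<mu>) (Y \<mu>)"
proof -
  obtain C D where C: "C > 0" "\<And>\<mu>. finite_borel_measure_01 \<mu> \<Longrightarrow> X \<mu> \<le> ennreal C * Y \<mu>"
    and D: "D > 0" "\<And>\<mu>. finite_borel_measure_01 \<mu> \<Longrightarrow> Y \<mu> \<le> ennreal D * X \<mu>"
    using assms unfolding dominated_def by blast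
  have "comparable K (X \<mu>) (Y \<mu>)" if "K \<ge> max C D" and \<mu>: "finite_borel_measure_01 \<mu>" for K \<mu>
  proof -
    have "ennreal C * Y \<mu> \<le> ennreal K * Y \<mu>" "ennreal D * X \<mu> \<le> ennreal K * X \<mu>"
      using that by (auto intro!: mult_right_mono ennreal_leI)
    thus ?thesis using C(2)[OF \<mu>] D(2)[OF \<mu>] unfolding comparable_def by (blast intro: order.trans)
  qed
  thus ?thesis using C(1) by (intro exI[of _ "max C D"]) auto
qed

theorem theorem1p3:
  fixes p p' \<gamma> s :: real
  assumes "1 < p" and "1 / p + 1 / p' = 1" and "\<gamma> > 0" and "s = \<gamma> + 1 / p"
  shows "(\<forall>\<mu>. finite_borel_measure_01 \<mu> \<longrightarrow>
            (bounded_Hardy_Hinf p (Cesaro_op \<mu> \<gamma>) \<longleftrightarrow> compact_Hardy_Hinf p (Cesaro_op \<mu> \<gamma>)) \<and>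
            (bounded_Hardy_Hinf p (Cesaro_op \<mu> \<gamma>) \<longleftrightarrow> seq_lq_norm p' (dyadic_seq \<mu> s) < \<infinity>) \<and>
            (bounded_Hardy_Hinf p (Cesaro_op \<mu> \<gamma>) \<longleftrightarrow> tail_integral \<mu> \<gamma> p' < \<infinity>) \<and>
            (bounded_Hardy_Hinf p (Cesaro_op \<mu> \<gamma>) \<longleftrightarrow> F_fun \<mu> (\<gamma> + 1) \<in> Hardy p') \<and>
            (bounded_Hardy_Hinf p (Cesaro_op \<mu> \<gamma>) \<longleftrightarrow> moment_sum \<mu> \<gamma> p' < \<infinity>)) \<and>
         (\<exists>K>0. \<forall>\<mu>. finite_borel_measure_01 \<mu> \<longrightarrow>
            comparable K (Hardy_Hinf_opnorm p (Cesaro_op \<mu> \<gamma>)) (Hardy_norm p' (F_fun \<mu> (\<gamma> + 1))) \<and>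
            comparable K (Hardy_norm p' (F_fun \<mu> (\<gamma> + 1))) (circle_Lq_norm p' (P_fun \<mu> (\<gamma> + 1))) \<and>
            comparable K (circle_Lq_norm p' (P_fun \<mu> (\<gamma> + 1))) (seq_lq_norm p' (dyadic_seq \<mu> s)) \<and>
            comparable K (seq_lq_norm p' (dyadic_seq \<mu> s)) (enn_powr (moment_sum \<mu> \<gamma> p') (1 / p')) \<and>
            comparable K (enn_powr (moment_sum \<mu> \<gamma> p') (1 / p'))
              (enn_powr (ennreal (measure \<mu> {0..<1} powr p') + tail_integral \<mu> \<gamma> p') (1 / p')))"
proof -
  note p = assms(1,2) and \<gamma> = assms(3)
  have q: "p' > 1" by (rule conjugate_exponent_gt_1[OF p])
  have s: "s = \<gamma> + 1 - 1 / p'" using assms(2,4) by simp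
  have \<alpha>: "\<gamma> + 1 > 1 / p'" using \<gamma> q by (smt (verit) divide_less_eq_1)
  define Nop where "Nop \<mu> = Hardy_Hinf_opnorm p (Cesaro_op \<mu> \<gamma>)" for \<mu>
  define NF where "NF \<mu> = Hardy_norm p' (F_fun \<mu> (\<gamma> + 1))" for \<mu>
  define NP where "NP \<mu> = circle_Lq_norm p' (P_fun \<mu> (\<gamma> + 1))" for \<mu>
  define Nb where "Nb \<mu> = seq_lq_norm p' (dyadic_seq \<mu> s)" for \<mu>
  define Nm where "Nm \<mu> = enn_powr (moment_sum \<mu> \<gamma> p') (1 / p')" for \<mu>
  define Nt where "Nt \<mu> = enn_powr (ennreal (measure \<mu> {0..<1} powr p') + tail_integral \<mu> \<gamma> p') (1 / p')" for \<mu>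
  have "2 powr \<gamma> > (0::real)" "2 powr (\<gamma> + 1) > (0::real)" by simp_all
  hence op_P: "dominated Nop NP" and F_P: "dominated NF NP" and b_t: "dominated Nb Nt"
    using Hardy_Hinf_opnorm_Cesaro_le[OF p _ \<gamma>] Hardy_norm_F_fun_le[of _ "\<gamma> + 1" p'] \<gamma> q
      dyadic_seq_le_tail_integral[OF _ \<gamma> _ s]
    unfolding dominated_def Nop_def NF_def NP_def Nb_def Nt_def by (meson add_pos_pos less_trans zero_less_one)+
  have b_op: "dominated Nb Nop" unfolding dominated_def Nb_def Nop_def by (rule seq_lq_norm_le_opnorm[OF p \<gamma> s])
  have b_F: "dominated Nb NF" unfolding dominated_def Nb_def NF_def
    using \<gamma> s by (intro seq_lq_norm_le_Hardy_norm_F_fun[OF p]) auto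
  have m_P: "dominated Nm NP" unfolding dominated_def Nm_def NP_def using \<gamma> q by (intro moment_sum_le) auto
  have t_m: "dominated Nt Nm" unfolding dominated_def Nt_def Nm_def using \<gamma> q by (intro tail_integral_le) auto
  have P_b: "dominated NP Nb"
  proof -
    obtain C where C: "C > 0" "\<And>\<mu>. finite_borel_measure_01 \<mu> \<Longrightarrow> NP \<mu> \<le>
        ennreal C * seq_lq_norm p' (\<lambda>j. 2 powr (real j * (\<gamma> + 1 - 1 / p')) * dyadic_mass \<mu> j)"
      using circle_Lq_norm_P_fun_le[OF p \<alpha>] unfolding NP_def by blast
    have "NP \<mu> \<le> ennreal C * Nb \<mu>" if \<mu>: "finite_borel_measure_01 \<mu>" for \<mu>
      unfolding Nb_def s
      by (rule order.trans[OF C(2)[OF \<mu>]], rule mult_left_mono, rule seq_lq_norm_dyadic_mass_le[OF \<mu>]) (use q in auto)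
    thus ?thesis using C(1) unfolding dominated_def by blast
  qed
  \<comment> \<open>All quantities meet at \<open>Nb\<close>: the dominations close the cycle
    \<open>Nb\<close>, \<open>Nt\<close>, \<open>Nm\<close>, \<open>NP\<close>, \<open>Nb\<close>,
    while \<open>Nop\<close> and \<open>NF\<close> lie between \<open>Nb\<close> and
    \<open>NP\<close>.\<close>
  note op_b = dominated_trans[OF op_P P_b] and F_b = dominated_trans[OF F_P P_b]
    and m_b = dominated_trans[OF m_P P_b] and b_m = dominated_trans[OF b_t t_m]
  note t_b = dominated_trans[OF t_m m_b]
  have part1: "(bounded_Hardy_Hinf p (Cesaro_op \<mu> \<gamma>) \<longleftrightarrow> compact_Hardy_Hinf p (Cesaro_op \<mu> \<gamma>)) \<and>
      (bounded_Hardy_Hinf p (Cesaro_op \<mu> \<gamma>) \<longleftrightarrow> seq_lq_norm p' (dyadic_seq \<mu> s) < \<infinity>) \<and>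
      (bounded_Hardy_Hinf p (Cesaro_op \<mu> \<gamma>) \<longleftrightarrow> tail_integral \<mu> \<gamma> p' < \<infinity>) \<and>
      (bounded_Hardy_Hinf p (Cesaro_op \<mu> \<gamma>) \<longleftrightarrow> F_fun \<mu> (\<gamma> + 1) \<in> Hardy p') \<and>
      (bounded_Hardy_Hinf p (Cesaro_op \<mu> \<gamma>) \<longleftrightarrow> moment_sum \<mu> \<gamma> p' < \<infinity>)"
    if \<mu>: "finite_borel_measure_01 \<mu>" for \<mu>
  proof -
    have bb: "bounded_Hardy_Hinf p (Cesaro_op \<mu> \<gamma>) \<longleftrightarrow> Nb \<mu> < \<infinity>"
      unfolding bounded_Cesaro_iff[OF \<mu> \<gamma>] Nop_def[symmetric]
      using dominated_finite[OF op_b \<mu>] dominated_finite[OF b_op \<mu>] by blast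
    have "compact_Hardy_Hinf p (Cesaro_op \<mu> \<gamma>) \<longleftrightarrow> Nb \<mu> < \<infinity>"
    proof
      assume "compact_Hardy_Hinf p (Cesaro_op \<mu> \<gamma>)"
      hence "Nop \<mu> < \<infinity>" unfolding Nop_def using p by (intro compact_imp_opnorm_finite[OF \<mu> \<gamma>]) auto
      thus "Nb \<mu> < \<infinity>" by (rule dominated_finite[OF b_op \<mu>])
    next
      assume fin: "Nb \<mu> < \<infinity>"
      hence "bounded_Hardy_Hinf p (Cesaro_op \<mu> \<gamma>)" using bb by blast
      thus "compact_Hardy_Hinf p (Cesaro_op \<mu> \<gamma>)"
        using fin by (intro compact_Cesaro[OF p \<mu> \<gamma> s]) (auto simp: bounded_Hardy_Hinf_def Nb_def)
    qed
    moreover have "tail_integral \<mu> \<gamma> p' < \<infinity> \<longleftrightarrow> Nb \<mu> < \<infinity>"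
    proof -
      \<comment> \<open>The total mass is finite, so adding its power does not affect
        finiteness.\<close>
      have "Nt \<mu> < \<infinity> \<longleftrightarrow> tail_integral \<mu> \<gamma> p' < \<infinity>"
        unfolding Nt_def enn_powr_less_top_iff
        by (cases "tail_integral \<mu> \<gamma> p'") (auto simp flip: ennreal_plus)
      thus ?thesis using dominated_finite[OF t_b \<mu>] dominated_finite[OF b_t \<mu>] by blast
    qed
    moreover have "F_fun \<mu> (\<gamma> + 1) \<in> Hardy p' \<longleftrightarrow> Nb \<mu> < \<infinity>"
      using dominated_finite[OF F_b \<mu>] dominated_finite[OF b_F \<mu>] F_fun_holomorphic[OF \<mu>, of "\<gamma> + 1"] \<gamma>
      by (auto simp: Hardy_def NF_def)
    moreover have "moment_sum \<mu> \<gamma> p' < \<infinity> \<longleftrightarrow> Nb \<mu> < \<infinity>"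
      using dominated_finite[OF m_b \<mu>] dominated_finite[OF b_m \<mu>]
      unfolding Nm_def enn_powr_less_top_iff by blast
    ultimately show ?thesis using bb by (simp add: Nb_def)
  qed
  obtain K1 where K1: "K1 > 0" "\<And>K \<mu>. K \<ge> K1 \<Longrightarrow> finite_borel_measure_01 \<mu> \<Longrightarrow> comparable K (Nop \<mu>) (NF \<mu>)"
    using dominated_imp_comparable[OF dominated_trans[OF op_b b_F] dominated_trans[OF F_b b_op]] by blast
  obtain K2 where K2: "K2 > 0" "\<And>K \<mu>. K \<ge> K2 \<Longrightarrow> finite_borel_measure_01 \<mu> \<Longrightarrow> comparable K (NF \<mu>) (NP \<mu>)"
    using dominated_imp_comparable[OF F_P dominated_trans[OF P_b b_F]] by blast
  obtain K3 where K3: "K3 > 0" "\<And>K \<mu>. K \<ge> K3 \<Longrightarrow> finite_borel_measure_01 \<mu> \<Longrightarrow> comparable K (NP \<mu>) (Nb \<mu>)"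
    using dominated_imp_comparable[OF P_b dominated_trans[OF b_F F_P]] by blast
  obtain K4 where K4: "K4 > 0" "\<And>K \<mu>. K \<ge> K4 \<Longrightarrow> finite_borel_measure_01 \<mu> \<Longrightarrow> comparable K (Nb \<mu>) (Nm \<mu>)"
    using dominated_imp_comparable[OF b_m m_b] by blast
  obtain K5 where K5: "K5 > 0" "\<And>K \<mu>. K \<ge> K5 \<Longrightarrow> finite_borel_measure_01 \<mu> \<Longrightarrow> comparable K (Nm \<mu>) (Nt \<mu>)"
    using dominated_imp_comparable[OF dominated_trans[OF m_b b_t] t_m] by blast
  define K where "K = max (max K1 K2) (max K3 (max K4 K5))"
  have K: "K > 0" "K \<ge> K1" "K \<ge> K2" "K \<ge> K3" "K \<ge> K4" "K \<ge> K5" using K1(1) by (auto simp: K_def)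
  show ?thesis
    using part1 K(1) K1(2)[OF K(2)] K2(2)[OF K(3)] K3(2)[OF K(4)] K4(2)[OF K(5)] K5(2)[OF K(6)]
    unfolding Nop_def NF_def NP_def Nb_def Nm_def Nt_def by blast
qed

end
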